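(* Let $\Delta Y=Z\Delta X+\varepsilon$ with $\Delta X$ a random vector in $\mathbb R^p$, $Z\in\mathbb R^{q\times p}$ and $\varepsilon$ a random vector in $\mathbb R^q$, as in the context. Assume $\operatorname{rk}(\mathbb I_p-MZ)=p$, $p=q$ and $\operatorname{rk}Z=p$, and that in the ideal model $\mathcal L_{\mathrm{id}}(\varepsilon)=\mathcal N_q(0,V)$ with $\varepsilon$ independent of $\Delta X$. Then the following are equivalent: (i) $\mathrm E_{\mathrm{id}}[\Delta X\mid\Delta Y]$ is linear in $\Delta Y$; (ii) $\mathcal L_{\mathrm{id}}(\Delta X)$ is normal; (iii) for all $e\in\mathbb R^p$ (and almost all $y$), $$M_3(e):=\mathrm E_{\mathrm{id}}\Big[\big(e^\tau(\Delta X-\mathrm E_{\mathrm{id}}[\Delta X\mid\Delta Y])\big)^3\,\Big|\,\Delta Y=y\Big]=0.$$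
   Context: $\Delta X$ is the prediction error of a filter in a linear state space model with observation equation $Y=ZX+\varepsilon$ (time index omitted); it is centered, $\mathrm E\Delta X=0$, with finite covariance $\Sigma$, and $\Delta Y=Z\Delta X+\varepsilon$ is the observation innovation. Subscript "id" refers to the ideal model. $M$ is the matrix of the (best) linear reconstruction of $\Delta X$ from $\Delta Y$, i.e. $M=\operatorname{Cov}(\Delta X,\Delta Y)(\operatorname{Var}\Delta Y)^-=\Sigma Z^\tau(Z\Sigma Z^\tau+V)^-$ (Moore–Penrose inverse; the Kalman gain), which in case (i) is the matrix with $\mathrm E_{\mathrm{id}}[\Delta X|\Delta Y]=M\Delta Y$. $\mathbb I_p$ is the $p\times p$ identity matrix. *)

theory Defs
  imports "HOL-Probability.Probability"
begin

section \<open>The Moore--Penrose inverse\<close>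

definition is_moore_penrose :: "real^'n^'m \<Rightarrow> real^'m^'n \<Rightarrow> bool" where
  "is_moore_penrose A G \<longleftrightarrow>
     A ** G ** A = A \<and> G ** A ** G = G \<and>
     transpose (A ** G) = A ** G \<and> transpose (G ** A) = G ** A"

definition moore_penrose :: "real^'n^'m \<Rightarrow> real^'m^'n" where
  "moore_penrose A = (THE G. is_moore_penrose A G)"

lemma is_moore_penrose_unique:
  assumes "is_moore_penrose A G" "is_moore_penrose A H"
  shows "G = H"
proof -
  have AG: "A ** G = A ** H"
  proof -
    have "A ** G = transpose (A ** G)" using assms(1) by (simp add: is_moore_penrose_def)
    also have "\<dots> = transpose ((A ** H) ** (A ** G))"
      using assms(2) by (simp add: is_moore_penrose_def matrix_mul_assoc)
    also have "\<dots> = (A ** G) ** (A ** H)"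
      using assms unfolding is_moore_penrose_def by (metis matrix_transpose_mul)
    also have "\<dots> = A ** H" using assms(1) by (simp add: is_moore_penrose_def matrix_mul_assoc)
    finally show ?thesis .
  qed
  have GA: "G ** A = H ** A"
  proof -
    have "G ** A = transpose (G ** A)" using assms(1) by (simp add: is_moore_penrose_def)
    also have "\<dots> = transpose ((G ** A) ** (H ** A))"
      using assms(2) by (metis is_moore_penrose_def matrix_mul_assoc)
    also have "\<dots> = (H ** A) ** (G ** A)"
      using assms unfolding is_moore_penrose_def by (metis matrix_transpose_mul)
    also have "\<dots> = H ** A" using assms(1) by (metis is_moore_penrose_def matrix_mul_assoc)
    finally show ?thesis .
  qed
  have "G = G ** A ** G" using assms(1) by (simp add: is_moore_penrose_def)
  also have "\<dots> = H ** (A ** G)" by (simp add: GA matrix_mul_assoc)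
  also have "\<dots> = H ** A ** H" by (simp add: AG matrix_mul_assoc)
  also have "\<dots> = H" using assms(2) by (simp add: is_moore_penrose_def)
  finally show ?thesis .
qed

lemma matrix_gram_left_cancel:
  fixes A :: "real^'n^'m" and B C :: "real^'k^'n"
  assumes "transpose A ** A ** B = transpose A ** A ** C"
  shows "A ** B = A ** C"
proof -
  have "A *v (B *v x) = A *v (C *v x)" for x
  proof -
    let ?d = "B *v x - C *v x"
    have "(transpose A ** A ** B) *v x = (transpose A ** A ** C) *v x" using assms by simp
    then have 0: "transpose A *v (A *v ?d) = 0"
      by (simp add: matrix_vector_mul_assoc matrix_vector_mult_diff_distrib matrix_mul_assoc)
    have "(A *v ?d) \<bullet> (A *v ?d) = (transpose A *v (A *v ?d)) \<bullet> ?d"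
      by (metis dot_lmul_matrix inner_commute transpose_matrix_vector)
    then have "A *v ?d = 0" using 0 by simp
    then show ?thesis by (simp add: matrix_vector_mult_diff_distrib)
  qed
  then show ?thesis by (simp add: matrix_eq matrix_vector_mul_assoc)
qed

lemma generalized_inverse_exists:
  fixes A :: "real^'n^'m"
  shows "\<exists>K :: real^'m^'n. A ** K ** A = A"
proof -
  obtain g :: "real^'m \<Rightarrow> real^'n" where g: "linear g" "\<forall>v\<in>range ((*v) A). A *v g v = v"
    using linear_exists_right_inverse_on[of "(*v) A" UNIV] by auto
  have "A ** matrix g ** A = A"
    using g by (simp add: matrix_eq matrix_vector_mul_assoc[symmetric] matrix_works)
  then show ?thesis by blast
qed

lemma gram_generalized_inverse:
  fixes A :: "real^'n^'m"
  obtains L where "A ** L ** transpose A ** A = A"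
    and "transpose (A ** L ** transpose A) = A ** L ** transpose A"
proof -
  obtain L where L: "(transpose A ** A) ** L ** (transpose A ** A) = transpose A ** A"
    using generalized_inverse_exists by blast
  have c: "A ** N ** transpose A ** A = A"
    if "(transpose A ** A) ** N ** (transpose A ** A) = transpose A ** A" for N
    using matrix_gram_left_cancel[of A "N ** (transpose A ** A)" "mat 1"] that
    by (simp add: matrix_mul_assoc)
  define E where "E = A ** L ** transpose A"
  have EA: "E ** A = A" using c[OF L] by (simp add: E_def)
  have "E ** transpose E = transpose E"
    using EA by (simp add: E_def matrix_transpose_mul matrix_mul_assoc)
  then have "transpose E = E"
    by (metis matrix_transpose_mul transpose_transpose)
  then show ?thesis using that EA by (simp add: E_def)
qed

lemma is_moore_penrose_moore_penrose: "is_moore_penrose A (moore_penrose A)"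
proof -
  obtain L where L: "A ** L ** transpose A ** A = A"
    and Ls: "transpose (A ** L ** transpose A) = A ** L ** transpose A"
    by (rule gram_generalized_inverse)
  obtain K where K: "transpose A ** K ** A ** transpose A = transpose A"
    and Ks: "transpose (transpose A ** K ** A) = transpose A ** K ** A"
    using gram_generalized_inverse[of "transpose A"] by auto
  define G where "G = transpose A ** K ** A ** L ** transpose A"
  have K': "A ** transpose A ** K ** A = A"
  proof -
    have "transpose (transpose A ** K ** A ** transpose A) = A" using K by simp
    then have "A ** (transpose A ** K ** A) = A"
      using Ks by (simp only: matrix_transpose_mul[of "transpose A ** K ** A"] transpose_transpose)
    then show ?thesis by (simp add: matrix_mul_assoc)
  qed
  have AG: "A ** G = A ** L ** transpose A" using K' by (simp add: G_def matrix_mul_assoc)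
  have GA: "G ** A = transpose A ** K ** A"
    using L unfolding G_def by (metis matrix_mul_assoc)
  have "G ** A ** G = transpose A ** K ** (A ** transpose A ** K ** A) ** L ** transpose A"
    unfolding GA unfolding G_def by (simp only: matrix_mul_assoc)
  then have "G ** A ** G = G"
    unfolding K' G_def .
  then have "is_moore_penrose A G"
    unfolding is_moore_penrose_def using AG GA L Ls Ks by auto
  then have "\<exists>!G. is_moore_penrose A G" by (blast intro: is_moore_penrose_unique)
  then show ?thesis unfolding moore_penrose_def by (rule theI')
qed

section \<open>Random vectors\<close>

definition cross_covariance ::
    "'a measure \<Rightarrow> ('a \<Rightarrow> real^'n) \<Rightarrow> ('a \<Rightarrow> real^'m) \<Rightarrow> real^'m^'n" where
  "cross_covariance P X Y = (\<chi> i j.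
     \<integral>\<omega>. (X \<omega> $ i - (\<integral>\<omega>'. X \<omega>' $ i \<partial>P)) * (Y \<omega> $ j - (\<integral>\<omega>'. Y \<omega>' $ j \<partial>P)) \<partial>P)"

definition generated_sigma :: "'a measure \<Rightarrow> ('a \<Rightarrow> 'b::topological_space) \<Rightarrow> 'a measure" where
  "generated_sigma P Y = vimage_algebra (space P) Y borel"

(* prob_space.indep_var requires both variables to have the same type, hence this variant. *)
definition indep_random_vectors ::
    "'a measure \<Rightarrow> ('a \<Rightarrow> 'b::topological_space) \<Rightarrow> ('a \<Rightarrow> 'c::topological_space) \<Rightarrow> bool" where
  "indep_random_vectors P X Y \<longleftrightarrow>
     prob_space.indep_set P (sets (generated_sigma P X)) (sets (generated_sigma P Y))"

text \<open>Normal laws are allowed to be degenerate: the variance \<open>0\<close> gives a point mass.\<close>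

definition univariate_normal :: "real \<Rightarrow> real \<Rightarrow> real measure" where
  "univariate_normal m v =
     (if v = 0 then return borel m else density lborel (\<lambda>x. ennreal (normal_density m (sqrt v) x)))"

text \<open>A law on \<open>\<real>\<^sup>n\<close> is \<open>N(\<mu>, V)\<close> if each linear functional \<open>t\<close> has law \<open>N(t \<bullet> \<mu>, t \<bullet> V t)\<close>.
  Symmetry makes \<open>V\<close> unique, and nonnegativity is needed because
  \<^const>\<open>normal_density\<close> only depends on the absolute value of the variance parameter.\<close>

definition multivariate_normal :: "real^'n \<Rightarrow> real^'n^'n \<Rightarrow> (real^'n) measure \<Rightarrow> bool" where
  "multivariate_normal \<mu> V N \<longleftrightarrow>
     sets N = sets borel \<and> transpose V = V \<and>
     (\<forall>t. 0 \<le> t \<bullet> (V *v t) \<and>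
          distr N borel (\<lambda>x. t \<bullet> x) = univariate_normal (t \<bullet> \<mu>) (t \<bullet> (V *v t)))"

definition is_normal_law :: "(real^'n) measure \<Rightarrow> bool" where
  "is_normal_law N \<longleftrightarrow> (\<exists>\<mu> V. multivariate_normal \<mu> V N)"

section \<open>Conditional expectations given a random vector\<close>

definition cond_exp_vec ::
    "'a measure \<Rightarrow> ('a \<Rightarrow> real^'n) \<Rightarrow> ('a \<Rightarrow> real^'m) \<Rightarrow> 'a \<Rightarrow> real^'n" where
  "cond_exp_vec P X Y \<omega> = (\<chi> i. real_cond_exp P (generated_sigma P Y) (\<lambda>\<omega>'. X \<omega>' $ i) \<omega>)"

text \<open>\<open>h\<close> is a version of \<open>y \<mapsto> E[f | Y = y]\<close>. For \<open>f\<close> that is not integrable,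
  \<^const>\<open>real_cond_exp\<close> is the difference of the conditional expectations of the positive and the
  negative part of \<open>f\<close>; this is the usual generalized conditional expectation as long as both
  are almost surely finite.\<close>

definition is_cond_exp_given ::
    "'a measure \<Rightarrow> ('a \<Rightarrow> real) \<Rightarrow> ('a \<Rightarrow> real^'m) \<Rightarrow> (real^'m \<Rightarrow> real) \<Rightarrow> bool" where
  "is_cond_exp_given P f Y h \<longleftrightarrow> h \<in> borel_measurable borel \<and>
     (AE \<omega> in P. h (Y \<omega>) = real_cond_exp P (generated_sigma P Y) f \<omega>)"

end

theory Submission
  imports Defs
begin

text \<open>
  Write \<open>X\<close>, \<open>Y = Z X + \<epsilon>\<close>, \<open>W = Z X\<close> for the three vectors, \<open>R = X - M Y\<close> for the error of the best
  linear reconstruction, and \<open>\<Sigma>\<close> for the covariance of \<open>X\<close>. Three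
  implications are proved: normality implies both other conditions, linearity implies normality, and
  vanishing third moments imply linearity.

  \<^bold>\<open>Normal implies linear and symmetric.\<close> The matrix \<open>M\<close> makes \<open>R\<close> and \<open>Y\<close> uncorrelated
  (\<open>R_orthogonal\<close>). If \<open>X\<close> is normal, then \<open>(R, Y)\<close> is jointly normal, and changing the sign of \<open>R\<close> does
  not change its characteristic function, hence not its law (\<open>symmetric_law_R_Y\<close>). Therefore every odd
  function of \<open>R\<close> has conditional expectation zero given \<open>Y\<close> (\<open>real_cond_exp_odd_eq_0\<close>). The linear
  functionals of \<open>R\<close> give \<open>E[X | Y] = M Y\<close>, and their cubes give the statement on third moments.

  \<^bold>\<open>Linear implies normal.\<close> If \<open>E[X | Y]\<close> is linear, it is \<open>M Y\<close>. Testing \<open>E[R | Y] = 0\<close> against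
  \<open>exp (i u \<bullet> Y)\<close> and splitting \<open>X\<close> from the independent Gaussian noise gives, because \<open>1 - M Z\<close> is
  invertible and \<open>Z\<close> injective, the differential equation \<open>f' s = - s (c \<bullet> \<Sigma> c) f s\<close> for the
  characteristic function \<open>f\<close> of each \<open>c \<bullet> X\<close>. Its solution is the one of a normal law
  (\<open>linear_imp_normal\<close>).

  \<^bold>\<open>Vanishing third moments imply linear.\<close> The rank condition on \<open>1 - M Z\<close> forces \<open>W\<close> to live on the range
  of \<open>V\<close> (\<open>W_kernel\<close>), so that a shift of the noise by \<open>W\<close> is absolutely continuous, also if \<open>V\<close> is
  singular; the density is the one of Cameron and Martin. Bayes' formula (\<open>bayes_formula\<close>) then
  identifies the conditional laws of \<open>W\<close> given \<open>Y = V \<eta>\<close>: they are the members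
  \<open>exp (w \<bullet> \<eta>) \<nu>(dw) / L \<eta>\<close> of one exponential family, in which all exponential moments are finite.
  The third conditional central moments are the third derivatives of \<open>ln L\<close> along lines. If they vanish
  for almost every \<open>y\<close>, then by quasi-invariance of the noise law under shifts and by continuity they
  vanish for all \<open>\<eta>\<close> (\<open>third_cumulant_0_everywhere\<close>). So \<open>ln L\<close> is quadratic on every line through the
  origin, hence a quadratic polynomial, and its gradient, the conditional mean of \<open>W\<close>, is affine
  (\<open>affine_mean_if_third_cumulants_vanish\<close>).

  Both uses of Fourier analysis in several dimensions rest on the theorem that a finite measure on a
  Euclidean space is determined by its characteristic function (\<open>finite_measure_eqI_char\<close>).
\<close>

section \<open>Characteristic functions determine finite measures\<close>

text \<open>The total mass is the value of the characteristic function at zero, so normalizing reduces the claim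
  to Levy's theorem for probability measures.\<close>

lemma finite_measure_real_eqI_char:
  fixes M N :: "real measure"
  assumes fin: "finite_measure M" "finite_measure N"
    and sets: "sets M = sets borel" "sets N = sets borel"
    and char: "\<And>t. (\<integral>x. iexp (t * x) \<partial>M) = (\<integral>x. iexp (t * x) \<partial>N)"
  shows "M = N"
proof -
  interpret M: finite_measure M by fact
  interpret N: finite_measure N by fact
  have sp: "space M = UNIV" "space N = UNIV"
    using sets by (auto dest: sets_eq_imp_space_eq)
  define m where "m = measure M UNIV"
  have mN: "measure N UNIV = m"
    using char[of 0] by (simp add: sp m_def)
  have em: "emeasure M UNIV = ennreal m" "emeasure N UNIV = ennreal m"
    using M.emeasure_eq_measure N.emeasure_eq_measure mN by (auto simp: m_def)
  show ?thesis
  proof (cases "m = 0")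
    case True
    show ?thesis
    proof (rule measure_eqI)
      show "sets M = sets N" using sets by simp
      fix A assume "A \<in> sets M"
      have "emeasure M A \<le> emeasure M UNIV" "emeasure N A \<le> emeasure N UNIV"
        using \<open>A \<in> sets M\<close> sets sp by (metis emeasure_space)+
      then show "emeasure M A = emeasure N A" using em True by simp
    qed
  next
    case False
    then have m: "m > 0" using m_def measure_nonneg[of M UNIV] by linarith
    let ?D = "\<lambda>K :: real measure. density K (\<lambda>_. ennreal (1 / m))"
    have rd: "real_distribution (?D K)"
      if K: "sets K = sets borel" "emeasure K UNIV = ennreal m" for K
    proof -
      have "space K = UNIV" using K by (auto dest: sets_eq_imp_space_eq)
      then have "prob_space (?D K)"
        using K m by (intro prob_spaceI) (simp add: emeasure_density ennreal_mult'[symmetric])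
      then show ?thesis
        using K \<open>space K = UNIV\<close>
        by (simp add: real_distribution_def real_distribution_axioms_def)
    qed
    have "?D M = ?D N"
    proof (rule Levy_uniqueness)
      show "real_distribution (?D M)" "real_distribution (?D N)"
        using rd sets em by auto
      have i: "char (?D K) t = (1 / m) *\<^sub>R (\<integral>x. iexp (t * x) \<partial>K)"
        if "sets K = sets borel" for K :: "real measure" and t
      proof -
        have [measurable]: "(\<lambda>x. iexp (t * x)) \<in> borel_measurable K"
          using that by (simp cong: measurable_cong_sets)
        show ?thesis
          using m unfolding char_def by (subst integral_density) (auto simp del: of_real_mult)
      qed
      show "char (?D M) = char (?D N)"
        using i sets char by (intro ext) simp
    qed
    show ?thesis
    proof (rule measure_eqI)
      show "sets M = sets N" using sets by simp
      fix A assume A: "A \<in> sets M"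
      have "emeasure (?D M) A = emeasure (?D N) A" using \<open>?D M = ?D N\<close> by simp
      then have "ennreal (1 / m) * emeasure M A = ennreal (1 / m) * emeasure N A"
        using A sets by (simp add: emeasure_density nn_integral_cmult_indicator)
      then show "emeasure M A = emeasure N A"
        using m by (simp add: ennreal_mult_cancel_left)
    qed
  qed
qed

text \<open>The induction step for several dimensions: equality of all Fourier transforms of \<open>g M\<close> and \<open>g N\<close>
  survives the restriction to \<open>x \<bullet> j \<in> B\<close>. One-dimensional uniqueness needs nonnegative measures, whereas
  \<open>g x * exp (i b \<bullet> x)\<close> is complex; but \<open>g (1 + cos (b \<bullet> x))\<close> and \<open>g (1 + sin (b \<bullet> x))\<close> are nonnegative,
  their Fourier transforms are combinations of those of \<open>g\<close>, and together with \<open>g\<close> they span what is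
  needed.\<close>

lemma weighted_char_restrict:
  fixes M N :: "'a::euclidean_space measure" and g :: "'a \<Rightarrow> real" and j :: 'a
  assumes fin: "finite_measure M" "finite_measure N"
    and sets: "sets M = sets borel" "sets N = sets borel"
    and g[measurable]: "g \<in> borel_measurable borel" and g01: "\<And>x. 0 \<le> g x" "\<And>x. g x \<le> 1"
    and char: "\<And>b. (\<integral>x. g x *\<^sub>R iexp (b \<bullet> x) \<partial>M) = (\<integral>x. g x *\<^sub>R iexp (b \<bullet> x) \<partial>N)"
    and B[measurable]: "B \<in> sets borel"
  shows "(\<integral>x. (g x * indicator B (x \<bullet> j)) *\<^sub>R iexp (b \<bullet> x) \<partial>M) =
    (\<integral>x. (g x * indicator B (x \<bullet> j)) *\<^sub>R iexp (b \<bullet> x) \<partial>N)"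
proof -
  have bdd: "integrable K f"
    if K: "K = M \<or> K = N" and f: "f \<in> borel_measurable borel" and c: "\<And>x. norm (f x) \<le> 2"
    for K and f :: "'a \<Rightarrow> 'z::{banach, second_countable_topology}"
  proof -
    have "finite_measure K" "sets K = sets borel" using K fin sets by auto
    then show ?thesis
      using f c by (intro finite_measure.integrable_const_bound[where B = 2])
        (auto cong: measurable_cong_sets)
  qed
  have abs2: "\<bar>g x * u\<bar> \<le> 2" if "\<bar>u\<bar> \<le> 2" for x and u :: real
    using mult_mono[of "\<bar>g x\<bar>" 1 "\<bar>u\<bar>" 2] g01[of x] that by (simp add: abs_mult)
  have nrm: "norm (g x *\<^sub>R iexp u) \<le> 2" for x u
    using abs2[of 1 x] by simp
  \<comment> \<open>Such a \<open>\<phi>\<close> makes \<open>g \<phi>\<close> a nonnegative density, and one-dimensional uniqueness applies to its image under \<open>x \<mapsto> x \<bullet> j\<close>.\<close>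
  have key: "(\<integral>x. g x * \<phi> x * indicator B (x \<bullet> j) \<partial>M) = (\<integral>x. g x * \<phi> x * indicator B (x \<bullet> j) \<partial>N)"
    if \<phi>[measurable]: "\<phi> \<in> borel_measurable borel" and \<phi>02: "\<And>x. 0 \<le> \<phi> x" "\<And>x. \<phi> x \<le> 2"
      and c: "\<And>b. (\<integral>x. (g x * \<phi> x) *\<^sub>R iexp (b \<bullet> x) \<partial>M) = (\<integral>x. (g x * \<phi> x) *\<^sub>R iexp (b \<bullet> x) \<partial>N)"
    for \<phi>
  proof -
    let ?D = "\<lambda>K. distr (density K (\<lambda>x. ennreal (g x * \<phi> x))) borel (\<lambda>x. x \<bullet> j)"
    have gp: "0 \<le> g x * \<phi> x" "g x * \<phi> x \<le> 2" for x
      using g01[of x] \<phi>02[of x] abs2[of "\<phi> x" x] by auto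
    have D: "finite_measure (?D K)" "(\<integral>x. iexp (t * x) \<partial>?D K) = (\<integral>x. (g x * \<phi> x) *\<^sub>R iexp ((t *\<^sub>R j) \<bullet> x) \<partial>K)"
       "measure (?D K) B = (\<integral>x. g x * \<phi> x * indicator B (x \<bullet> j) \<partial>K)"
      if K: "K = M \<or> K = N" for K t
    proof -
      have sK[measurable_cong]: "sets K = sets borel" using K sets by auto
      have sp: "space K = UNIV" using sK by (auto dest: sets_eq_imp_space_eq)
      have "integrable K (\<lambda>x. g x * \<phi> x)" using gp by (intro bdd K) (auto simp: abs_of_nonneg)
      then have "finite_measure (density K (\<lambda>x. ennreal (g x * \<phi> x)))"
        using gp by (intro finite_measureI) (auto simp: emeasure_density sp nn_integral_eq_integral)
      then show fD: "finite_measure (?D K)"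
        by (rule finite_measure.finite_measure_distr) measurable
      show "(\<integral>x. iexp (t * x) \<partial>?D K) = (\<integral>x. (g x * \<phi> x) *\<^sub>R iexp ((t *\<^sub>R j) \<bullet> x) \<partial>K)"
        using gp by (subst integral_distr, simp, simp, subst integral_density)
          (auto simp: inner_commute)
      have "measure (?D K) B = (\<integral>x. indicator B x \<partial>?D K)" by simp
      also have "\<dots> = (\<integral>x. g x * \<phi> x * indicator B (x \<bullet> j) \<partial>K)"
        using gp by (subst integral_distr, simp, simp, subst integral_density) (auto simp: mult_ac)
      finally show "measure (?D K) B = (\<integral>x. g x * \<phi> x * indicator B (x \<bullet> j) \<partial>K)" .
    qed
    have "?D M = ?D N"
      by (rule finite_measure_real_eqI_char) (auto simp only: D simp_thms c sets_distr)
    then show ?thesis using D(3)[of M] D(3)[of N] by simp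
  qed
  have int_e: "integrable K (\<lambda>x. g x *\<^sub>R iexp (b' \<bullet> x))" if "K = M \<or> K = N" for K b'
    by (rule bdd[OF that _ nrm]) measurable
  have lin: "(\<integral>x. g x *\<^sub>R iexp (b1 \<bullet> x) + (c * (g x *\<^sub>R iexp (b2 \<bullet> x)) + d * (g x *\<^sub>R iexp (b3 \<bullet> x))) \<partial>K) =
      (\<integral>x. g x *\<^sub>R iexp (b1 \<bullet> x) \<partial>K) +
      (c * (\<integral>x. g x *\<^sub>R iexp (b2 \<bullet> x) \<partial>K) + d * (\<integral>x. g x *\<^sub>R iexp (b3 \<bullet> x) \<partial>K))"
    if K: "K = M \<or> K = N" for K b1 b2 b3 c d
    by (simp only: int_e[OF K] Bochner_Integration.integral_add Bochner_Integration.integrable_add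
        integrable_mult_right integral_mult_right_zero)
  have one: "(\<integral>x. g x * indicator B (x \<bullet> j) \<partial>M) = (\<integral>x. g x * indicator B (x \<bullet> j) \<partial>N)"
    using key[of "\<lambda>_. 1"] char by simp
  have cos: "(\<integral>x. g x * (1 + cos (b \<bullet> x)) * indicator B (x \<bullet> j) \<partial>M) =
      (\<integral>x. g x * (1 + cos (b \<bullet> x)) * indicator B (x \<bullet> j) \<partial>N)"
  proof (rule key)
    fix b'
    have e: "(g x * (1 + cos (b \<bullet> x))) *\<^sub>R iexp (b' \<bullet> x) = g x *\<^sub>R iexp (b' \<bullet> x)
        + ((1/2) * (g x *\<^sub>R iexp ((b' + b) \<bullet> x)) + (1/2) * (g x *\<^sub>R iexp ((b' - b) \<bullet> x)))" for x
    proof -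
      have "complex_of_real (cos (b \<bullet> x)) = (iexp (b \<bullet> x) + iexp (- (b \<bullet> x))) / 2"
        by (simp add: cos_of_real[symmetric] cos_exp_eq)
      moreover have "iexp ((b' + b) \<bullet> x) = iexp (b' \<bullet> x) * iexp (b \<bullet> x)"
        "iexp ((b' - b) \<bullet> x) = iexp (b' \<bullet> x) * iexp (- (b \<bullet> x))"
        by (simp_all add: inner_add_left inner_diff_left algebra_simps flip: exp_add)
      ultimately show ?thesis
        unfolding scaleR_conv_of_real of_real_mult of_real_add by (simp only:) (simp add: field_simps)
    qed
    show "(\<integral>x. (g x * (1 + cos (b \<bullet> x))) *\<^sub>R iexp (b' \<bullet> x) \<partial>M) = (\<integral>x. (g x * (1 + cos (b \<bullet> x))) *\<^sub>R iexp (b' \<bullet> x) \<partial>N)"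
      unfolding e by (simp only: lin simp_thms char)
  qed (auto simp: add_increasing2 intro!: order_trans[OF add_left_mono[OF cos_le_one]]
      intro: order_trans[OF _ add_left_mono[OF cos_ge_minus_one]])
  have sin: "(\<integral>x. g x * (1 + sin (b \<bullet> x)) * indicator B (x \<bullet> j) \<partial>M) =
      (\<integral>x. g x * (1 + sin (b \<bullet> x)) * indicator B (x \<bullet> j) \<partial>N)"
  proof (rule key)
    fix b'
    have e: "(g x * (1 + sin (b \<bullet> x))) *\<^sub>R iexp (b' \<bullet> x) = g x *\<^sub>R iexp (b' \<bullet> x)
        + ((- \<i>/2) * (g x *\<^sub>R iexp ((b' + b) \<bullet> x)) + (\<i>/2) * (g x *\<^sub>R iexp ((b' - b) \<bullet> x)))" for x
    proof -
      have "complex_of_real (sin (b \<bullet> x)) = - \<i> * (iexp (b \<bullet> x) - iexp (- (b \<bullet> x))) / 2"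
        by (simp add: sin_of_real[symmetric] sin_exp_eq divide_simps)
      moreover have "iexp ((b' + b) \<bullet> x) = iexp (b' \<bullet> x) * iexp (b \<bullet> x)"
        "iexp ((b' - b) \<bullet> x) = iexp (b' \<bullet> x) * iexp (- (b \<bullet> x))"
        by (simp_all add: inner_add_left inner_diff_left algebra_simps flip: exp_add)
      ultimately show ?thesis
        unfolding scaleR_conv_of_real of_real_mult of_real_add by (simp only:) (simp add: field_simps)
    qed
    show "(\<integral>x. (g x * (1 + sin (b \<bullet> x))) *\<^sub>R iexp (b' \<bullet> x) \<partial>M) = (\<integral>x. (g x * (1 + sin (b \<bullet> x))) *\<^sub>R iexp (b' \<bullet> x) \<partial>N)"
      unfolding e by (simp only: lin simp_thms char)
  qed (auto simp: add_increasing2 intro!: order_trans[OF add_left_mono[OF sin_le_one]]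
      intro: order_trans[OF _ add_left_mono[OF sin_ge_minus_one]])
  have split: "(\<integral>x. (g x * indicator B (x \<bullet> j)) *\<^sub>R iexp (b \<bullet> x) \<partial>K) =
      of_real ((\<integral>x. g x * (1 + cos (b \<bullet> x)) * indicator B (x \<bullet> j) \<partial>K))
      + \<i> * of_real ((\<integral>x. g x * (1 + sin (b \<bullet> x)) * indicator B (x \<bullet> j) \<partial>K))
      - (1 + \<i>) * of_real ((\<integral>x. g x * indicator B (x \<bullet> j) \<partial>K))"
    if K: "K = M \<or> K = N" for K
  proof -
    have e: "(g x * indicator B (x \<bullet> j)) *\<^sub>R iexp (b \<bullet> x) =
        of_real (g x * (1 + cos (b \<bullet> x)) * indicator B (x \<bullet> j))
      + \<i> * of_real (g x * (1 + sin (b \<bullet> x)) * indicator B (x \<bullet> j))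
      - (1 + \<i>) * of_real (g x * indicator B (x \<bullet> j))" for x
      by (simp add: complex_eq_iff Re_exp Im_exp algebra_simps)
    have u: "\<bar>g x * u * indicator B (x \<bullet> j)\<bar> \<le> 2" if "\<bar>u\<bar> \<le> 2" for x u
      using abs2[OF that, of x] by (auto simp: indicator_def)
    have c1: "\<bar>1 + cos y\<bar> \<le> 2" "\<bar>1 + sin y\<bar> \<le> 2" for y :: real
      using cos_ge_minus_one[of y] cos_le_one[of y] sin_ge_minus_one[of y] sin_le_one[of y] by linarith+
    have i: "integrable K (\<lambda>x. g x * (1 + cos (b \<bullet> x)) * indicator B (x \<bullet> j))"
        "integrable K (\<lambda>x. g x * (1 + sin (b \<bullet> x)) * indicator B (x \<bullet> j))"
        "integrable K (\<lambda>x. g x * indicator B (x \<bullet> j))"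
      using u[OF c1(1)] u[OF c1(2)] u[of 1] by (auto intro!: bdd[OF K])
    show ?thesis
      unfolding e
      by (subst Bochner_Integration.integral_diff Bochner_Integration.integral_add
            integral_mult_right_zero integral_complex_of_real;
          (intro Bochner_Integration.integrable_add integrable_mult_right integrable_of_real i)?)+
         simp
  qed
  show ?thesis by (simp only: split[of M] split[of N] one cos sin simp_thms)
qed

text \<open>Restricting the coordinates one after the other shows that the two measures agree on boxes, which
  form an intersection-stable generator of the Borel sets.\<close>

theorem finite_measure_eqI_char:
  fixes M N :: "'a::euclidean_space measure"
  assumes fin: "finite_measure M" "finite_measure N"
    and sets: "sets M = sets borel" "sets N = sets borel"
    and char: "\<And>t. (\<integral>x. iexp (t \<bullet> x) \<partial>M) = (\<integral>x. iexp (t \<bullet> x) \<partial>N)"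
  shows "M = N"
proof -
  interpret M: finite_measure M by fact
  interpret N: finite_measure N by fact
  have boxes: "(\<integral>x. (\<Prod>i\<in>I. indicator (A i) (x \<bullet> i)) *\<^sub>R iexp (b \<bullet> x) \<partial>M) =
      (\<integral>x. (\<Prod>i\<in>I. indicator (A i) (x \<bullet> i)) *\<^sub>R iexp (b \<bullet> x) \<partial>N)"
    if "finite I" and A: "\<And>i. A i \<in> sets borel" for I and A :: "'a \<Rightarrow> real set" and b
    using \<open>finite I\<close>
  proof (induction I arbitrary: b rule: finite_induct)
    case empty
    then show ?case using char by simp
  next
    case (insert j I)
    note [measurable] = A
    have p01: "0 \<le> (\<Prod>i\<in>I. indicator (A i) (x \<bullet> i) :: real)" "(\<Prod>i\<in>I. indicator (A i) (x \<bullet> i)) \<le> (1 :: real)" for x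
      by (auto intro!: prod_nonneg prod_le_1)
    show ?case
      using weighted_char_restrict[OF fin sets _ p01 insert.IH A[of j], of j b] insert.hyps
      by (simp add: mult.commute)
  qed
  have eqb: "emeasure M (box a b) = emeasure N (box a b)" for a b
  proof -
    have ind: "(\<Prod>i\<in>Basis. indicator {a \<bullet> i<..<b \<bullet> i} (x \<bullet> i)) = (indicator (box a b) x :: real)" for x
      by (auto simp: indicator_def box_def prod_zero_iff split: if_splits)
    have "(\<integral>x. (indicator (box a b) x *\<^sub>R 1 :: complex) \<partial>M) = (\<integral>x. indicator (box a b) x *\<^sub>R 1 \<partial>N)"
      using boxes[of Basis "\<lambda>i. {a \<bullet> i<..<b \<bullet> i}" 0] by (simp add: ind)
    moreover have int: "(\<integral>x. (indicator (box a b) x *\<^sub>R 1 :: complex) \<partial>K) = of_real (measure K (box a b))"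
      if "finite_measure K" "sets K = sets borel" for K
    proof -
      interpret K: finite_measure K by fact
      have "box a b \<in> sets K" using that by simp
      then show ?thesis
        by (subst integral_scaleR_left) (auto simp: K.emeasure_finite less_top[symmetric] scaleR_conv_of_real)
    qed
    ultimately have "of_real (measure M (box a b)) = (of_real (measure N (box a b)) :: complex)"
      using int[OF M.finite_measure_axioms sets(1)] int[OF N.finite_measure_axioms sets(2)] by simp
    then have "measure M (box a b) = measure N (box a b)"
      by simp
    then show ?thesis by (simp add: M.emeasure_eq_measure N.emeasure_eq_measure)
  qed
  show ?thesis
  proof (rule measure_eqI_generator_eq[where \<Omega> = UNIV and E = "range (\<lambda>(a, b). box a b)"
        and A = "\<lambda>i::nat. box (- (real i *\<^sub>R One)) (real i *\<^sub>R One)"])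
    show "Int_stable (range (\<lambda>(a, b). box a b :: 'a set))"
      by (auto simp: Int_stable_def box_Int_box)
    show "sets M = sigma_sets UNIV (range (\<lambda>(a, b). box a b))"
      "sets N = sigma_sets UNIV (range (\<lambda>(a, b). box a b))"
      using sets by (auto simp: borel_eq_box)
  qed (auto simp: eqb UN_box_eq_UNIV)
qed

section \<open>Normal laws\<close>

lemma prob_space_univariate_normal:
  assumes "0 \<le> v" shows "prob_space (univariate_normal m v)"
  using assms prob_space_normal_density[of "sqrt v" m] prob_space_return[of m borel]
  by (auto simp: univariate_normal_def)

lemma sets_univariate_normal[measurable_cong, simp]: "sets (univariate_normal m v) = sets borel"
  by (simp add: univariate_normal_def)

lemma integral_univariate_normal:
  fixes f :: "real \<Rightarrow> 'b::{banach, second_countable_topology}"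
  assumes "0 < v" and [measurable]: "f \<in> borel_measurable borel"
  shows "(\<integral>x. f x \<partial>univariate_normal m v) = (\<integral>x. normal_density m (sqrt v) x *\<^sub>R f x \<partial>lborel)"
    and "integrable (univariate_normal m v) f \<longleftrightarrow> integrable lborel (\<lambda>x. normal_density m (sqrt v) x *\<^sub>R f x)"
  using assms by (simp_all add: univariate_normal_def integral_density integrable_density)

lemma char_univariate_normal:
  assumes "0 \<le> v"
  shows "(\<integral>x. iexp (t * x) \<partial>univariate_normal m v) = iexp (t * m) * of_real (exp (- (t\<^sup>2 * v) / 2))"
proof (cases "v = 0")
  case True
  then show ?thesis by (simp add: univariate_normal_def integral_return)
next
  case False
  define s where "s = sqrt v"
  have s: "s > 0" "v = s\<^sup>2" using False assms by (auto simp: s_def)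
  have d: "s * normal_density m s (m + s * y) = std_normal_density y" for y
    using s by (simp add: normal_density_def real_sqrt_mult field_simps power2_eq_square)
  have "(\<integral>x. iexp (t * x) \<partial>univariate_normal m v) = (\<integral>x. normal_density m s x *\<^sub>R iexp (t * x) \<partial>lborel)"
    using False assms by (subst integral_univariate_normal) (auto simp: s_def)
  also have "\<dots> = s *\<^sub>R (\<integral>y. normal_density m s (m + s * y) *\<^sub>R iexp (t * (m + s * y)) \<partial>lborel)"
    using s by (subst lborel_integral_real_affine[where c = s and t = m]) auto
  also have "\<dots> = (\<integral>y. iexp (t * m) * (std_normal_density y *\<^sub>R iexp ((t * s) * y)) \<partial>lborel)"
    unfolding d[symmetric] 
    by (subst integral_scaleR_right[symmetric], rule Bochner_Integration.integral_cong)
       (simp_all add: scaleR_conv_of_real exp_add[symmetric] algebra_simps)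
  also have "\<dots> = iexp (t * m) * char std_normal_distribution (t * s)"
    unfolding char_def by (subst integral_density) (auto simp only: integral_mult_right_zero normal_density_nonneg AE_I2, measurable)
  finally show ?thesis
    using s by (simp del: of_real_mult add: char_std_normal_distribution power_mult_distrib)
qed

text \<open>Completing the square: the weight \<open>exp x\<close> turns \<open>N(0, v)\<close> into \<open>exp (v / 2)\<close> times \<open>N(v, v)\<close>.\<close>

lemma char_univariate_normal_tilted:
  assumes "0 \<le> v"
  shows "integrable (univariate_normal 0 v) (\<lambda>x. exp x)"
    and "(\<integral>x. exp x *\<^sub>R iexp (a * x) \<partial>univariate_normal 0 v) =
      exp (v / 2) *\<^sub>R (iexp (a * v) * of_real (exp (- (a\<^sup>2 * v) / 2)))"
proof -
  have "integrable (univariate_normal 0 v) (\<lambda>x. exp x) \<and>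
      (\<integral>x. exp x *\<^sub>R iexp (a * x) \<partial>univariate_normal 0 v) =
      exp (v / 2) *\<^sub>R (iexp (a * v) * of_real (exp (- (a\<^sup>2 * v) / 2)))"
  proof (cases "v = 0")
    case True
    have "integrable (return borel (0::real)) (\<lambda>x. exp x)"
      by (simp add: integrable_iff_bounded nn_integral_return)
    then show ?thesis using True by (simp add: univariate_normal_def integral_return)
  next
    case False
    then have v: "0 < v" using assms by simp
    have d: "normal_density 0 (sqrt v) x * exp x = exp (v / 2) * normal_density v (sqrt v) x" for x
    proof -
      have "- (x\<^sup>2 / (2 * v)) + x = v / 2 - (x - v)\<^sup>2 / (2 * v)"
        using v by (simp add: field_simps power2_eq_square)
      then show ?thesis
        using v by (simp add: normal_density_def exp_add[symmetric] mult.commute)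
    qed
    have "integrable (univariate_normal 0 v) (\<lambda>x. exp x)"
      using v by (subst integral_univariate_normal) (auto simp: d)
    moreover have "(\<integral>x. exp x *\<^sub>R iexp (a * x) \<partial>univariate_normal 0 v) =
        (\<integral>x. exp (v / 2) *\<^sub>R (normal_density v (sqrt v) x *\<^sub>R iexp (a * x)) \<partial>lborel)"
      using v by (subst integral_univariate_normal) (auto simp only: d scaleR_scaleR, measurable)
    moreover have "\<dots> = exp (v / 2) *\<^sub>R (\<integral>x. iexp (a * x) \<partial>univariate_normal v v)"
      using v by (subst integral_univariate_normal) (auto simp only: integral_scaleR_right, measurable)
    ultimately show ?thesis using char_univariate_normal[OF assms] by simp
  qed
  then show "integrable (univariate_normal 0 v) (\<lambda>x. exp x)"
    "(\<integral>x. exp x *\<^sub>R iexp (a * x) \<partial>univariate_normal 0 v) =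
      exp (v / 2) *\<^sub>R (iexp (a * v) * of_real (exp (- (a\<^sup>2 * v) / 2)))" by auto
qed

lemma univariate_normal_moments:
  assumes "0 \<le> v"
  shows "(\<integral>x. x \<partial>univariate_normal m v) = m"
    and "integrable (univariate_normal m v) (\<lambda>x. (x - m)\<^sup>2)"
    and "(\<integral>x. (x - m)\<^sup>2 \<partial>univariate_normal m v) = v"
proof -
  have "(\<integral>x. x \<partial>univariate_normal m v) = m \<and> integrable (univariate_normal m v) (\<lambda>x. (x - m)\<^sup>2)
      \<and> (\<integral>x. (x - m)\<^sup>2 \<partial>univariate_normal m v) = v"
  proof (cases "v = 0")
    case True
    then show ?thesis
      by (simp add: univariate_normal_def integral_return integrable_iff_bounded nn_integral_return)
  next
    case False
    then have v: "0 < v" using assms by simp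
    show ?thesis
      using normal_moment_even[of "sqrt v" m 1] v
      using integral_univariate_normal[OF v, of "\<lambda>x. x" m] integral_univariate_normal[OF v, of "\<lambda>x. (x - m)\<^sup>2" m]
      by (simp add: integral_normal_moment_nz_1 has_bochner_integral_iff)
  qed
  then show "(\<integral>x. x \<partial>univariate_normal m v) = m"
    and "integrable (univariate_normal m v) (\<lambda>x. (x - m)\<^sup>2)"
    and "(\<integral>x. (x - m)\<^sup>2 \<partial>univariate_normal m v) = v" by auto
qed

lemma inner_vec_sum: "(a :: real^'n) \<bullet> x = (\<Sum>i\<in>UNIV. a $ i * x $ i)"
  by (simp add: inner_vec_def)

lemma borel_measurable_vec_component[measurable (raw)]:
  fixes X :: "'a \<Rightarrow> real^'n"
  shows "X \<in> borel_measurable M \<Longrightarrow> (\<lambda>x. X x $ i) \<in> borel_measurable M"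
  unfolding cart_eq_inner_axis by (rule borel_measurable_inner) auto

lemma integrable_mult_of_squares:
  fixes f g :: "'a \<Rightarrow> real"
  assumes "f \<in> borel_measurable P" "g \<in> borel_measurable P"
    and "integrable P (\<lambda>x. (f x)\<^sup>2)" "integrable P (\<lambda>x. (g x)\<^sup>2)"
  shows "integrable P (\<lambda>x. f x * g x)"
proof (rule Bochner_Integration.integrable_bound)
  show "integrable P (\<lambda>x. (f x)\<^sup>2 + (g x)\<^sup>2)" using assms by simp
  have "\<bar>u * v\<bar> \<le> u\<^sup>2 + v\<^sup>2" for u v :: real
    using sum_squares_bound[of "\<bar>u\<bar>" "\<bar>v\<bar>"] mult_nonneg_nonneg[of "\<bar>u\<bar>" "\<bar>v\<bar>"]
    unfolding abs_mult power2_abs by linarith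
  then show "AE x in P. norm (f x * g x) \<le> norm ((f x)\<^sup>2 + (g x)\<^sup>2)" by simp
qed (use assms in measurable)

lemma integrable_inner_square:
  fixes X :: "'a \<Rightarrow> real^'n"
  assumes [measurable]: "X \<in> borel_measurable P" and sq: "\<And>i. integrable P (\<lambda>x. (X x $ i)\<^sup>2)"
  shows "integrable P (\<lambda>x. (a \<bullet> X x)\<^sup>2)"
proof -
  have "(\<lambda>x. (a \<bullet> X x)\<^sup>2) = (\<lambda>x. \<Sum>i\<in>UNIV. \<Sum>j\<in>UNIV. (a $ i * a $ j) * (X x $ i * X x $ j))"
    by (simp add: inner_vec_sum power2_eq_square sum_product mult_ac)
  then show ?thesis
    using sq by (auto intro!: Bochner_Integration.integrable_sum integrable_mult_right integrable_mult_of_squares)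
qed

lemma cross_covariance_inner:
  fixes X :: "'a \<Rightarrow> real^'n" and Y :: "'a \<Rightarrow> real^'m"
  assumes "\<And>i. (\<integral>x. X x $ i \<partial>P) = 0" "\<And>j. (\<integral>x. Y x $ j \<partial>P) = 0"
    and int: "\<And>i j. integrable P (\<lambda>x. X x $ i * Y x $ j)"
  shows "a \<bullet> (cross_covariance P X Y *v b) = (\<integral>x. (a \<bullet> X x) * (b \<bullet> Y x) \<partial>P)"
proof -
  have "(\<integral>x. (a \<bullet> X x) * (b \<bullet> Y x) \<partial>P) =
      (\<integral>x. (\<Sum>i\<in>UNIV. \<Sum>j\<in>UNIV. (a $ i * b $ j) * (X x $ i * Y x $ j)) \<partial>P)"
    unfolding inner_vec_sum sum_product by (simp only: mult_ac)
  also have "\<dots> = (\<Sum>i\<in>UNIV. \<Sum>j\<in>UNIV. (a $ i * b $ j) * (\<integral>x. X x $ i * Y x $ j \<partial>P))"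
    using int by (simp add: Bochner_Integration.integral_sum)
  also have "\<dots> = a \<bullet> (cross_covariance P X Y *v b)"
    using assms(1,2) by (simp add: inner_vec_sum matrix_vector_mult_def cross_covariance_def sum_distrib_left mult_ac)
  finally show ?thesis ..
qed

lemma (in prob_space) inner_multivariate_normal:
  fixes X :: "'a \<Rightarrow> real^'n"
  assumes X[measurable]: "X \<in> borel_measurable M"
    and N: "multivariate_normal \<mu> V (distr M borel X)"
  shows "distr M borel (\<lambda>x. t \<bullet> X x) = univariate_normal (t \<bullet> \<mu>) (t \<bullet> (V *v t))" "0 \<le> t \<bullet> (V *v t)"
    "expectation (\<lambda>x. t \<bullet> X x) = t \<bullet> \<mu>"
    "integrable M (\<lambda>x. (t \<bullet> X x - t \<bullet> \<mu>)\<^sup>2)"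
    "expectation (\<lambda>x. (t \<bullet> X x - t \<bullet> \<mu>)\<^sup>2) = t \<bullet> (V *v t)"
proof -
  show d: "distr M borel (\<lambda>x. t \<bullet> X x) = univariate_normal (t \<bullet> \<mu>) (t \<bullet> (V *v t))"
    and v: "0 \<le> t \<bullet> (V *v t)"
    using N unfolding multivariate_normal_def by (auto simp: distr_distr comp_def)
  have i: "(\<integral>x. f (t \<bullet> X x) \<partial>M) = (\<integral>x. f x \<partial>univariate_normal (t \<bullet> \<mu>) (t \<bullet> (V *v t)))"
    if "f \<in> borel_measurable borel" for f :: "real \<Rightarrow> real"
    using that by (simp add: d[symmetric] integral_distr)
  show "expectation (\<lambda>x. t \<bullet> X x) = t \<bullet> \<mu>"
    using i[of "\<lambda>x. x"] univariate_normal_moments[OF v] by simp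
  show "expectation (\<lambda>x. (t \<bullet> X x - t \<bullet> \<mu>)\<^sup>2) = t \<bullet> (V *v t)"
    using i[of "\<lambda>x. (x - t \<bullet> \<mu>)\<^sup>2"] univariate_normal_moments[OF v] by simp
  have "integrable (distr M borel (\<lambda>x. t \<bullet> X x)) (\<lambda>x. (x - t \<bullet> \<mu>)\<^sup>2)"
    using univariate_normal_moments[OF v] d by simp
  then show "integrable M (\<lambda>x. (t \<bullet> X x - t \<bullet> \<mu>)\<^sup>2)"
    by (subst (asm) integrable_distr_eq) auto
qed

lemma (in prob_space) char_multivariate_normal:
  fixes X :: "'a \<Rightarrow> real^'n"
  assumes X[measurable]: "X \<in> borel_measurable M"
    and N: "multivariate_normal \<mu> V (distr M borel X)"
  shows "(\<integral>x. iexp (t \<bullet> X x) \<partial>M) = iexp (t \<bullet> \<mu>) * of_real (exp (- (t \<bullet> (V *v t)) / 2))"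
proof -
  have "(\<integral>x. iexp (t \<bullet> X x) \<partial>M) = (\<integral>x. iexp (1 * x) \<partial>distr M borel (\<lambda>x. t \<bullet> X x))"
    by (subst integral_distr) auto
  then show ?thesis
    using char_univariate_normal[OF inner_multivariate_normal(2)[OF X N, of t], of "t \<bullet> \<mu>" 1]
    by (simp only: inner_multivariate_normal(1)[OF X N] mult_1 power_one)
qed

text \<open>A centered square integrable vector can only be normal with its own covariance matrix, so normality
  becomes an explicit formula for the characteristic function.\<close>

lemma (in prob_space) centered_is_normal_law_iff_char:
  fixes X :: "'a \<Rightarrow> real^'n"
  assumes X[measurable]: "X \<in> borel_measurable M"
    and sq: "\<And>i. integrable M (\<lambda>x. (X x $ i)\<^sup>2)" and mean: "\<And>i. expectation (\<lambda>x. X x $ i) = 0"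
  shows "is_normal_law (distr M borel X) \<longleftrightarrow>
    (\<forall>t. (\<integral>x. iexp (t \<bullet> X x) \<partial>M) = of_real (exp (- expectation (\<lambda>x. (t \<bullet> X x)\<^sup>2) / 2)))"
proof
  have Xi: "(\<lambda>x. X x $ i) \<in> borel_measurable M" for i
    by measurable
  have Xint: "integrable M (\<lambda>x. X x $ i)" for i
    by (rule square_integrable_imp_integrable[OF Xi sq])
  assume "is_normal_law (distr M borel X)"
  then obtain \<mu> V where N: "multivariate_normal \<mu> V (distr M borel X)"
    unfolding is_normal_law_def by auto
  have "t \<bullet> \<mu> = 0" for t
    using inner_multivariate_normal(3)[OF X N, of t] mean Xint
    by (simp add: inner_vec_sum Bochner_Integration.integral_sum)
  then show "\<forall>t. (\<integral>x. iexp (t \<bullet> X x) \<partial>M) = of_real (exp (- expectation (\<lambda>x. (t \<bullet> X x)\<^sup>2) / 2))"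
    using char_multivariate_normal[OF X N] inner_multivariate_normal(5)[OF X N] by simp
next
  have Xi: "(\<lambda>x. X x $ i) \<in> borel_measurable M" for i
    by measurable
  assume c: "\<forall>t. (\<integral>x. iexp (t \<bullet> X x) \<partial>M) = of_real (exp (- expectation (\<lambda>x. (t \<bullet> X x)\<^sup>2) / 2))"
  have cov: "t \<bullet> (cross_covariance M X X *v t) = expectation (\<lambda>x. (t \<bullet> X x)\<^sup>2)" for t
    using sq by (subst cross_covariance_inner) (auto simp: mean power2_eq_square intro!: integrable_mult_of_squares)
  have d: "distr M borel (\<lambda>x. t \<bullet> X x) = univariate_normal 0 (expectation (\<lambda>x. (t \<bullet> X x)\<^sup>2))" for t
  proof (rule finite_measure_real_eqI_char)
    have v: "0 \<le> expectation (\<lambda>x. (t \<bullet> X x)\<^sup>2)" by simp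
    show "finite_measure (distr M borel (\<lambda>x. t \<bullet> X x))" by (rule finite_measure_distr) simp
    show "finite_measure (univariate_normal 0 (expectation (\<lambda>x. (t \<bullet> X x)\<^sup>2)))"
      using prob_space_univariate_normal[OF v] by (rule prob_space.finite_measure)
    fix s
    have "(\<integral>x. iexp (s * x) \<partial>distr M borel (\<lambda>x. t \<bullet> X x)) = (\<integral>x. iexp ((s *\<^sub>R t) \<bullet> X x) \<partial>M)"
      by (subst integral_distr) auto
    also have "\<dots> = of_real (exp (- (s\<^sup>2 * expectation (\<lambda>x. (t \<bullet> X x)\<^sup>2)) / 2))"
      using c[rule_format, of "s *\<^sub>R t"] by (simp only: inner_scaleR_left power_mult_distrib integral_mult_right_zero)
    finally show "(\<integral>x. iexp (s * x) \<partial>distr M borel (\<lambda>x. t \<bullet> X x)) =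
        (\<integral>x. iexp (s * x) \<partial>univariate_normal 0 (expectation (\<lambda>x. (t \<bullet> X x)\<^sup>2)))"
      unfolding char_univariate_normal[OF v] by simp
  qed simp_all
  have "multivariate_normal 0 (cross_covariance M X X) (distr M borel X)"
    unfolding multivariate_normal_def
    using d by (auto simp: cov distr_distr comp_def)
      (simp add: transpose_def cross_covariance_def vec_eq_iff mult.commute)
  then show "is_normal_law (distr M borel X)"
    unfolding is_normal_law_def by blast
qed

section \<open>Exponential families with vanishing third cumulants\<close>

text \<open>A quadratic bound on the remainder that is uniform in the integration variable up to an integrable
  factor allows differentiation under the integral sign; both the real and the complex exponential
  functions satisfy such a bound.\<close>

lemma has_vector_derivative_integral:
  fixes F :: "real \<Rightarrow> 'a \<Rightarrow> 'b::{banach, second_countable_topology}"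
  assumes F: "\<And>u. integrable M (F u)" and D: "integrable M D" and G: "integrable M G"
    and bound: "\<And>h x. \<bar>h\<bar> \<le> 1 \<Longrightarrow> norm (F (s + h) x - F s x - h *\<^sub>R D x) \<le> h\<^sup>2 * G x"
  shows "((\<lambda>u. \<integral>x. F u x \<partial>M) has_vector_derivative (\<integral>x. D x \<partial>M)) (at s)"
proof -
  let ?f = "\<lambda>u. \<integral>x. F u x \<partial>M" and ?d = "\<integral>x. D x \<partial>M" and ?g = "\<integral>x. G x \<partial>M"
  have b: "norm (norm (?f (s + h) - ?f s - h *\<^sub>R ?d) / norm h) \<le> \<bar>h\<bar> * ?g" if "\<bar>h\<bar> \<le> 1" for h
  proof -
    have "?f (s + h) - ?f s - h *\<^sub>R ?d = (\<integral>x. F (s + h) x - F s x - h *\<^sub>R D x \<partial>M)"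
      using F D by simp
    also have "norm \<dots> \<le> (\<integral>x. h\<^sup>2 * G x \<partial>M)"
      by (rule order_trans[OF integral_norm_bound integral_mono]) (use F D G bound[OF that] in auto)
    also have "\<dots> = h\<^sup>2 * ?g" by simp
    finally have *: "norm (?f (s + h) - ?f s - h *\<^sub>R ?d) \<le> h\<^sup>2 * ?g" .
    have "norm (?f (s + h) - ?f s - h *\<^sub>R ?d) / \<bar>h\<bar> \<le> h\<^sup>2 * ?g / \<bar>h\<bar>"
      by (rule divide_right_mono[OF *]) simp
    also have "h\<^sup>2 * ?g / \<bar>h\<bar> = \<bar>h\<bar> * ?g"
      by (cases "h = 0") (simp_all add: power2_eq_square abs_if)
    finally show ?thesis by simp
  qed
  have "((\<lambda>h. norm (?f (s + h) - ?f s - h *\<^sub>R ?d) / norm h) \<longlongrightarrow> 0) (at 0)"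
  proof (rule Lim_null_comparison)
    show "\<forall>\<^sub>F h in at 0. norm (norm (?f (s + h) - ?f s - h *\<^sub>R ?d) / norm h) \<le> \<bar>h\<bar> * ?g"
      unfolding eventually_at by (intro exI[of _ 1]) (use b in auto)
    show "((\<lambda>h::real. \<bar>h\<bar> * ?g) \<longlongrightarrow> 0) (at 0)" by (auto intro!: tendsto_eq_intros)
  qed
  then show ?thesis
    unfolding has_vector_derivative_def has_derivative_at
    by (auto intro!: bounded_linear_scaleR_left)
qed

lemma exp_minus_linear_bound: "\<bar>exp y - 1 - y\<bar> \<le> y\<^sup>2 * exp \<bar>y\<bar>" for y :: real
proof -
  have 1: "1 + y \<le> exp y" by (rule exp_ge_add_one_self)
  have "1 - y \<le> exp (- y)" using exp_ge_add_one_self[of "- y"] by simp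
  then have "exp y * (1 - y) \<le> exp y * exp (- y)" by (intro mult_left_mono) auto
  then have 2: "exp y - 1 \<le> y * exp y" by (simp add: exp_minus algebra_simps)
  have "exp y - 1 - y \<le> y * (exp y - 1)" using 2 by (simp add: algebra_simps)
  also have "\<dots> \<le> y\<^sup>2 * exp \<bar>y\<bar>"
  proof (cases "0 \<le> y")
    case True
    then show ?thesis
      using mult_left_mono[OF 2 True] by (simp add: power2_eq_square mult.assoc)
  next
    case False
    have "y * (exp y - 1) \<le> y * y" using False 1 by (intro mult_left_mono_neg) linarith+
    also have "\<dots> \<le> (y * y) * exp \<bar>y\<bar>" using mult_left_mono[of 1 "exp \<bar>y\<bar>" "y * y"] by simp
    finally show ?thesis by (simp add: power2_eq_square)
  qed
  finally show ?thesis using 1 by linarith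
qed

text \<open>Up to normalization, the \<open>k\<close>-th moment of \<open>w \<bullet> c\<close> under the member of the exponential family
  generated by \<open>N\<close> that has the natural parameter \<open>\<eta>\<close>; for \<open>k = 0\<close> it is the normalizing factor, for
  each \<open>c\<close>.\<close>

definition exp_moment :: "'a::euclidean_space measure \<Rightarrow> 'a \<Rightarrow> nat \<Rightarrow> 'a \<Rightarrow> real" where
  "exp_moment N c k \<eta> = (\<integral>w. (w \<bullet> c) ^ k * exp (w \<bullet> \<eta>) \<partial>N)"

locale exponential_family =
  fixes N :: "'a::euclidean_space measure"
  assumes sets_N[measurable_cong, simp]: "sets N = sets borel"
    and nontrivial: "emeasure N (space N) \<noteq> 0"
    and integrable_exp: "\<And>\<eta>. integrable N (\<lambda>w. exp (w \<bullet> \<eta>))"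
begin

text \<open>In terms of the coordinate \<open>i\<close> of largest modulus, \<open>norm w \<le> DIM \<bar>w \<bullet> i\<bar>\<close>; so the exponentials of
  finitely many linear functionals dominate.\<close>

lemma integrable_exp_norm:
  assumes "0 \<le> K" shows "integrable N (\<lambda>w. exp (K * norm w))"
proof -
  define C where "C = K * real DIM('a)"
  have "0 \<le> C" using assms by (simp add: C_def)
  have bound: "exp (K * norm w) \<le> (\<Sum>i\<in>Basis. exp (w \<bullet> (C *\<^sub>R i)) + exp (w \<bullet> (- C *\<^sub>R i)))" for w :: 'a
  proof -
    obtain i :: 'a where i: "i \<in> Basis" "\<And>j. j \<in> Basis \<Longrightarrow> \<bar>w \<bullet> j\<bar> \<le> \<bar>w \<bullet> i\<bar>"
      using obtains_MAX[OF finite_Basis nonempty_Basis, of "\<lambda>j. \<bar>w \<bullet> j\<bar>"] Max_ge[OF finite_imageI[OF finite_Basis]]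
      by (metis imageI)
    have "norm w \<le> (\<Sum>j\<in>Basis. \<bar>w \<bullet> j\<bar>)" by (rule norm_le_l1)
    also have "\<dots> \<le> real DIM('a) * \<bar>w \<bullet> i\<bar>" by (rule sum_bounded_above) (use i in auto)
    finally have "K * norm w \<le> C * \<bar>w \<bullet> i\<bar>"
      using mult_left_mono[OF _ assms] by (simp add: C_def mult.assoc)
    then have "exp (K * norm w) \<le> exp (C * \<bar>w \<bullet> i\<bar>)" by simp
    also have "\<dots> \<le> exp (w \<bullet> (C *\<^sub>R i)) + exp (w \<bullet> (- C *\<^sub>R i))"
      by (cases "0 \<le> w \<bullet> i") (auto simp: add_increasing add_increasing2)
    also have "\<dots> \<le> (\<Sum>i\<in>Basis. exp (w \<bullet> (C *\<^sub>R i)) + exp (w \<bullet> (- C *\<^sub>R i)))"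
      by (rule member_le_sum[OF i(1)]) auto
    finally show ?thesis .
  qed
  show ?thesis
  proof (rule Bochner_Integration.integrable_bound)
    show "integrable N (\<lambda>w. \<Sum>i\<in>Basis. exp (w \<bullet> (C *\<^sub>R i)) + exp (w \<bullet> (- C *\<^sub>R i)))"
      by (intro Bochner_Integration.integrable_sum Bochner_Integration.integrable_add integrable_exp)
    show "AE w in N. norm (exp (K * norm w)) \<le> norm (\<Sum>i\<in>Basis. exp (w \<bullet> (C *\<^sub>R i)) + exp (w \<bullet> (- C *\<^sub>R i)))"
      using bound by (auto simp: abs_of_nonneg sum_nonneg)
  qed simp
qed

lemma integrable_exp_growth:
  fixes h :: "'a \<Rightarrow> 'b::{banach, second_countable_topology}"
  assumes [measurable]: "h \<in> borel_measurable borel"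
    and "0 \<le> K" and h: "\<And>w. norm (h w) \<le> C * exp (K * norm w)"
  shows "integrable N h"
proof (rule Bochner_Integration.integrable_bound)
  show "integrable N (\<lambda>w. C * exp (K * norm w))"
    using integrable_exp_norm[OF assms(2)] by simp
  show "AE w in N. norm (h w) \<le> norm (C * exp (K * norm w))"
    by (intro AE_I2 order_trans[OF h]) simp
qed simp

lemma power_inner_le_exp:
  fixes w c \<eta> :: 'a
  shows "\<bar>(w \<bullet> c) ^ k * exp (w \<bullet> \<eta>)\<bar> \<le> norm c ^ k * exp ((real k + norm \<eta>) * norm w)"
proof -
  have "\<bar>w \<bullet> c\<bar> \<le> norm c * exp (norm w)"
  proof -
    have "\<bar>w \<bullet> c\<bar> \<le> norm w * norm c" by (rule Cauchy_Schwarz_ineq2)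
    also have "\<dots> \<le> exp (norm w) * norm c"
      using exp_ge_add_one_self[of "norm w"] by (intro mult_right_mono norm_ge_zero) linarith
    finally show ?thesis by (simp add: mult.commute)
  qed
  then have "\<bar>w \<bullet> c\<bar> ^ k \<le> (norm c * exp (norm w)) ^ k" by (rule power_mono) simp
  also have "\<dots> = norm c ^ k * exp (real k * norm w)"
    by (simp add: power_mult_distrib exp_of_nat_mult)
  finally have "\<bar>(w \<bullet> c) ^ k\<bar> \<le> norm c ^ k * exp (real k * norm w)" by (simp add: power_abs)
  moreover have "exp (w \<bullet> \<eta>) \<le> exp (norm \<eta> * norm w)"
    using Cauchy_Schwarz_ineq2[of w \<eta>] by (simp add: mult.commute)
  ultimately have "\<bar>(w \<bullet> c) ^ k\<bar> * exp (w \<bullet> \<eta>) \<le> (norm c ^ k * exp (real k * norm w)) * exp (norm \<eta> * norm w)"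
    by (intro mult_mono) auto
  then show ?thesis by (simp add: abs_mult exp_add algebra_simps)
qed

lemma integrable_exp_moment: "integrable N (\<lambda>w. (w \<bullet> c) ^ k * exp (w \<bullet> \<eta>))"
  by (rule integrable_exp_growth[where C = "norm c ^ k" and K = "real k + norm \<eta>"])
    (use power_inner_le_exp in \<open>simp_all\<close>)

lemma exp_moment_0: "exp_moment N c 0 \<eta> = exp_moment N d 0 \<eta>"
  by (simp add: exp_moment_def)

lemma exp_moment_pos: "0 < exp_moment N c 0 \<eta>"
proof -
  have "0 \<le> (\<integral>w. exp (w \<bullet> \<eta>) \<partial>N)" by simp
  moreover have "(\<integral>w. exp (w \<bullet> \<eta>) \<partial>N) \<noteq> 0"
  proof
    assume "(\<integral>w. exp (w \<bullet> \<eta>) \<partial>N) = 0"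
    then have "AE w in N. exp (w \<bullet> \<eta>) = 0"
      by (subst (asm) integral_nonneg_eq_0_iff_AE[OF integrable_exp]) auto
    then have "ae_filter N = bot" by (simp add: trivial_limit_def)
    then show False using nontrivial by (simp add: ae_filter_eq_bot_iff)
  qed
  ultimately have "0 < (\<integral>w. exp (w \<bullet> \<eta>) \<partial>N)" by linarith
  then show ?thesis by (simp add: exp_moment_def)
qed

text \<open>Differentiating the weight \<open>exp (w \<bullet> \<eta>)\<close> in the direction \<open>c\<close> multiplies by \<open>w \<bullet> c\<close>, so along lines
  the exponential moments are successive derivatives of the normalizing factor.\<close>

lemma has_derivative_exp_moment:
  "((\<lambda>s. exp_moment N c k (\<eta> + s *\<^sub>R c)) has_real_derivative exp_moment N c (Suc k) (\<eta> + s *\<^sub>R c)) (at s)"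
  unfolding exp_moment_def has_real_derivative_iff_has_vector_derivative
proof (rule has_vector_derivative_integral)
  let ?z = "\<eta> + s *\<^sub>R c"
  let ?G = "\<lambda>w. norm c ^ (k + 2) * exp ((real k + 2 + norm ?z + norm c) * norm w)"
  show "integrable N ?G"
    using integrable_exp_norm[of "real k + 2 + norm ?z + norm c"] by simp
  fix h :: real and w :: 'a
  assume h: "\<bar>h\<bar> \<le> 1"
  let ?x = "w \<bullet> c"
  have x: "\<bar>h * ?x\<bar> \<le> norm c * norm w"
    using mult_mono[OF h Cauchy_Schwarz_ineq2[of w c]] by (simp add: abs_mult mult.commute)
  have "norm (?x ^ k * exp (w \<bullet> (\<eta> + (s + h) *\<^sub>R c)) - ?x ^ k * exp (w \<bullet> ?z) - h *\<^sub>R (?x ^ Suc k * exp (w \<bullet> ?z)))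
      = \<bar>?x ^ k * exp (w \<bullet> ?z)\<bar> * \<bar>exp (h * ?x) - 1 - h * ?x\<bar>"
    unfolding abs_mult[symmetric] by (simp add: inner_add_right exp_add algebra_simps)
  also have "\<dots> \<le> \<bar>?x ^ k * exp (w \<bullet> ?z)\<bar> * ((h * ?x)\<^sup>2 * exp \<bar>h * ?x\<bar>)"
    by (intro mult_left_mono exp_minus_linear_bound) simp
  also have "\<dots> \<le> \<bar>?x ^ k * exp (w \<bullet> ?z)\<bar> * ((h * ?x)\<^sup>2 * exp (norm c * norm w))"
    using x by (intro mult_left_mono) auto
  also have "\<dots> = h\<^sup>2 * (\<bar>?x ^ (k + 2) * exp (w \<bullet> ?z)\<bar> * exp (norm c * norm w))"
    by (simp add: abs_mult power_mult_distrib power_add mult_ac power_abs power2_eq_square)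
  also have "\<dots> \<le> h\<^sup>2 * ((norm c ^ (k + 2) * exp ((real (k + 2) + norm ?z) * norm w)) * exp (norm c * norm w))"
    by (intro mult_left_mono mult_right_mono power_inner_le_exp) auto
  also have "\<dots> = h\<^sup>2 * ?G w"
    by (simp add: exp_add algebra_simps)
  finally show "norm (?x ^ k * exp (w \<bullet> (\<eta> + (s + h) *\<^sub>R c)) - ?x ^ k * exp (w \<bullet> ?z) - h *\<^sub>R (?x ^ Suc k * exp (w \<bullet> ?z))) \<le> h\<^sup>2 * ?G w" .
qed (rule integrable_exp_moment)+

lemma continuous_exp_moment: "continuous_on UNIV (exp_moment N c k)"
  unfolding continuous_on_sequentially
proof (intro allI ballI impI, elim conjE)
  fix x and \<eta> :: 'a assume x: "x \<longlonglongrightarrow> \<eta>"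
  then obtain B where B: "\<And>n. norm (x n) \<le> B"
    using convergent_imp_Bseq[OF convergentI[OF x]] by (auto simp: Bseq_def)
  have "0 \<le> B" using B[of 0] norm_ge_zero order_trans by blast
  have "(\<lambda>n. \<integral>w. (w \<bullet> c) ^ k * exp (w \<bullet> x n) \<partial>N) \<longlonglongrightarrow> (\<integral>w. (w \<bullet> c) ^ k * exp (w \<bullet> \<eta>) \<partial>N)"
  proof (rule integral_dominated_convergence)
    show "integrable N (\<lambda>w. norm c ^ k * exp ((real k + B) * norm w))"
      using integrable_exp_norm[of "real k + B"] \<open>0 \<le> B\<close> by simp
    show "AE w in N. (\<lambda>n. (w \<bullet> c) ^ k * exp (w \<bullet> x n)) \<longlonglongrightarrow> (w \<bullet> c) ^ k * exp (w \<bullet> \<eta>)"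
      by (intro AE_I2 tendsto_intros x)
    have "(real k + norm (x n)) * norm w \<le> (real k + B) * norm w" for n and w :: 'a
      using B[of n] by (intro mult_right_mono) auto
    then have "norm c ^ k * exp ((real k + norm (x n)) * norm w) \<le> norm c ^ k * exp ((real k + B) * norm w)"
      for n and w :: 'a
      by (intro mult_left_mono) auto
    then show "AE w in N. norm ((w \<bullet> c) ^ k * exp (w \<bullet> x n)) \<le> norm c ^ k * exp ((real k + B) * norm w)" for n
      by (intro AE_I2) (simp only: real_norm_def order_trans[OF power_inner_le_exp])
  qed simp_all
  then show "(exp_moment N c k \<circ> x) \<longlonglongrightarrow> exp_moment N c k \<eta>"
    by (simp add: exp_moment_def comp_def)
qed

definition mean :: "'a \<Rightarrow> 'a \<Rightarrow> real" where
  "mean c \<eta> = exp_moment N c 1 \<eta> / exp_moment N c 0 \<eta>"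

text \<open>The third derivative of the logarithm of the normalizing factor in the direction \<open>c\<close>, written in
  terms of moments; \<open>third_cumulant_eq\<close> shows that it is a central moment.\<close>

definition third_cumulant :: "'a \<Rightarrow> 'a \<Rightarrow> real" where
  "third_cumulant c \<eta> = exp_moment N c 3 \<eta> / exp_moment N c 0 \<eta>
     - 3 * mean c \<eta> * (exp_moment N c 2 \<eta> / exp_moment N c 0 \<eta>) + 2 * mean c \<eta> ^ 3"

lemma third_cumulant_eq:
  "(\<integral>w. (w \<bullet> c - mean c \<eta>) ^ 3 * exp (w \<bullet> \<eta>) \<partial>N) / exp_moment N c 0 \<eta> = third_cumulant c \<eta>"
proof -
  let ?m = "mean c \<eta>"
  have "(w \<bullet> c - ?m) ^ 3 * exp (w \<bullet> \<eta>) = (w \<bullet> c) ^ 3 * exp (w \<bullet> \<eta>) - 3 * ?m * ((w \<bullet> c) ^ 2 * exp (w \<bullet> \<eta>))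
      + 3 * ?m ^ 2 * ((w \<bullet> c) ^ 1 * exp (w \<bullet> \<eta>)) - ?m ^ 3 * ((w \<bullet> c) ^ 0 * exp (w \<bullet> \<eta>))" for w
    by (simp add: algebra_simps power3_eq_cube power2_eq_square)
  then have "(\<integral>w. (w \<bullet> c - ?m) ^ 3 * exp (w \<bullet> \<eta>) \<partial>N) = exp_moment N c 3 \<eta> - 3 * ?m * exp_moment N c 2 \<eta>
      + 3 * ?m ^ 2 * exp_moment N c 1 \<eta> - ?m ^ 3 * exp_moment N c 0 \<eta>"
    unfolding exp_moment_def
    by (simp only: integrable_exp_moment Bochner_Integration.integral_add Bochner_Integration.integral_diff
      Bochner_Integration.integrable_add Bochner_Integration.integrable_diff integrable_mult_right integral_mult_right_zero)
  then have "(\<integral>w. (w \<bullet> c - ?m) ^ 3 * exp (w \<bullet> \<eta>) \<partial>N) / exp_moment N c 0 \<eta> =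
      (exp_moment N c 3 \<eta> - 3 * ?m * exp_moment N c 2 \<eta>
      + 3 * ?m ^ 2 * exp_moment N c 1 \<eta> - ?m ^ 3 * exp_moment N c 0 \<eta>) / exp_moment N c 0 \<eta>"
    by (rule arg_cong)
  moreover have "exp_moment N c 1 \<eta> = ?m * exp_moment N c 0 \<eta>"
    using exp_moment_pos[of c \<eta>] by (simp add: mean_def)
  ultimately show ?thesis
    using exp_moment_pos[of c \<eta>] by (simp add: third_cumulant_def field_simps power2_eq_square power3_eq_cube)
qed

text \<open>Along the line through \<open>c\<close>, the logarithm of the normalizing factor has the first derivative mean,
  the second derivative variance and the third derivative zero; it is its own Taylor polynomial of
  degree two. The claim is the value at the parameter one.\<close>

lemma log_normalizer_quadratic_on_line:
  assumes "\<And>s. third_cumulant c (s *\<^sub>R c) = 0"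
  shows "exp_moment N c 0 c = exp_moment N c 0 0 *
    exp (mean c 0 + (exp_moment N c 2 0 / exp_moment N c 0 0 - (mean c 0)\<^sup>2) / 2)"
proof -
  define \<phi> where "\<phi> k s = exp_moment N c k (s *\<^sub>R c)" for k s
  have d[derivative_intros]: "(\<phi> k has_real_derivative \<phi> (Suc k) s) (at s)" for k s
    using has_derivative_exp_moment[of c k 0 s] unfolding \<phi>_def by simp
  have p: "\<phi> 0 s > 0" for s using exp_moment_pos by (simp add: \<phi>_def)
  then have nz: "\<phi> 0 s \<noteq> 0" for s by (metis less_irrefl)
  define m where "m s = \<phi> 1 s / \<phi> 0 s" for s
  define v where "v s = \<phi> 2 s / \<phi> 0 s - (m s)\<^sup>2" for s
  have dm: "(m has_real_derivative v s) (at s)" for s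
  proof -
    have "((\<lambda>s. \<phi> 1 s / \<phi> 0 s) has_real_derivative v s) (at s)"
      using nz[of s] by (auto intro!: derivative_eq_intros simp: v_def m_def field_simps power2_eq_square numeral_2_eq_2)
    then show ?thesis unfolding m_def[abs_def] .
  qed
  have dv: "(v has_real_derivative 0) (at s)" for s
  proof -
    have k: "\<phi> 3 s / \<phi> 0 s - 3 * m s * (\<phi> 2 s / \<phi> 0 s) + 2 * m s ^ 3 = 0"
      using assms[of s] by (simp add: third_cumulant_def mean_def m_def \<phi>_def)
    have "((\<lambda>s. \<phi> 2 s / \<phi> 0 s - (m s)\<^sup>2) has_real_derivative
        (\<phi> 3 s * \<phi> 0 s - \<phi> 2 s * \<phi> 1 s) / (\<phi> 0 s * \<phi> 0 s) - 2 * m s * v s) (at s)"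
      using nz[of s] by (auto intro!: derivative_eq_intros dm simp: numeral_2_eq_2 numeral_3_eq_3)
    moreover have "(\<phi> 3 s * \<phi> 0 s - \<phi> 2 s * \<phi> 1 s) / (\<phi> 0 s * \<phi> 0 s) - 2 * m s * v s
        = \<phi> 3 s / \<phi> 0 s - 3 * m s * (\<phi> 2 s / \<phi> 0 s) + 2 * m s ^ 3"
      using nz[of s] by (simp add: v_def m_def field_simps power2_eq_square power3_eq_cube)
    ultimately show ?thesis using k by (simp add: v_def[abs_def])
  qed
  have v: "v s = v 0" for s using DERIV_isconst_all[of v] dv by blast
  have "((\<lambda>s. m s - s * v 0) has_real_derivative v s - v 0) (at s)" for s
    by (auto intro!: derivative_eq_intros dm)
  then have "((\<lambda>s. m s - s * v 0) has_real_derivative 0) (at s)" for s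
    by (rule DERIV_cong) (use v[of s] in linarith)
  then have *: "m s - s * v 0 = m 0 - 0 * v 0" for s
    by (intro DERIV_isconst_all[of "\<lambda>s. m s - s * v 0"]) auto
  have m: "m s = m 0 + s * v 0" for s using *[of s] by linarith
  have "((\<lambda>s. ln (\<phi> 0 s) - s * m 0 - s\<^sup>2 * v 0 / 2) has_real_derivative m s - m 0 - s * v 0) (at s)" for s
    using p[of s] by (auto intro!: derivative_eq_intros simp: m_def[of s] field_simps)
  then have "((\<lambda>s. ln (\<phi> 0 s) - s * m 0 - s\<^sup>2 * v 0 / 2) has_real_derivative 0) (at s)" for s
    by (rule DERIV_cong) (use m[of s] in linarith)
  then have "ln (\<phi> 0 1) - 1 * m 0 - 1\<^sup>2 * v 0 / 2 = ln (\<phi> 0 0) - 0 * m 0 - 0\<^sup>2 * v 0 / 2"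
    by (intro DERIV_isconst_all[of "\<lambda>s. ln (\<phi> 0 s) - s * m 0 - s\<^sup>2 * v 0 / 2"]) auto
  then have "ln (\<phi> 0 1) = ln (\<phi> 0 0) + (m 0 + v 0 / 2)" by simp
  then have "exp (ln (\<phi> 0 1)) = exp (ln (\<phi> 0 0)) * exp (m 0 + v 0 / 2)" by (simp add: exp_add)
  then have "\<phi> 0 1 = \<phi> 0 0 * exp (m 0 + v 0 / 2)" by (simp only: exp_ln[OF p])
  then show ?thesis
    by (simp add: \<phi>_def m_def v_def mean_def)
qed

text \<open>On each line through the origin the logarithm of the normalizing factor is quadratic, with
  coefficients that are the mean (linear in the direction) and the variance (quadratic in the
  direction) at the origin. So it is globally a quadratic polynomial in \<open>\<eta>\<close>, and \<open>mean c \<eta>\<close> is its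
  derivative in the direction \<open>c\<close>.\<close>

theorem affine_mean_if_third_cumulants_vanish:
  assumes "\<And>c \<eta>. third_cumulant c \<eta> = 0"
  shows "\<exists>a b. \<forall>\<eta>. mean c \<eta> = a + b \<bullet> \<eta>"
proof -
  define L where "L = exp_moment N 0 0"
  have L: "exp_moment N c 0 = L" for c by (auto simp: L_def exp_moment_0)
  have Lpos: "L \<eta> > 0" for \<eta> using exp_moment_pos by (simp add: L_def)
  have n: "norm w \<le> exp (norm w)" for w :: 'a
    using exp_ge_add_one_self[of "norm w"] by linarith
  have int1: "integrable N (\<lambda>w. w)"
    by (rule integrable_exp_growth[where C = 1 and K = 1]) (use n in simp_all)
  have int2: "integrable N (\<lambda>w. (w \<bullet> d) *\<^sub>R w)" for d
  proof (rule integrable_exp_growth[where C = "norm d" and K = 2])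
    fix w :: 'a
    have "norm ((w \<bullet> d) *\<^sub>R w) \<le> (norm w * norm d) * norm w"
      using Cauchy_Schwarz_ineq2[of w d] by (simp add: mult_right_mono)
    also have "\<dots> = norm d * (norm w * norm w)" by simp
    also have "\<dots> \<le> norm d * (exp (norm w) * exp (norm w))"
      by (intro mult_left_mono mult_mono n) auto
    finally show "norm ((w \<bullet> d) *\<^sub>R w) \<le> norm d * exp (2 * norm w)"
      by (simp add: exp_add[symmetric])
  qed simp_all
  define \<mu> where "\<mu> = (1 / L 0) *\<^sub>R (\<integral>w. w \<partial>N)"
  define S where "S d = (1 / L 0) *\<^sub>R (\<integral>w. (w \<bullet> d) *\<^sub>R w \<partial>N)" for d
  have m0: "mean d 0 = \<mu> \<bullet> d" for d
    using int1 by (simp add: mean_def L exp_moment_def \<mu>_def inner_commute[of _ d])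
  have S2: "S d \<bullet> e = (\<integral>w. (w \<bullet> d) * (w \<bullet> e) \<partial>N) / L 0" for d e
  proof -
    have "(\<integral>w. (w \<bullet> d) *\<^sub>R w \<partial>N) \<bullet> e = (\<integral>w. ((w \<bullet> d) *\<^sub>R w) \<bullet> e \<partial>N)"
      using int2[of d] by (rule integral_inner_left[symmetric])
    then show ?thesis by (simp add: S_def)
  qed
  have e2: "exp_moment N d 2 0 / L 0 = S d \<bullet> d" for d
    by (simp add: S2 exp_moment_def power2_eq_square)
  have int3: "integrable N (\<lambda>w. (w \<bullet> d) * (w \<bullet> e))" for d e
    using integrable_inner_left[OF int2[of d], of e] by simp
  have add: "S (d + s *\<^sub>R e) \<bullet> (d + s *\<^sub>R e) = S d \<bullet> d + 2 * s * (S e \<bullet> d) + s\<^sup>2 * (S e \<bullet> e)" for d e s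
  proof -
    have "(\<integral>w. (w \<bullet> (d + s *\<^sub>R e)) * (w \<bullet> (d + s *\<^sub>R e)) \<partial>N) =
        (\<integral>w. (w \<bullet> d) * (w \<bullet> d) + (2 * s) * ((w \<bullet> e) * (w \<bullet> d)) + s\<^sup>2 * ((w \<bullet> e) * (w \<bullet> e)) \<partial>N)"
      by (rule Bochner_Integration.integral_cong) (auto simp: inner_add_right algebra_simps power2_eq_square)
    also have "\<dots> = (\<integral>w. (w \<bullet> d) * (w \<bullet> d) \<partial>N) + (2 * s) * (\<integral>w. (w \<bullet> e) * (w \<bullet> d) \<partial>N)
        + s\<^sup>2 * (\<integral>w. (w \<bullet> e) * (w \<bullet> e) \<partial>N)"
      using int3 by (simp only: Bochner_Integration.integral_add Bochner_Integration.integrable_add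
          integrable_mult_right integral_mult_right_zero)
    finally show ?thesis by (simp add: S2 add_divide_distrib)
  qed
  \<comment> \<open>The line through \<open>\<eta>\<close> gives the value at the arbitrary point \<open>\<eta>\<close>.\<close>
  have Lq: "L \<eta> = L 0 * exp (\<mu> \<bullet> \<eta> + (S \<eta> \<bullet> \<eta> - (\<mu> \<bullet> \<eta>)\<^sup>2) / 2)" for \<eta>
    using log_normalizer_quadratic_on_line[OF assms, of \<eta>] by (simp add: L e2 m0)
  define b where "b = S c - (\<mu> \<bullet> c) *\<^sub>R \<mu>"
  have "mean c \<eta> = \<mu> \<bullet> c + b \<bullet> \<eta>" for \<eta>
  proof -
    \<comment> \<open>Two ways to differentiate \<open>L\<close> at \<open>\<eta>\<close> in the direction \<open>c\<close>: as an integral, and as the exponential of the polynomial.\<close>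
    have "((\<lambda>s. L (\<eta> + s *\<^sub>R c)) has_real_derivative exp_moment N c 1 \<eta>) (at 0)"
      using has_derivative_exp_moment[of c 0 \<eta> 0] by (simp add: L)
    moreover have "((\<lambda>s. L (\<eta> + s *\<^sub>R c)) has_real_derivative L \<eta> * (\<mu> \<bullet> c + b \<bullet> \<eta>)) (at 0)"
    proof -
      let ?q = "\<lambda>s. \<mu> \<bullet> \<eta> + s * (\<mu> \<bullet> c) + (S \<eta> \<bullet> \<eta> + 2 * s * (S c \<bullet> \<eta>) + s\<^sup>2 * (S c \<bullet> c)
        - (\<mu> \<bullet> \<eta> + s * (\<mu> \<bullet> c))\<^sup>2) / 2"
      have "L (\<eta> + s *\<^sub>R c) = L 0 * exp (?q s)" for s
        unfolding Lq[of "\<eta> + s *\<^sub>R c"] add by (simp add: inner_add_right)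
      moreover have "((\<lambda>s. L 0 * exp (?q s)) has_real_derivative L \<eta> * (\<mu> \<bullet> c + b \<bullet> \<eta>)) (at 0)"
        by (auto intro!: derivative_eq_intros simp: Lq[of \<eta>] b_def inner_diff_left field_simps)
      ultimately show ?thesis by simp
    qed
    ultimately have "exp_moment N c 1 \<eta> = L \<eta> * (\<mu> \<bullet> c + b \<bullet> \<eta>)" by (rule DERIV_unique)
    then show ?thesis using Lpos[of \<eta>] by (simp add: mean_def L)
  qed
  then show ?thesis by blast
qed

end

section \<open>Shifts of normal laws\<close>

text \<open>Otherwise \<open>t + r \<theta>\<close> would make the form negative for a suitable \<open>r\<close>, since the form is then affine in
  \<open>r\<close> with nonzero slope.\<close>

lemma quadratic_form_kernel:
  fixes V :: "real^'q^'q"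
  assumes sym: "transpose V = V" and psd: "\<And>t. 0 \<le> t \<bullet> (V *v t)" and "\<theta> \<bullet> (V *v \<theta>) = 0"
  shows "t \<bullet> (V *v \<theta>) = 0"
proof (rule ccontr)
  assume nz: "t \<bullet> (V *v \<theta>) \<noteq> 0"
  have comm: "\<theta> \<bullet> (V *v t) = t \<bullet> (V *v \<theta>)"
    by (metis dot_lmul_matrix inner_commute sym transpose_matrix_vector)
  define r where "r = - (t \<bullet> (V *v t) + 1) / (2 * (t \<bullet> (V *v \<theta>)))"
  have "0 \<le> (t + r *\<^sub>R \<theta>) \<bullet> (V *v (t + r *\<^sub>R \<theta>))" by (rule psd)
  also have "\<dots> = t \<bullet> (V *v t) + 2 * r * (t \<bullet> (V *v \<theta>))"
    using comm assms(3)
    by (simp add: matrix_vector_right_distrib matrix_vector_mult_scaleR inner_add_left inner_add_right algebra_simps)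
  also have "\<dots> = -1" using nz by (simp add: r_def field_simps)
  finally show False by simp
qed

lemma (in prob_space) indep_var_if_char_factorizes:
  fixes S T :: "'a \<Rightarrow> real"
  assumes [measurable]: "S \<in> borel_measurable M" "T \<in> borel_measurable M"
    and char: "\<And>a b. (\<integral>x. iexp (a * S x + b * T x) \<partial>M) = (\<integral>x. iexp (a * S x) \<partial>M) * (\<integral>x. iexp (b * T x) \<partial>M)"
  shows "indep_var borel S borel T"
proof -
  interpret S: prob_space "distr M borel S" by (rule prob_space_distr) simp
  interpret T: prob_space "distr M borel T" by (rule prob_space_distr) simp
  interpret ST: pair_prob_space "distr M borel S" "distr M borel T" ..
  have "distr M borel S \<Otimes>\<^sub>M distr M borel T = distr M borel (\<lambda>x. (S x, T x))"
  proof (rule finite_measure_eqI_char)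
    show "finite_measure (distr M borel S \<Otimes>\<^sub>M distr M borel T)" by (rule ST.finite_measure_axioms)
    show "finite_measure (distr M borel (\<lambda>x. (S x, T x)))" by (rule finite_measure_distr) simp
    have s: "sets (distr M borel S \<Otimes>\<^sub>M distr M borel T) = sets (borel \<Otimes>\<^sub>M borel)"
      by (intro sets_pair_measure_cong) auto
    then show "sets (distr M borel S \<Otimes>\<^sub>M distr M borel T) = sets borel" by (simp only: borel_prod)
    note [measurable_cong] = s
    fix t :: "real \<times> real"
    obtain a b where t: "t = (a, b)" by (cases t)
    have i: "integrable (distr M borel S \<Otimes>\<^sub>M distr M borel T) (\<lambda>(x, y). iexp (a * x) * iexp (b * y))"
      by (rule ST.P.integrable_const_bound[where B = 1]) (auto simp: norm_mult)
    have "(\<integral>x. iexp (t \<bullet> x) \<partial>(distr M borel S \<Otimes>\<^sub>M distr M borel T)) =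
        (\<integral>x. (case x of (x, y) \<Rightarrow> iexp (a * x) * iexp (b * y)) \<partial>(distr M borel S \<Otimes>\<^sub>M distr M borel T))"
      by (rule Bochner_Integration.integral_cong) (auto simp: t inner_Pair exp_add[symmetric] algebra_simps)
    also have "\<dots> = (\<integral>x. \<integral>y. iexp (a * x) * iexp (b * y) \<partial>distr M borel T \<partial>distr M borel S)"
      using ST.integral_fst[OF i] by simp
    also have "\<dots> = (\<integral>x. iexp (a * S x) \<partial>M) * (\<integral>x. iexp (b * T x) \<partial>M)"
      by (simp add: integral_distr)
    also have "\<dots> = (\<integral>x. iexp (t \<bullet> x) \<partial>distr M borel (\<lambda>x. (S x, T x)))"
      unfolding char[symmetric] by (subst integral_distr) (auto simp: t inner_Pair)
    finally show "(\<integral>x. iexp (t \<bullet> x) \<partial>(distr M borel S \<Otimes>\<^sub>M distr M borel T)) =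
      (\<integral>x. iexp (t \<bullet> x) \<partial>distr M borel (\<lambda>x. (S x, T x)))" .
  qed simp
  then show ?thesis
    by (simp add: indep_var_distribution_eq borel_prod)
qed

text \<open>Both measures have the same characteristic function. To compute the one of the density at \<open>t\<close>, split
  \<open>t \<bullet> y = \<tau> \<bullet> y + \<alpha> (\<theta> \<bullet> y)\<close> with \<open>\<tau> \<bullet> y\<close> uncorrelated with, hence independent of, \<open>\<theta> \<bullet> y\<close>; the
  weight only concerns the second part, which is a one-dimensional integral. The argument avoids
  densities with respect to Lebesgue measure, and so it covers singular \<open>V\<close> and shifts in the range of \<open>V\<close>.\<close>

theorem cameron_martin:
  fixes V :: "real^'q^'q" and N :: "(real^'q) measure"
  assumes N: "multivariate_normal 0 V N" and "prob_space N"
  shows "distr N borel (\<lambda>y. y + V *v \<theta>) =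
    density N (\<lambda>y. ennreal (exp (\<theta> \<bullet> y - \<theta> \<bullet> (V *v \<theta>) / 2)))"
proof -
  interpret prob_space N by fact
  have sets[measurable_cong, simp]: "sets N = sets borel" using N by (simp add: multivariate_normal_def)
  have [simp]: "space N = UNIV" using sets_eq_imp_space_eq[OF sets] by simp
  have sym: "transpose V = V" and psd: "\<And>t. 0 \<le> t \<bullet> (V *v t)"
    using N by (auto simp: multivariate_normal_def)
  have N': "multivariate_normal 0 V (distr N borel (\<lambda>y. y))"
    using N distr_id2[of borel N] by simp
  have char: "(\<integral>y. iexp (t \<bullet> y) \<partial>N) = of_real (exp (- (t \<bullet> (V *v t)) / 2))" for t
    using char_multivariate_normal[OF _ N', of t] by simp
  define v where "v = \<theta> \<bullet> (V *v \<theta>)"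
  have v: "0 \<le> v" using psd by (simp add: v_def)
  have law: "distr N borel (\<lambda>y. \<theta> \<bullet> y) = univariate_normal 0 v"
    using inner_multivariate_normal(1)[OF _ N', of \<theta>] by (simp add: v_def)
  have int_exp: "integrable N (\<lambda>y. exp (\<theta> \<bullet> y))"
    using char_univariate_normal_tilted(1)[OF v] unfolding law[symmetric]
    by (subst (asm) integrable_distr_eq) auto
  show ?thesis
  proof (rule finite_measure_eqI_char)
    show "finite_measure (distr N borel (\<lambda>y. y + V *v \<theta>))" by (rule finite_measure_distr) simp
    show "finite_measure (density N (\<lambda>y. ennreal (exp (\<theta> \<bullet> y - \<theta> \<bullet> (V *v \<theta>) / 2))))"
    proof (rule finite_measureI)
      have "integrable N (\<lambda>y. exp (\<theta> \<bullet> y - v / 2))"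
        using int_exp by (simp add: exp_diff)
      then show "emeasure (density N (\<lambda>y. ennreal (exp (\<theta> \<bullet> y - \<theta> \<bullet> (V *v \<theta>) / 2))))
          (space (density N (\<lambda>y. ennreal (exp (\<theta> \<bullet> y - \<theta> \<bullet> (V *v \<theta>) / 2))))) \<noteq> \<infinity>"
        by (simp add: emeasure_density v_def[symmetric] nn_integral_eq_integral)
    qed
    fix t
    \<comment> \<open>The regression coefficient of \<open>t \<bullet> y\<close> on \<open>\<theta> \<bullet> y\<close>; for \<open>v = 0\<close> the quotient is \<open>0\<close>, and the covariance vanishes as well.\<close>
    define \<alpha> where "\<alpha> = t \<bullet> (V *v \<theta>) / v"
    define \<tau> where "\<tau> = t - \<alpha> *\<^sub>R \<theta>"
    have \<alpha>: "t \<bullet> (V *v \<theta>) = \<alpha> * v"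
    proof (cases "v = 0")
      case True
      then show ?thesis
        using quadratic_form_kernel[OF sym psd, of \<theta> t] by (simp add: v_def)
    next
      case False
      then show ?thesis by (simp add: \<alpha>_def)
    qed
    have comm: "\<theta> \<bullet> (V *v s) = s \<bullet> (V *v \<theta>)" for s
      by (metis dot_lmul_matrix inner_commute sym transpose_matrix_vector)
    have \<tau>\<theta>: "\<tau> \<bullet> (V *v \<theta>) = 0"
      using \<alpha> by (simp add: \<tau>_def inner_diff_left v_def)
    have \<tau>\<tau>: "\<tau> \<bullet> (V *v \<tau>) = t \<bullet> (V *v t) - \<alpha>\<^sup>2 * v"
      using \<alpha> comm[of t]
      by (simp add: \<tau>_def inner_diff_left matrix_vector_mult_diff_distrib matrix_vector_mult_scaleR inner_diff_right
          v_def[symmetric] power2_eq_square algebra_simps)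
    have indep: "indep_var borel (\<lambda>y. \<tau> \<bullet> y) borel (\<lambda>y. \<theta> \<bullet> y)"
    proof (rule indep_var_if_char_factorizes)
      fix a b
      have q: "(a *\<^sub>R \<tau> + b *\<^sub>R \<theta>) \<bullet> (V *v (a *\<^sub>R \<tau> + b *\<^sub>R \<theta>)) =
          (a *\<^sub>R \<tau>) \<bullet> (V *v (a *\<^sub>R \<tau>)) + (b *\<^sub>R \<theta>) \<bullet> (V *v (b *\<^sub>R \<theta>))"
        using \<tau>\<theta> comm[of \<tau>]
        by (simp add: matrix_vector_right_distrib matrix_vector_mult_scaleR inner_add_left inner_add_right)
      have "(\<integral>x. iexp (a * (\<tau> \<bullet> x) + b * (\<theta> \<bullet> x)) \<partial>N) = (\<integral>x. iexp ((a *\<^sub>R \<tau> + b *\<^sub>R \<theta>) \<bullet> x) \<partial>N)"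
        by (simp add: inner_add_left)
      also have "\<dots> = (\<integral>x. iexp ((a *\<^sub>R \<tau>) \<bullet> x) \<partial>N) * (\<integral>x. iexp ((b *\<^sub>R \<theta>) \<bullet> x) \<partial>N)"
        unfolding char q by (simp add: exp_add[symmetric] add_divide_distrib diff_divide_distrib flip: of_real_mult)
      finally show "(\<integral>x. iexp (a * (\<tau> \<bullet> x) + b * (\<theta> \<bullet> x)) \<partial>N) =
          (\<integral>x. iexp (a * (\<tau> \<bullet> x)) \<partial>N) * (\<integral>x. iexp (b * (\<theta> \<bullet> x)) \<partial>N)"
        by simp
    qed simp_all
    have "indep_var borel ((\<lambda>x. iexp x) \<circ> (\<lambda>y. \<tau> \<bullet> y)) borel ((\<lambda>x. exp x *\<^sub>R iexp (\<alpha> * x)) \<circ> (\<lambda>y. \<theta> \<bullet> y))"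
      by (rule indep_var_compose[OF indep]) simp_all
    then have fact: "(\<integral>y. iexp (\<tau> \<bullet> y) * (exp (\<theta> \<bullet> y) *\<^sub>R iexp (\<alpha> * (\<theta> \<bullet> y))) \<partial>N) =
        (\<integral>y. iexp (\<tau> \<bullet> y) \<partial>N) * (\<integral>y. exp (\<theta> \<bullet> y) *\<^sub>R iexp (\<alpha> * (\<theta> \<bullet> y)) \<partial>N)"
    proof (subst indep_var_lebesgue_integral[symmetric])
      show "integrable N (\<lambda>y. iexp (\<tau> \<bullet> y))" by (rule integrable_const_bound[where B = 1]) auto
      show "integrable N (\<lambda>y. exp (\<theta> \<bullet> y) *\<^sub>R iexp (\<alpha> * (\<theta> \<bullet> y)))"
        by (rule Bochner_Integration.integrable_bound[OF int_exp]) auto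
    qed (simp_all add: comp_def)
    have e2: "(\<integral>y. exp (\<theta> \<bullet> y) *\<^sub>R iexp (\<alpha> * (\<theta> \<bullet> y)) \<partial>N) =
        exp (v / 2) *\<^sub>R (iexp (\<alpha> * v) * of_real (exp (- (\<alpha>\<^sup>2 * v) / 2)))"
      unfolding char_univariate_normal_tilted(2)[OF v, symmetric] law[symmetric]
      by (subst integral_distr) auto
    have "(\<integral>y. iexp (t \<bullet> y) \<partial>density N (\<lambda>y. ennreal (exp (\<theta> \<bullet> y - \<theta> \<bullet> (V *v \<theta>) / 2)))) =
        (\<integral>y. exp (\<theta> \<bullet> y - v / 2) *\<^sub>R iexp (t \<bullet> y) \<partial>N)"
      by (subst integral_density) (auto simp: v_def)
    also have "\<dots> = (\<integral>y. exp (- v / 2) *\<^sub>R (iexp (\<tau> \<bullet> y) * (exp (\<theta> \<bullet> y) *\<^sub>R iexp (\<alpha> * (\<theta> \<bullet> y)))) \<partial>N)"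
    proof (rule Bochner_Integration.integral_cong)
      fix y
      have "iexp (t \<bullet> y) = iexp (\<tau> \<bullet> y) * iexp (\<alpha> * (\<theta> \<bullet> y))"
        by (simp add: \<tau>_def inner_diff_left exp_add[symmetric] algebra_simps)
      moreover have "exp (\<theta> \<bullet> y - v / 2) = exp (- v / 2) * exp (\<theta> \<bullet> y)"
        by (simp add: exp_add[symmetric])
      ultimately show "exp (\<theta> \<bullet> y - v / 2) *\<^sub>R iexp (t \<bullet> y) =
          exp (- v / 2) *\<^sub>R (iexp (\<tau> \<bullet> y) * (exp (\<theta> \<bullet> y) *\<^sub>R iexp (\<alpha> * (\<theta> \<bullet> y))))"
        by (simp only: scaleR_conv_of_real of_real_mult mult_ac)
    qed simp
    also have "\<dots> = exp (- v / 2) *\<^sub>R ((\<integral>y. iexp (\<tau> \<bullet> y) \<partial>N) * (\<integral>y. exp (\<theta> \<bullet> y) *\<^sub>R iexp (\<alpha> * (\<theta> \<bullet> y)) \<partial>N))"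
      unfolding integral_scaleR_right fact ..
    also have "\<dots> = of_real (exp (- v / 2) * exp (- (\<tau> \<bullet> (V *v \<tau>)) / 2) * exp (v / 2) * exp (- (\<alpha>\<^sup>2 * v) / 2)) * iexp (\<alpha> * v)"
      unfolding char e2 by (simp add: scaleR_conv_of_real mult_ac)
    also have "exp (- v / 2) * exp (- (\<tau> \<bullet> (V *v \<tau>)) / 2) * exp (v / 2) * exp (- (\<alpha>\<^sup>2 * v) / 2) = exp (- (t \<bullet> (V *v t)) / 2)"
      by (simp add: \<tau>\<tau> exp_add[symmetric] field_simps)
    also have "of_real (exp (- (t \<bullet> (V *v t)) / 2)) * iexp (\<alpha> * v) = (\<integral>y. iexp (t \<bullet> (V *v \<theta>)) * iexp (t \<bullet> y) \<partial>N)"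
      unfolding \<alpha> using char[of t] by (subst integral_mult_right_zero) simp
    also have "\<dots> = (\<integral>y. iexp (t \<bullet> y) \<partial>distr N borel (\<lambda>y. y + V *v \<theta>))"
      by (subst integral_distr) (auto simp: inner_add_right exp_add[symmetric] algebra_simps)
    finally show "(\<integral>y. iexp (t \<bullet> y) \<partial>distr N borel (\<lambda>y. y + V *v \<theta>)) =
      (\<integral>y. iexp (t \<bullet> y) \<partial>density N (\<lambda>y. ennreal (exp (\<theta> \<bullet> y - \<theta> \<bullet> (V *v \<theta>) / 2))))" ..
  qed simp_all
qed

section \<open>Conditional expectations of odd functions\<close>

lemma (in prob_space) subalgebra_generated_sigma:
  assumes [measurable]: "Y \<in> borel_measurable M"
  shows "subalgebra M (generated_sigma M Y)"
  unfolding subalgebra_def generated_sigma_def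
  by (auto simp: sets_vimage_algebra2)

lemma (in prob_space) sigma_finite_subalgebra_generated_sigma:
  assumes "Y \<in> borel_measurable M"
  shows "sigma_finite_subalgebra M (generated_sigma M Y)"
  by (intro finite_measure_subalgebra_is_sigma_finite finite_measure_subalgebra.intro
      finite_measure_subalgebra_axioms.intro finite_measure_axioms subalgebra_generated_sigma assms)

lemma measurable_generated_sigma:
  fixes Y :: "'a \<Rightarrow> 'b::topological_space" and g :: "'b \<Rightarrow> 'c::topological_space"
  assumes "g \<in> borel_measurable borel"
  shows "(\<lambda>\<omega>. g (Y \<omega>)) \<in> borel_measurable (generated_sigma M Y)"
  unfolding generated_sigma_def
  by (rule measurable_compose[OF measurable_vimage_algebra1 assms]) auto

lemma sets_generated_sigmaE:
  fixes Y :: "'a \<Rightarrow> 'b::topological_space"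
  assumes "A \<in> sets (generated_sigma M Y)"
  obtains B where "B \<in> sets borel" "A = Y -` B \<inter> space M"
  using assms unfolding generated_sigma_def by (auto simp: sets_vimage_algebra2)

text \<open>The conditional expectations of the positive and the negative part of \<open>f R\<close> agree, because \<open>R\<close> may
  be replaced by \<open>- R\<close> jointly with \<open>Y\<close>. The argument takes place in the nonnegative extended reals and
  so covers functions such as cubes of square integrable variables, which need not be integrable.\<close>

lemma (in prob_space) real_cond_exp_odd_eq_0:
  fixes R :: "'a \<Rightarrow> 'b::euclidean_space" and Y :: "'a \<Rightarrow> 'c::euclidean_space" and f :: "'b \<Rightarrow> real"
  assumes R[measurable]: "R \<in> borel_measurable M" and Y[measurable]: "Y \<in> borel_measurable M"
    and law: "distr M borel (\<lambda>\<omega>. (R \<omega>, Y \<omega>)) = distr M borel (\<lambda>\<omega>. (- R \<omega>, Y \<omega>))"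
    and f[measurable]: "f \<in> borel_measurable borel" and odd: "\<And>r. f (- r) = - f r"
  shows "AE \<omega> in M. real_cond_exp M (generated_sigma M Y) (\<lambda>\<omega>. f (R \<omega>)) \<omega> = 0"
proof -
  let ?F = "generated_sigma M Y"
  interpret sigma_finite_subalgebra M ?F
    by (rule sigma_finite_subalgebra_generated_sigma) simp
  have "AE \<omega> in M. nn_cond_exp M ?F (\<lambda>\<omega>. ennreal (f (R \<omega>))) \<omega> =
      nn_cond_exp M ?F (\<lambda>\<omega>. ennreal (- f (R \<omega>))) \<omega>"
  proof (rule nn_cond_exp_charact)
    fix A assume A: "A \<in> sets ?F"
    then obtain B where B[measurable]: "B \<in> sets borel" and AB: "A = Y -` B \<inter> space M"
      by (rule sets_generated_sigmaE)
    have ind: "indicator A \<omega> = (indicator B (Y \<omega>) :: ennreal)" if "\<omega> \<in> space M" for \<omega>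
      using that by (simp add: AB indicator_def)
    have snd[measurable]: "snd \<in> borel_measurable (borel :: ('b \<times> 'c) measure)"
      "fst \<in> borel_measurable (borel :: ('b \<times> 'c) measure)"
      by (simp_all add: borel_prod[symmetric])
    have "(\<integral>\<^sup>+ \<omega>\<in>A. nn_cond_exp M ?F (\<lambda>\<omega>. ennreal (f (R \<omega>))) \<omega> \<partial>M) =
        (\<integral>\<^sup>+ \<omega>. indicator A \<omega> * ennreal (f (R \<omega>)) \<partial>M)"
      using A by (subst nn_cond_exp_intg[symmetric]) (auto simp: mult.commute)
    also have "\<dots> = (\<integral>\<^sup>+ \<omega>. ennreal (f (fst (R \<omega>, Y \<omega>))) * indicator B (snd (R \<omega>, Y \<omega>)) \<partial>M)"
      by (rule nn_integral_cong) (simp add: ind mult.commute)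
    also have "\<dots> = (\<integral>\<^sup>+ z. ennreal (f (fst z)) * indicator B (snd z) \<partial>distr M borel (\<lambda>\<omega>. (R \<omega>, Y \<omega>)))"
      by (subst nn_integral_distr) auto
    also have "\<dots> = (\<integral>\<^sup>+ \<omega>. ennreal (f (fst (- R \<omega>, Y \<omega>))) * indicator B (snd (- R \<omega>, Y \<omega>)) \<partial>M)"
      unfolding law by (subst nn_integral_distr) auto
    also have "\<dots> = (\<integral>\<^sup>+ \<omega>\<in>A. ennreal (- f (R \<omega>)) \<partial>M)"
      by (rule nn_integral_cong) (simp add: ind odd)
    finally show "(\<integral>\<^sup>+ \<omega>\<in>A. ennreal (- f (R \<omega>)) \<partial>M) =
        (\<integral>\<^sup>+ \<omega>\<in>A. nn_cond_exp M ?F (\<lambda>\<omega>. ennreal (f (R \<omega>))) \<omega> \<partial>M)" by simp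
  qed auto
  then show ?thesis by (auto simp: real_cond_exp_def)
qed

section \<open>The observation model\<close>

text \<open>The adjoint of a matrix is written as \<open>transpose A *v a\<close> below, and not in the row vector notation
  to which the simplifier would turn it.\<close>

declare transpose_matrix_vector[simp del]

locale linear_gaussian_observation = prob_space P for P :: "'a measure" +
  fixes Z :: "real^'p^'q" and V :: "real^'q^'q"
    and X :: "'a \<Rightarrow> real^'p" and Y \<epsilon> :: "'a \<Rightarrow> real^'q" and M :: "real^'q^'p"
  assumes X[measurable]: "X \<in> borel_measurable P"
    and square_integrable_X: "\<And>i. integrable P (\<lambda>\<omega>. (X \<omega> $ i)\<^sup>2)"
    and centered_X: "\<And>i. (\<integral>\<omega>. X \<omega> $ i \<partial>P) = 0"
    and \<epsilon>[measurable]: "\<epsilon> \<in> borel_measurable P"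
    and normal_\<epsilon>: "multivariate_normal 0 V (distr P borel \<epsilon>)"
    and indep: "indep_random_vectors P \<epsilon> X"
    and Y: "\<And>\<omega>. Y \<omega> = Z *v X \<omega> + \<epsilon> \<omega>"
    and M: "M = cross_covariance P X Y ** moore_penrose (cross_covariance P Y Y)"
    and rank_IMZ: "rank (mat 1 - M ** Z) = CARD('p)"
    and rank_Z: "rank Z = CARD('p)"
begin

lemma measurable_matrix_vector[measurable (raw)]:
  fixes A :: "real^'m^'n"
  shows "f \<in> borel_measurable N \<Longrightarrow> (\<lambda>\<omega>. A *v f \<omega>) \<in> borel_measurable N"
  by (rule borel_measurable_continuous_on[OF linear_continuous_on[OF matrix_vector_mul_bounded_linear]])

lemma Y_measurable[measurable]: "Y \<in> borel_measurable P"
  unfolding Y[abs_def] by measurable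

lemma mean_inner_X: "(\<integral>\<omega>. a \<bullet> X \<omega> \<partial>P) = 0"
  using centered_X square_integrable_imp_integrable[OF _ square_integrable_X]
  by (simp add: inner_vec_sum Bochner_Integration.integral_sum)

lemma square_integrable_inner_X: "integrable P (\<lambda>\<omega>. (a \<bullet> X \<omega>)\<^sup>2)"
  by (rule integrable_inner_square[OF X square_integrable_X])

lemma mean_inner_\<epsilon>: "(\<integral>\<omega>. b \<bullet> \<epsilon> \<omega> \<partial>P) = 0"
  using inner_multivariate_normal(3)[OF \<epsilon> normal_\<epsilon>, of b] by simp

lemma square_integrable_inner_\<epsilon>: "integrable P (\<lambda>\<omega>. (b \<bullet> \<epsilon> \<omega>)\<^sup>2)"
  using inner_multivariate_normal(4)[OF \<epsilon> normal_\<epsilon>, of b] by simp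

lemma variance_inner_\<epsilon>: "(\<integral>\<omega>. (b \<bullet> \<epsilon> \<omega>)\<^sup>2 \<partial>P) = b \<bullet> (V *v b)"
  using inner_multivariate_normal(5)[OF \<epsilon> normal_\<epsilon>, of b] by simp

lemma char_\<epsilon>: "(\<integral>\<omega>. iexp (b \<bullet> \<epsilon> \<omega>) \<partial>P) = of_real (exp (- (b \<bullet> (V *v b)) / 2))"
  using char_multivariate_normal[OF \<epsilon> normal_\<epsilon>, of b] by simp

lemma V_symmetric: "transpose V = V" and V_nonneg: "0 \<le> t \<bullet> (V *v t)"
  using normal_\<epsilon> by (auto simp: multivariate_normal_def)

lemma indep_events_X_\<epsilon>:
  assumes "A \<in> sets borel" "B \<in> sets borel"
  shows "prob ((X -` A \<inter> space P) \<inter> (\<epsilon> -` B \<inter> space P)) = prob (X -` A \<inter> space P) * prob (\<epsilon> -` B \<inter> space P)"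
proof -
  have "prob ((\<epsilon> -` B \<inter> space P) \<inter> (X -` A \<inter> space P)) = prob (\<epsilon> -` B \<inter> space P) * prob (X -` A \<inter> space P)"
    using indep assms unfolding indep_random_vectors_def generated_sigma_def
    by (intro indep_setD) (auto intro: in_vimage_algebra)
  then show ?thesis by (simp add: Int_commute mult.commute)
qed

text \<open>The independence of the two vectors, which have different types, is transferred to functions of them
  with values in a common type, where the usual notion of independent variables applies.\<close>

lemma indep_var_of_X_\<epsilon>:
  fixes f :: "real^'p \<Rightarrow> 'b::topological_space" and g :: "real^'q \<Rightarrow> 'b"
  assumes f[measurable]: "f \<in> borel_measurable borel" and g[measurable]: "g \<in> borel_measurable borel"
  shows "indep_var borel (\<lambda>\<omega>. f (X \<omega>)) borel (\<lambda>\<omega>. g (\<epsilon> \<omega>))"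
proof -
  have *: "sigma_sets (space P) {(\<lambda>\<omega>. h (U \<omega>)) -` A \<inter> space P |A. A \<in> sets borel} \<subseteq>
      {U -` A \<inter> space P |A. A \<in> sets borel}" (is "sigma_sets _ ?E \<subseteq> _")
    if [measurable]: "h \<in> borel_measurable borel" for h :: "'c::topological_space \<Rightarrow> 'b" and U :: "'a \<Rightarrow> 'c"
  proof -
    have "{U -` A \<inter> space P |A. A \<in> sets borel} = sets (vimage_algebra (space P) U borel)"
      by (simp add: sets_vimage_algebra2)
    moreover have "?E \<subseteq> sets (vimage_algebra (space P) U borel)"
      using measurable_sets[OF measurable_generated_sigma[OF that, of U P]]
      by (auto simp: generated_sigma_def)
    ultimately show ?thesis
      using sets.sigma_sets_subset[of ?E "vimage_algebra (space P) U borel"] by simp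
  qed
  show ?thesis
    unfolding indep_var_eq indep_sets2_eq
  proof (intro conjI ballI)
    show "random_variable borel (\<lambda>\<omega>. f (X \<omega>))" "random_variable borel (\<lambda>\<omega>. g (\<epsilon> \<omega>))" by auto
    show "sigma_sets (space P) {(\<lambda>\<omega>. f (X \<omega>)) -` A \<inter> space P |A. A \<in> sets borel} \<subseteq> events"
      "sigma_sets (space P) {(\<lambda>\<omega>. g (\<epsilon> \<omega>)) -` A \<inter> space P |A. A \<in> sets borel} \<subseteq> events"
      by (rule order_trans[OF *[OF f, of X]]; auto) (rule order_trans[OF *[OF g, of \<epsilon>]]; auto)
    fix a b
    assume ab: "a \<in> sigma_sets (space P) {(\<lambda>\<omega>. f (X \<omega>)) -` A \<inter> space P |A. A \<in> sets borel}"
      "b \<in> sigma_sets (space P) {(\<lambda>\<omega>. g (\<epsilon> \<omega>)) -` A \<inter> space P |A. A \<in> sets borel}"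
    obtain A where "A \<in> sets borel" "a = X -` A \<inter> space P"
      using subsetD[OF *[OF f, of X] ab(1)] by auto
    moreover obtain B where "B \<in> sets borel" "b = \<epsilon> -` B \<inter> space P"
      using subsetD[OF *[OF g, of \<epsilon>] ab(2)] by auto
    ultimately show "prob (a \<inter> b) = prob a * prob b" using indep_events_X_\<epsilon> by simp
  qed
qed

lemma integral_product_X_\<epsilon>:
  fixes f :: "real^'p \<Rightarrow> 'b::{real_normed_field, banach, second_countable_topology}" and g :: "real^'q \<Rightarrow> 'b"
  assumes "f \<in> borel_measurable borel" "g \<in> borel_measurable borel"
    and "integrable P (\<lambda>\<omega>. f (X \<omega>))" "integrable P (\<lambda>\<omega>. g (\<epsilon> \<omega>))"
  shows "(\<integral>\<omega>. f (X \<omega>) * g (\<epsilon> \<omega>) \<partial>P) = (\<integral>\<omega>. f (X \<omega>) \<partial>P) * (\<integral>\<omega>. g (\<epsilon> \<omega>) \<partial>P)"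
    and "integrable P (\<lambda>\<omega>. f (X \<omega>) * g (\<epsilon> \<omega>))"
  by (rule indep_var_lebesgue_integral[OF indep_var_of_X_\<epsilon>[OF assms(1,2)] assms(3,4)],
      rule indep_var_integrable[OF indep_var_of_X_\<epsilon>[OF assms(1,2)] assms(3,4)])

lemma integrable_inner_X: "integrable P (\<lambda>\<omega>. a \<bullet> X \<omega>)"
  by (rule square_integrable_imp_integrable[OF _ square_integrable_inner_X]) measurable

lemma integrable_inner_\<epsilon>: "integrable P (\<lambda>\<omega>. b \<bullet> \<epsilon> \<omega>)"
  by (rule square_integrable_imp_integrable[OF _ square_integrable_inner_\<epsilon>]) measurable

lemma X_\<epsilon>_uncorrelated: "(\<integral>\<omega>. (a \<bullet> X \<omega>) * (b \<bullet> \<epsilon> \<omega>) \<partial>P) = 0" "integrable P (\<lambda>\<omega>. (a \<bullet> X \<omega>) * (b \<bullet> \<epsilon> \<omega>))"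
  using integral_product_X_\<epsilon>[of "\<lambda>x. a \<bullet> x" "\<lambda>x. b \<bullet> x"] integrable_inner_X integrable_inner_\<epsilon> mean_inner_X
  by simp_all

lemma inner_Y: "b \<bullet> Y \<omega> = (transpose Z *v b) \<bullet> X \<omega> + b \<bullet> \<epsilon> \<omega>"
  by (simp add: Y inner_add_right transpose_matrix_vector dot_lmul_matrix)

lemma mean_inner_Y: "(\<integral>\<omega>. b \<bullet> Y \<omega> \<partial>P) = 0"
  using integrable_inner_X integrable_inner_\<epsilon> mean_inner_X mean_inner_\<epsilon> by (simp add: inner_Y)

lemma square_integrable_inner_Y: "integrable P (\<lambda>\<omega>. (b \<bullet> Y \<omega>)\<^sup>2)"
  unfolding inner_Y power2_sum
  using square_integrable_inner_X square_integrable_inner_\<epsilon> X_\<epsilon>_uncorrelated(2)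
  by (auto simp: mult.assoc)

lemma integrable_inner_Y: "integrable P (\<lambda>\<omega>. b \<bullet> Y \<omega>)"
  by (rule square_integrable_imp_integrable[OF _ square_integrable_inner_Y]) measurable

lemma integrable_XY: "integrable P (\<lambda>\<omega>. (a \<bullet> X \<omega>) * (b \<bullet> Y \<omega>))"
  by (intro integrable_mult_of_squares square_integrable_inner_X square_integrable_inner_Y) measurable

lemma integrable_YY: "integrable P (\<lambda>\<omega>. (a \<bullet> Y \<omega>) * (b \<bullet> Y \<omega>))"
  by (intro integrable_mult_of_squares square_integrable_inner_Y) measurable

lemma cross_covariance_XY: "a \<bullet> (cross_covariance P X Y *v b) = (\<integral>\<omega>. (a \<bullet> X \<omega>) * (b \<bullet> Y \<omega>) \<partial>P)"
  using mean_inner_Y[of "axis _ 1"] integrable_XY[of "axis _ 1" "axis _ 1"] centered_X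
  by (intro cross_covariance_inner) (simp_all add: inner_axis')

lemma cross_covariance_YY: "a \<bullet> (cross_covariance P Y Y *v b) = (\<integral>\<omega>. (a \<bullet> Y \<omega>) * (b \<bullet> Y \<omega>) \<partial>P)"
  using mean_inner_Y[of "axis _ 1"] integrable_YY[of "axis _ 1" "axis _ 1"]
  by (intro cross_covariance_inner) (simp_all add: inner_axis')

lemma AE_0_if_square_integral_0:
  fixes f :: "'a \<Rightarrow> real"
  assumes "f \<in> borel_measurable P" "integrable P (\<lambda>\<omega>. (f \<omega>)\<^sup>2)" "(\<integral>\<omega>. (f \<omega>)\<^sup>2 \<partial>P) = 0"
  shows "AE \<omega> in P. f \<omega> = 0"
proof -
  have "AE \<omega> in P. (f \<omega>)\<^sup>2 = 0"
    using assms by (subst integral_nonneg_eq_0_iff_AE[symmetric]) auto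
  then show ?thesis by simp
qed

lemma AE_eq_if_inner:
  fixes f g :: "'a \<Rightarrow> real^'n"
  assumes "\<And>a. AE \<omega> in P. a \<bullet> f \<omega> = a \<bullet> g \<omega>"
  shows "AE \<omega> in P. f \<omega> = g \<omega>"
proof -
  have "AE \<omega> in P. \<forall>i\<in>UNIV. axis i 1 \<bullet> f \<omega> = axis i 1 \<bullet> g \<omega>"
    using assms by (intro AE_finite_allI) auto
  then show ?thesis by (simp add: inner_axis' vec_eq_iff)
qed

definition R :: "'a \<Rightarrow> real^'p" where "R \<omega> = X \<omega> - M *v Y \<omega>"

lemma R_measurable[measurable]: "R \<in> borel_measurable P"
  unfolding R_def[abs_def] by measurable

text \<open>The columns of \<open>G K - 1\<close> lie in the kernel of \<open>K = Var Y\<close>, for each generalized inverse \<open>G\<close> of \<open>K\<close>. A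
  vector \<open>d\<close> in this kernel has \<open>d \<bullet> Y = 0\<close> almost surely, so it is also in the kernel of \<open>Cov X Y\<close>.\<close>

lemma M_normal_equation: "M ** cross_covariance P Y Y = cross_covariance P X Y"
proof -
  define K where "K = cross_covariance P Y Y"
  define C where "C = cross_covariance P X Y"
  define G where "G = moore_penrose K"
  have KGK: "K ** G ** K = K"
    using is_moore_penrose_moore_penrose[of K] by (simp add: is_moore_penrose_def G_def)
  have "C *v (G ** K *v b - b) = 0" for b
  proof -
    define d where "d = G ** K *v b - b"
    have "K *v d = 0"
      unfolding d_def matrix_vector_mult_diff_distrib matrix_vector_mul_assoc matrix_mul_assoc KGK by simp
    then have "(\<integral>\<omega>. (d \<bullet> Y \<omega>)\<^sup>2 \<partial>P) = 0"
      using cross_covariance_YY[of d d] by (simp add: K_def power2_eq_square)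
    then have "AE \<omega> in P. d \<bullet> Y \<omega> = 0"
      by (intro AE_0_if_square_integral_0 square_integrable_inner_Y) measurable
    then have z: "(\<integral>\<omega>. (a \<bullet> X \<omega>) * (d \<bullet> Y \<omega>) \<partial>P) = (\<integral>\<omega>. 0 \<partial>P)" for a
      by (intro integral_cong_AE) auto
    have "(C *v d) \<bullet> (C *v d) = 0"
      using z[of "C *v d"] by (simp add: C_def cross_covariance_XY[symmetric])
    then show ?thesis by (simp add: d_def)
  qed
  then have "C ** (G ** K) *v b = C *v b" for b
    by (simp add: matrix_vector_mult_diff_distrib matrix_vector_mul_assoc)
  then have "C ** (G ** K) = C" by (simp add: matrix_eq)
  then show ?thesis by (simp add: M K_def C_def G_def matrix_mul_assoc)
qed

lemma inner_matrix: "a \<bullet> (A *v x) = (transpose A *v a) \<bullet> x"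
  for A :: "real^'m^'n"
  by (simp add: transpose_matrix_vector dot_lmul_matrix)

lemma R_orthogonal: "(\<integral>\<omega>. (a \<bullet> R \<omega>) * (b \<bullet> Y \<omega>) \<partial>P) = 0"
proof -
  have "(\<integral>\<omega>. (a \<bullet> R \<omega>) * (b \<bullet> Y \<omega>) \<partial>P) =
      (\<integral>\<omega>. (a \<bullet> X \<omega>) * (b \<bullet> Y \<omega>) - ((transpose M *v a) \<bullet> Y \<omega>) * (b \<bullet> Y \<omega>) \<partial>P)"
    by (simp add: R_def inner_diff_right inner_matrix left_diff_distrib)
  also have "\<dots> = a \<bullet> (cross_covariance P X Y *v b) - (transpose M *v a) \<bullet> (cross_covariance P Y Y *v b)"
    using integrable_XY integrable_YY by (simp add: cross_covariance_XY cross_covariance_YY)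
  also have "\<dots> = 0"
    by (simp add: inner_matrix[symmetric] matrix_vector_mul_assoc M_normal_equation)
  finally show ?thesis .
qed

lemma inner_R: "a \<bullet> R \<omega> = (transpose (mat 1 - M ** Z) *v a) \<bullet> X \<omega> - (transpose M *v a) \<bullet> \<epsilon> \<omega>"
  by (simp add: R_def Y inner_matrix[symmetric] matrix_vector_mult_diff_rdistrib inner_diff_right
      matrix_vector_right_distrib matrix_vector_mul_assoc inner_add_right)

lemma IMZ_transpose_surj: obtains a where "transpose (mat 1 - M ** Z) *v a = c"
proof -
  obtain B where "B ** (mat 1 - M ** Z) = mat 1"
    using rank_IMZ full_rank_injective[of "mat 1 - M ** Z"] matrix_left_invertible_injective by metis
  then have "transpose (mat 1 - M ** Z) ** transpose B = mat 1"
    by (metis matrix_transpose_mul transpose_mat)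
  then have "transpose (mat 1 - M ** Z) *v (transpose B *v c) = c"
    by (simp add: matrix_vector_mul_assoc)
  then show ?thesis by (rule that)
qed

lemma Z_transpose_surj: obtains u where "transpose Z *v u = c"
proof -
  obtain B where "B ** Z = mat 1"
    using rank_Z full_rank_injective[of Z] matrix_left_invertible_injective by metis
  then have "transpose Z ** transpose B = mat 1"
    by (metis matrix_transpose_mul transpose_mat)
  then have "transpose Z *v (transpose B *v c) = c"
    by (simp add: matrix_vector_mul_assoc)
  then show ?thesis by (rule that)
qed

abbreviation \<F> :: "'a measure" where "\<F> \<equiv> generated_sigma P Y"

sublocale F: sigma_finite_subalgebra P \<F>
  by (rule sigma_finite_subalgebra_generated_sigma) simp

lemma inner_cond_exp_vec:
  "AE \<omega> in P. a \<bullet> cond_exp_vec P X Y \<omega> = real_cond_exp P \<F> (\<lambda>\<omega>. a \<bullet> X \<omega>) \<omega>"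
proof -
  have i: "integrable P (\<lambda>\<omega>. X \<omega> $ i)" for i
    using integrable_inner_X[of "axis i 1"] by (simp add: inner_axis')
  have "AE \<omega> in P. real_cond_exp P \<F> (\<lambda>\<omega>. \<Sum>i\<in>UNIV. a $ i * X \<omega> $ i) \<omega> =
      (\<Sum>i\<in>UNIV. real_cond_exp P \<F> (\<lambda>\<omega>. a $ i * X \<omega> $ i) \<omega>)"
    using i by (intro F.real_cond_exp_sum) simp
  moreover have "AE \<omega> in P. \<forall>i\<in>UNIV. real_cond_exp P \<F> (\<lambda>\<omega>. a $ i * X \<omega> $ i) \<omega> = a $ i * real_cond_exp P \<F> (\<lambda>\<omega>. X \<omega> $ i) \<omega>"
    using i by (intro AE_finite_allI F.real_cond_exp_cmult) auto
  ultimately show ?thesis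
    by eventually_elim (simp add: inner_vec_sum cond_exp_vec_def)
qed

lemma cond_exp_vec_eqI:
  assumes "\<And>a. AE \<omega> in P. real_cond_exp P \<F> (\<lambda>\<omega>. a \<bullet> X \<omega>) \<omega> = a \<bullet> f \<omega>"
  shows "AE \<omega> in P. cond_exp_vec P X Y \<omega> = f \<omega>"
proof (rule AE_eq_if_inner)
  fix a
  show "AE \<omega> in P. a \<bullet> cond_exp_vec P X Y \<omega> = a \<bullet> f \<omega>"
    using inner_cond_exp_vec[of a] assms[of a] by eventually_elim simp
qed

section \<open>Normal states have linear filters and symmetric errors\<close>

text \<open>A linear combination \<open>a \<bullet> R + b \<bullet> Y\<close> is a sum of a functional of \<open>X\<close> and an independent functional of
  \<open>\<epsilon>\<close>, hence normal, and by orthogonality its variance is the sum of the variances of \<open>a \<bullet> R\<close> and \<open>b \<bullet> Y\<close>.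
  This is even in \<open>a\<close>.\<close>

lemma symmetric_law_R_Y:
  assumes "is_normal_law (distr P borel X)"
  shows "distr P borel (\<lambda>\<omega>. (R \<omega>, Y \<omega>)) = distr P borel (\<lambda>\<omega>. (- R \<omega>, Y \<omega>))"
proof -
  have charX: "(\<integral>\<omega>. iexp (c \<bullet> X \<omega>) \<partial>P) = of_real (exp (- (\<integral>\<omega>. (c \<bullet> X \<omega>)\<^sup>2 \<partial>P) / 2))" for c
    using assms centered_is_normal_law_iff_char[OF X square_integrable_X centered_X] by simp
  have char: "(\<integral>\<omega>. iexp (a \<bullet> R \<omega> + b \<bullet> Y \<omega>) \<partial>P) =
      of_real (exp (- ((\<integral>\<omega>. (a \<bullet> R \<omega>)\<^sup>2 \<partial>P) + (\<integral>\<omega>. (b \<bullet> Y \<omega>)\<^sup>2 \<partial>P)) / 2))" for a b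
  proof -
    define c where "c = transpose (mat 1 - M ** Z) *v a + transpose Z *v b"
    define d where "d = b - transpose M *v a"
    have e: "a \<bullet> R \<omega> + b \<bullet> Y \<omega> = c \<bullet> X \<omega> + d \<bullet> \<epsilon> \<omega>" for \<omega>
      by (simp add: inner_R inner_Y c_def d_def inner_add_left inner_diff_left)
    have iR: "integrable P (\<lambda>\<omega>. (a \<bullet> R \<omega>)\<^sup>2)"
      unfolding inner_R power2_diff
      using square_integrable_inner_X square_integrable_inner_\<epsilon> X_\<epsilon>_uncorrelated(2) by (auto simp: mult.assoc)
    have iRY: "integrable P (\<lambda>\<omega>. (a \<bullet> R \<omega>) * (b \<bullet> Y \<omega>))"
      by (intro integrable_mult_of_squares iR square_integrable_inner_Y) measurable
    have "(\<integral>\<omega>. (a \<bullet> R \<omega>)\<^sup>2 \<partial>P) + (\<integral>\<omega>. (b \<bullet> Y \<omega>)\<^sup>2 \<partial>P) = (\<integral>\<omega>. (a \<bullet> R \<omega> + b \<bullet> Y \<omega>)\<^sup>2 \<partial>P)"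
      unfolding power2_sum mult.assoc
      using iR iRY square_integrable_inner_Y R_orthogonal by simp
    also have "\<dots> = (\<integral>\<omega>. (c \<bullet> X \<omega>)\<^sup>2 \<partial>P) + (\<integral>\<omega>. (d \<bullet> \<epsilon> \<omega>)\<^sup>2 \<partial>P)"
      unfolding e power2_sum mult.assoc
      using square_integrable_inner_X square_integrable_inner_\<epsilon> X_\<epsilon>_uncorrelated by simp
    finally have v: "(\<integral>\<omega>. (a \<bullet> R \<omega>)\<^sup>2 \<partial>P) + (\<integral>\<omega>. (b \<bullet> Y \<omega>)\<^sup>2 \<partial>P) =
      (\<integral>\<omega>. (c \<bullet> X \<omega>)\<^sup>2 \<partial>P) + (\<integral>\<omega>. (d \<bullet> \<epsilon> \<omega>)\<^sup>2 \<partial>P)" .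
    have "(\<integral>\<omega>. iexp (a \<bullet> R \<omega> + b \<bullet> Y \<omega>) \<partial>P) = (\<integral>\<omega>. iexp (c \<bullet> X \<omega>) * iexp (d \<bullet> \<epsilon> \<omega>) \<partial>P)"
      unfolding e by (simp add: exp_add[symmetric] algebra_simps)
    also have "\<dots> = (\<integral>\<omega>. iexp (c \<bullet> X \<omega>) \<partial>P) * (\<integral>\<omega>. iexp (d \<bullet> \<epsilon> \<omega>) \<partial>P)"
      by (rule integral_product_X_\<epsilon>) (auto intro!: integrable_const_bound[where B = 1])
    also have "\<dots> = of_real (exp (- (\<integral>\<omega>. (c \<bullet> X \<omega>)\<^sup>2 \<partial>P) / 2) * exp (- (\<integral>\<omega>. (d \<bullet> \<epsilon> \<omega>)\<^sup>2 \<partial>P) / 2))"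
      unfolding charX char_\<epsilon> variance_inner_\<epsilon> of_real_mult ..
    also have "\<dots> = of_real (exp (- ((\<integral>\<omega>. (a \<bullet> R \<omega>)\<^sup>2 \<partial>P) + (\<integral>\<omega>. (b \<bullet> Y \<omega>)\<^sup>2 \<partial>P)) / 2))"
      unfolding v exp_add[symmetric] by (simp add: field_simps)
    finally show ?thesis .
  qed
  show ?thesis
  proof (rule finite_measure_eqI_char)
    show "finite_measure (distr P borel (\<lambda>\<omega>. (R \<omega>, Y \<omega>)))" "finite_measure (distr P borel (\<lambda>\<omega>. (- R \<omega>, Y \<omega>)))"
      by (intro finite_measure_distr; simp)+
    fix t :: "(real^'p) \<times> (real^'q)"
    obtain a b where t: "t = (a, b)" by (cases t)
    show "(\<integral>z. iexp (t \<bullet> z) \<partial>distr P borel (\<lambda>\<omega>. (R \<omega>, Y \<omega>))) =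
        (\<integral>z. iexp (t \<bullet> z) \<partial>distr P borel (\<lambda>\<omega>. (- R \<omega>, Y \<omega>)))"
      using char[of a b] char[of "- a" b]
      by (subst (1 2) integral_distr) (simp_all add: t inner_Pair)
  qed simp_all
qed

theorem normal_imp_linear:
  assumes "is_normal_law (distr P borel X)"
  shows "AE \<omega> in P. cond_exp_vec P X Y \<omega> = M *v Y \<omega>"
proof (rule cond_exp_vec_eqI)
  fix a
  let ?b = "transpose M *v a"
  have [measurable]: "(\<lambda>\<omega>. ?b \<bullet> Y \<omega>) \<in> borel_measurable \<F>"
    by (rule measurable_generated_sigma) measurable
  have iR: "integrable P (\<lambda>\<omega>. a \<bullet> R \<omega>)"
    unfolding inner_R using integrable_inner_X integrable_inner_\<epsilon> by simp
  have "AE \<omega> in P. real_cond_exp P \<F> (\<lambda>\<omega>. ?b \<bullet> Y \<omega> + a \<bullet> R \<omega>) \<omega> =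
      real_cond_exp P \<F> (\<lambda>\<omega>. ?b \<bullet> Y \<omega>) \<omega> + real_cond_exp P \<F> (\<lambda>\<omega>. a \<bullet> R \<omega>) \<omega>"
    by (rule F.real_cond_exp_add[OF integrable_inner_Y iR])
  moreover have "AE \<omega> in P. real_cond_exp P \<F> (\<lambda>\<omega>. ?b \<bullet> Y \<omega>) \<omega> = ?b \<bullet> Y \<omega>"
    by (rule F.real_cond_exp_F_meas[OF integrable_inner_Y]) measurable
  moreover have "AE \<omega> in P. real_cond_exp P \<F> (\<lambda>\<omega>. a \<bullet> R \<omega>) \<omega> = 0"
    by (rule real_cond_exp_odd_eq_0[OF _ _ symmetric_law_R_Y[OF assms]]) auto
  ultimately show "AE \<omega> in P. real_cond_exp P \<F> (\<lambda>\<omega>. a \<bullet> X \<omega>) \<omega> = a \<bullet> (M *v Y \<omega>)"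
    by eventually_elim (simp add: R_def inner_matrix inner_diff_right)
qed

lemma measurable_cond_exp_vec[measurable]: "cond_exp_vec P X Y \<in> borel_measurable P"
  unfolding cond_exp_vec_def[abs_def]
  by (subst borel_measurable_euclidean_space) (auto simp: Basis_vec_def inner_axis)

theorem normal_imp_third_moment_0:
  assumes "is_normal_law (distr P borel X)"
  shows "AE \<omega> in P. real_cond_exp P \<F> (\<lambda>\<omega>. (e \<bullet> (X \<omega> - cond_exp_vec P X Y \<omega>)) ^ 3) \<omega> = 0"
proof -
  have "AE \<omega> in P. real_cond_exp P \<F> (\<lambda>\<omega>. (e \<bullet> (X \<omega> - cond_exp_vec P X Y \<omega>)) ^ 3) \<omega> =
      real_cond_exp P \<F> (\<lambda>\<omega>. (e \<bullet> R \<omega>) ^ 3) \<omega>"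
  proof (rule F.real_cond_exp_cong)
    show "AE \<omega> in P. (e \<bullet> (X \<omega> - cond_exp_vec P X Y \<omega>)) ^ 3 = (e \<bullet> R \<omega>) ^ 3"
      using normal_imp_linear[OF assms] by eventually_elim (simp add: R_def)
  qed simp_all
  moreover have "AE \<omega> in P. real_cond_exp P \<F> (\<lambda>\<omega>. (e \<bullet> R \<omega>) ^ 3) \<omega> = 0"
    by (rule real_cond_exp_odd_eq_0[OF _ _ symmetric_law_R_Y[OF assms]]) auto
  ultimately show ?thesis by eventually_elim simp
qed

end

section \<open>Linear filters force normal states\<close>

lemma (in prob_space) has_vector_derivative_integral_iexp:
  fixes f g :: "'a \<Rightarrow> real"
  assumes [measurable]: "f \<in> borel_measurable M" "g \<in> borel_measurable M" and sq: "integrable M (\<lambda>x. (f x)\<^sup>2)"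
  shows "((\<lambda>s. \<integral>x. iexp (g x + s * f x) \<partial>M) has_vector_derivative
    (\<integral>x. \<i> * (of_real (f x) * iexp (g x + s * f x)) \<partial>M)) (at s)"
proof (rule has_vector_derivative_integral)
  show "integrable M (\<lambda>x. iexp (g x + u * f x))" for u
    by (rule integrable_const_bound[where B = 1]) auto
  have "integrable M f" by (rule square_integrable_imp_integrable[OF _ sq]) simp
  then show "integrable M (\<lambda>x. \<i> * (of_real (f x) * iexp (g x + s * f x)))"
    by (rule Bochner_Integration.integrable_bound) (auto simp: norm_mult)
  show "integrable M (\<lambda>x. (f x)\<^sup>2)" by fact
  fix h :: real and x
  have "iexp (g x + (s + h) * f x) - iexp (g x + s * f x) - h *\<^sub>R (\<i> * (of_real (f x) * iexp (g x + s * f x)))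
      = iexp (g x + s * f x) * (iexp (h * f x) - (1 + \<i> * of_real (h * f x)))"
    by (simp add: distrib_right distrib_left exp_add scaleR_conv_of_real algebra_simps)
  also have "norm \<dots> = norm (iexp (h * f x) - (1 + \<i> * of_real (h * f x)))"
    by (simp add: norm_mult del: of_real_mult of_real_add)
  also have "\<dots> \<le> \<bar>h * f x\<bar> ^ 2 / 2"
    using iexp_approx1[of "h * f x" 1] by (simp add: numeral_2_eq_2)
  also have "\<dots> \<le> h\<^sup>2 * (f x)\<^sup>2"
    by (simp add: power_mult_distrib)
  finally show "norm (iexp (g x + (s + h) * f x) - iexp (g x + s * f x) -
      h *\<^sub>R (\<i> * (of_real (f x) * iexp (g x + s * f x)))) \<le> h\<^sup>2 * (f x)\<^sup>2" .
qed

context linear_gaussian_observation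
begin

lemma covariance_\<epsilon>: "(\<integral>\<omega>. (a \<bullet> \<epsilon> \<omega>) * (b \<bullet> \<epsilon> \<omega>) \<partial>P) = a \<bullet> (V *v b)"
proof -
  have comm: "b \<bullet> (V *v a) = a \<bullet> (V *v b)"
    by (metis inner_matrix inner_commute V_symmetric)
  have "(\<integral>\<omega>. ((a + b) \<bullet> \<epsilon> \<omega>)\<^sup>2 \<partial>P) =
      (\<integral>\<omega>. (a \<bullet> \<epsilon> \<omega>)\<^sup>2 + (b \<bullet> \<epsilon> \<omega>)\<^sup>2 + 2 * ((a \<bullet> \<epsilon> \<omega>) * (b \<bullet> \<epsilon> \<omega>)) \<partial>P)"
    by (simp add: inner_add_left power2_sum mult.assoc)
  also have "\<dots> = a \<bullet> (V *v a) + b \<bullet> (V *v b) + 2 * (\<integral>\<omega>. (a \<bullet> \<epsilon> \<omega>) * (b \<bullet> \<epsilon> \<omega>) \<partial>P)"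
    using square_integrable_inner_\<epsilon>
      integrable_mult_of_squares[OF _ _ square_integrable_inner_\<epsilon>[of a] square_integrable_inner_\<epsilon>[of b]]
    by (simp add: variance_inner_\<epsilon>)
  finally show ?thesis
    using comm unfolding variance_inner_\<epsilon>
    by (simp add: inner_add_left inner_add_right matrix_vector_right_distrib)
qed

text \<open>Stein's identity for the noise, tested on exponentials: differentiate the characteristic function
  of \<open>\<epsilon>\<close> at \<open>u\<close> in the direction \<open>d\<close>.\<close>

lemma stein_\<epsilon>:
  "(\<integral>\<omega>. of_real (d \<bullet> \<epsilon> \<omega>) * iexp (u \<bullet> \<epsilon> \<omega>) \<partial>P) = \<i> * of_real (d \<bullet> (V *v u)) * (\<integral>\<omega>. iexp (u \<bullet> \<epsilon> \<omega>) \<partial>P)"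
proof -
  define q where "q s = exp (- ((u + s *\<^sub>R d) \<bullet> (V *v (u + s *\<^sub>R d))) / 2)" for s
  have comm: "u \<bullet> (V *v d) = d \<bullet> (V *v u)"
    by (metis inner_matrix inner_commute V_symmetric)
  have q: "q s = exp (- (u \<bullet> (V *v u) + 2 * s * (d \<bullet> (V *v u)) + s\<^sup>2 * (d \<bullet> (V *v d))) / 2)" for s
    using comm by (simp add: q_def inner_add_left inner_add_right matrix_vector_right_distrib
        matrix_vector_mult_scaleR power2_eq_square algebra_simps)
  have "(q has_real_derivative - (d \<bullet> (V *v u)) * q 0) (at 0)"
    unfolding q by (auto intro!: derivative_eq_intros)
  then have "((\<lambda>s. complex_of_real (q s)) has_vector_derivative of_real (- (d \<bullet> (V *v u)) * q 0)) (at 0)"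
    by (intro bounded_linear.has_vector_derivative[OF bounded_linear_of_real])
      (simp add: has_real_derivative_iff_has_vector_derivative)
  moreover have "complex_of_real (q s) = (\<integral>\<omega>. iexp (u \<bullet> \<epsilon> \<omega> + s * (d \<bullet> \<epsilon> \<omega>)) \<partial>P)" for s
    using char_\<epsilon>[of "u + s *\<^sub>R d"] by (simp add: q_def inner_add_left)
  ultimately have "((\<lambda>s. \<integral>\<omega>. iexp (u \<bullet> \<epsilon> \<omega> + s * (d \<bullet> \<epsilon> \<omega>)) \<partial>P) has_vector_derivative of_real (- (d \<bullet> (V *v u)) * q 0)) (at 0)"
    by simp
  moreover have "((\<lambda>s. \<integral>\<omega>. iexp (u \<bullet> \<epsilon> \<omega> + s * (d \<bullet> \<epsilon> \<omega>)) \<partial>P) has_vector_derivative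
      (\<integral>\<omega>. \<i> * (of_real (d \<bullet> \<epsilon> \<omega>) * iexp (u \<bullet> \<epsilon> \<omega> + 0 * (d \<bullet> \<epsilon> \<omega>))) \<partial>P)) (at 0)"
    by (rule has_vector_derivative_integral_iexp[OF _ _ square_integrable_inner_\<epsilon>]) measurable
  ultimately have "of_real (- (d \<bullet> (V *v u)) * q 0) = \<i> * (\<integral>\<omega>. of_real (d \<bullet> \<epsilon> \<omega>) * iexp (u \<bullet> \<epsilon> \<omega>) \<partial>P)"
    by (auto dest: vector_derivative_unique_at)
  then have "- \<i> * (\<i> * (\<integral>\<omega>. of_real (d \<bullet> \<epsilon> \<omega>) * iexp (u \<bullet> \<epsilon> \<omega>) \<partial>P)) = - \<i> * of_real (- (d \<bullet> (V *v u)) * q 0)"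
    by (simp only:)
  moreover have "(\<integral>\<omega>. iexp (u \<bullet> \<epsilon> \<omega>) \<partial>P) = of_real (q 0)"
    by (simp add: char_\<epsilon> q_def)
  ultimately show ?thesis by simp
qed

lemma linear_cond_exp_test:
  assumes lin: "AE \<omega> in P. cond_exp_vec P X Y \<omega> = A *v Y \<omega>"
    and [measurable]: "\<phi> \<in> borel_measurable borel" and int: "integrable P (\<lambda>\<omega>. \<phi> (Y \<omega>) * (a \<bullet> X \<omega>))"
  shows "(\<integral>\<omega>. \<phi> (Y \<omega>) * (a \<bullet> X \<omega>) \<partial>P) = (\<integral>\<omega>. \<phi> (Y \<omega>) * (a \<bullet> (A *v Y \<omega>)) \<partial>P)"
proof -
  have "(\<integral>\<omega>. \<phi> (Y \<omega>) * (a \<bullet> X \<omega>) \<partial>P) = (\<integral>\<omega>. \<phi> (Y \<omega>) * real_cond_exp P \<F> (\<lambda>\<omega>. a \<bullet> X \<omega>) \<omega> \<partial>P)"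
    by (rule F.real_cond_exp_intg(2)[OF int, symmetric]) (auto intro: measurable_generated_sigma)
  also have "\<dots> = (\<integral>\<omega>. \<phi> (Y \<omega>) * (a \<bullet> (A *v Y \<omega>)) \<partial>P)"
  proof (rule integral_cong_AE)
    show "AE \<omega> in P. \<phi> (Y \<omega>) * real_cond_exp P \<F> (\<lambda>\<omega>. a \<bullet> X \<omega>) \<omega> = \<phi> (Y \<omega>) * (a \<bullet> (A *v Y \<omega>))"
      using inner_cond_exp_vec[of a] lin by eventually_elim simp
  qed auto
  finally show ?thesis .
qed

text \<open>Both \<open>A Y\<close> and \<open>M Y\<close> leave an error that is orthogonal to all linear functionals of \<open>Y\<close>; so the
  linear functionals of \<open>(A - M) Y\<close> are orthogonal to themselves.\<close>

lemma linear_cond_exp_is_M: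
  assumes lin: "AE \<omega> in P. cond_exp_vec P X Y \<omega> = A *v Y \<omega>"
  shows "AE \<omega> in P. cond_exp_vec P X Y \<omega> = M *v Y \<omega>"
proof -
  have "AE \<omega> in P. A *v Y \<omega> = M *v Y \<omega>"
  proof (rule AE_eq_if_inner)
    fix a
    define d where "d = transpose A *v a - transpose M *v a"
    have "(\<integral>\<omega>. (d \<bullet> Y \<omega>) * (a \<bullet> X \<omega>) \<partial>P) = (\<integral>\<omega>. (d \<bullet> Y \<omega>) * (a \<bullet> (A *v Y \<omega>)) \<partial>P)"
      using integrable_XY by (intro linear_cond_exp_test[OF lin]) (auto simp: mult.commute)
    moreover have "(\<integral>\<omega>. (a \<bullet> X \<omega>) * (d \<bullet> Y \<omega>) - ((transpose M *v a) \<bullet> Y \<omega>) * (d \<bullet> Y \<omega>) \<partial>P) = 0"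
      using R_orthogonal[of a d] by (simp add: R_def inner_diff_right inner_matrix left_diff_distrib)
    moreover have "(\<integral>\<omega>. (d \<bullet> Y \<omega>)\<^sup>2 \<partial>P) = (\<integral>\<omega>. ((transpose A *v a) \<bullet> Y \<omega>) * (d \<bullet> Y \<omega>) - ((transpose M *v a) \<bullet> Y \<omega>) * (d \<bullet> Y \<omega>) \<partial>P)"
      by (rule Bochner_Integration.integral_cong) (auto simp: d_def inner_diff_left power2_eq_square algebra_simps)
    ultimately have "(\<integral>\<omega>. (d \<bullet> Y \<omega>)\<^sup>2 \<partial>P) = 0"
      using integrable_XY[of a d] integrable_YY by (simp add: inner_matrix mult.commute)
    then have "AE \<omega> in P. d \<bullet> Y \<omega> = 0"
      by (intro AE_0_if_square_integral_0 square_integrable_inner_Y) measurable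
    then show "AE \<omega> in P. a \<bullet> (A *v Y \<omega>) = a \<bullet> (M *v Y \<omega>)"
      by eventually_elim (simp add: d_def inner_diff_left inner_matrix)
  qed
  with lin show ?thesis by eventually_elim simp
qed

text \<open>With \<open>a\<close> and \<open>u\<close> such that \<open>a \<bullet> R = c \<bullet> X - d \<bullet> \<epsilon>\<close> and \<open>u \<bullet> Y = c \<bullet> X + u \<bullet> \<epsilon>\<close>, the identity
  \<open>E[(a \<bullet> R) exp (i s (u \<bullet> Y))] = 0\<close> factorizes by independence. Stein's identity evaluates the noise
  factors, and what remains after division by the characteristic function of the noise is a linear
  differential equation for the characteristic function of \<open>c \<bullet> X\<close>.\<close>

theorem linear_imp_normal:
  assumes lin: "AE \<omega> in P. cond_exp_vec P X Y \<omega> = A *v Y \<omega>"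
  shows "is_normal_law (distr P borel X)"
  unfolding centered_is_normal_law_iff_char[OF X square_integrable_X centered_X]
proof
  fix c
  define f where "f s = (\<integral>\<omega>. iexp (s * (c \<bullet> X \<omega>)) \<partial>P)" for s
  define \<kappa> where "\<kappa> = (\<integral>\<omega>. (c \<bullet> X \<omega>)\<^sup>2 \<partial>P)"
  obtain a where a: "transpose (mat 1 - M ** Z) *v a = c" by (rule IMZ_transpose_surj)
  obtain u where u: "transpose Z *v u = c" by (rule Z_transpose_surj)
  define d where "d = transpose M *v a"
  have R: "a \<bullet> R \<omega> = c \<bullet> X \<omega> - d \<bullet> \<epsilon> \<omega>" for \<omega> by (simp add: inner_R a d_def)
  have iR: "integrable P (\<lambda>\<omega>. a \<bullet> R \<omega>)" using integrable_inner_X integrable_inner_\<epsilon> by (simp add: R)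
  have uY: "u \<bullet> Y \<omega> = c \<bullet> X \<omega> + u \<bullet> \<epsilon> \<omega>" for \<omega> by (simp add: inner_Y u)
  \<comment> \<open>Orthogonality of \<open>a \<bullet> R\<close> and \<open>u \<bullet> Y\<close> identifies the constant in the differential equation as the variance of \<open>c \<bullet> X\<close>.\<close>
  have \<kappa>: "d \<bullet> (V *v u) = \<kappa>"
  proof -
    have "0 = (\<integral>\<omega>. (c \<bullet> X \<omega>)\<^sup>2 + (c \<bullet> X \<omega>) * (u \<bullet> \<epsilon> \<omega>) - (c \<bullet> X \<omega>) * (d \<bullet> \<epsilon> \<omega>) - (d \<bullet> \<epsilon> \<omega>) * (u \<bullet> \<epsilon> \<omega>) \<partial>P)"
      using R_orthogonal[of a u] by (simp add: R uY algebra_simps power2_eq_square)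
    also have "\<dots> = \<kappa> - d \<bullet> (V *v u)"
      using square_integrable_inner_X X_\<epsilon>_uncorrelated
        integrable_mult_of_squares[OF _ _ square_integrable_inner_\<epsilon>[of d] square_integrable_inner_\<epsilon>[of u]]
      by (simp add: covariance_\<epsilon> \<kappa>_def)
    finally show ?thesis by simp
  qed
  have score: "(\<integral>\<omega>. of_real (c \<bullet> X \<omega>) * iexp (s * (c \<bullet> X \<omega>)) \<partial>P) = \<i> * of_real (s * \<kappa>) * f s" for s
  proof -
    let ?u = "s *\<^sub>R u"
    have z: "(\<integral>\<omega>. \<phi> (?u \<bullet> Y \<omega>) * (a \<bullet> R \<omega>) \<partial>P) = 0"
      if [measurable]: "\<phi> \<in> borel_measurable borel" and b: "\<And>x. \<bar>\<phi> x\<bar> \<le> 1" for \<phi> :: "real \<Rightarrow> real"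
    proof -
      have i: "integrable P (\<lambda>\<omega>. \<phi> (?u \<bullet> Y \<omega>) * (x \<bullet> X \<omega>))" "integrable P (\<lambda>\<omega>. \<phi> (?u \<bullet> Y \<omega>) * (y \<bullet> Y \<omega>))" for x y
        by (rule Bochner_Integration.integrable_bound[OF integrable_inner_X[of x]],
            use mult_right_mono[OF b] in \<open>auto simp: abs_mult\<close>)
          (rule Bochner_Integration.integrable_bound[OF integrable_inner_Y[of y]],
            use mult_right_mono[OF b] in \<open>auto simp: abs_mult\<close>)
      have "(\<integral>\<omega>. \<phi> (?u \<bullet> Y \<omega>) * (a \<bullet> R \<omega>) \<partial>P) =
          (\<integral>\<omega>. \<phi> (?u \<bullet> Y \<omega>) * (a \<bullet> X \<omega>) \<partial>P) - (\<integral>\<omega>. \<phi> (?u \<bullet> Y \<omega>) * (a \<bullet> (M *v Y \<omega>)) \<partial>P)"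
        unfolding inner_matrix
        by (subst Bochner_Integration.integral_diff[OF i, symmetric])
           (simp add: R_def inner_diff_right inner_matrix right_diff_distrib)
      then show ?thesis
        using linear_cond_exp_test[OF linear_cond_exp_is_M[OF lin], of "\<lambda>y. \<phi> (?u \<bullet> y)" a] i(1)[of a] by simp
    qed
    have ic: "integrable P (\<lambda>\<omega>. \<phi> (?u \<bullet> Y \<omega>) * (a \<bullet> R \<omega>))"
      if [measurable]: "\<phi> \<in> borel_measurable borel" and b: "\<And>x. \<bar>\<phi> x\<bar> \<le> 1" for \<phi> :: "real \<Rightarrow> real"
      using mult_right_mono[OF b] by (auto intro!: Bochner_Integration.integrable_bound[OF iR] simp: abs_mult)
    have "(\<integral>\<omega>. of_real (a \<bullet> R \<omega>) * iexp (?u \<bullet> Y \<omega>) \<partial>P) =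
        (\<integral>\<omega>. of_real (cos (?u \<bullet> Y \<omega>) * (a \<bullet> R \<omega>)) + \<i> * of_real (sin (?u \<bullet> Y \<omega>) * (a \<bullet> R \<omega>)) \<partial>P)"
      by (rule Bochner_Integration.integral_cong) (auto simp: complex_eq_iff Re_exp Im_exp)
    also have "\<dots> = 0"
      using z[of cos] z[of sin] ic[of cos] ic[of sin]
      by (subst Bochner_Integration.integral_add) (auto simp del: of_real_mult intro!: integrable_mult_right integrable_of_real)
    finally have zero: "(\<integral>\<omega>. of_real (a \<bullet> R \<omega>) * iexp (?u \<bullet> Y \<omega>) \<partial>P) = 0" .
    have iX: "integrable P (\<lambda>\<omega>. of_real (c \<bullet> X \<omega>) * iexp (s * (c \<bullet> X \<omega>)))"
      by (rule Bochner_Integration.integrable_bound[OF integrable_inner_X[of c]]) (auto simp: norm_mult)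
    have i\<epsilon>: "integrable P (\<lambda>\<omega>. of_real (d \<bullet> \<epsilon> \<omega>) * iexp (?u \<bullet> \<epsilon> \<omega>))"
      by (rule Bochner_Integration.integrable_bound[OF integrable_inner_\<epsilon>[of d]]) (auto simp: norm_mult)
    have i1: "integrable P (\<lambda>\<omega>. iexp (s * (c \<bullet> X \<omega>)))" "integrable P (\<lambda>\<omega>. iexp (?u \<bullet> \<epsilon> \<omega>))"
      by (auto intro!: integrable_const_bound[where B = 1])
    note p1 = integral_product_X_\<epsilon>[of "\<lambda>x. of_real (c \<bullet> x) * iexp (s * (c \<bullet> x))" "\<lambda>x. iexp (?u \<bullet> x)", OF _ _ iX i1(2)]
    note p2 = integral_product_X_\<epsilon>[of "\<lambda>x. iexp (s * (c \<bullet> x))" "\<lambda>x. of_real (d \<bullet> x) * iexp (?u \<bullet> x)", OF _ _ i1(1) i\<epsilon>]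
    have "(\<integral>\<omega>. of_real (a \<bullet> R \<omega>) * iexp (?u \<bullet> Y \<omega>) \<partial>P) =
        (\<integral>\<omega>. (of_real (c \<bullet> X \<omega>) * iexp (s * (c \<bullet> X \<omega>))) * iexp (?u \<bullet> \<epsilon> \<omega>)
          - iexp (s * (c \<bullet> X \<omega>)) * (of_real (d \<bullet> \<epsilon> \<omega>) * iexp (?u \<bullet> \<epsilon> \<omega>)) \<partial>P)"
      by (rule Bochner_Integration.integral_cong) (auto simp: R uY exp_add algebra_simps)
    also have "\<dots> = (\<integral>\<omega>. of_real (c \<bullet> X \<omega>) * iexp (s * (c \<bullet> X \<omega>)) \<partial>P) * (\<integral>\<omega>. iexp (?u \<bullet> \<epsilon> \<omega>) \<partial>P)
        - f s * (\<integral>\<omega>. of_real (d \<bullet> \<epsilon> \<omega>) * iexp (?u \<bullet> \<epsilon> \<omega>) \<partial>P)"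
      unfolding f_def by (subst Bochner_Integration.integral_diff) (use p1 p2 in \<open>simp_all del: of_real_mult inner_scaleR_left\<close>)
    also have "\<dots> = ((\<integral>\<omega>. of_real (c \<bullet> X \<omega>) * iexp (s * (c \<bullet> X \<omega>)) \<partial>P) - \<i> * of_real (s * \<kappa>) * f s) * (\<integral>\<omega>. iexp (?u \<bullet> \<epsilon> \<omega>) \<partial>P)"
      unfolding stein_\<epsilon> unfolding matrix_vector_mult_scaleR inner_scaleR_right \<kappa> by (simp only: left_diff_distrib right_diff_distrib mult_ac)
    finally have "((\<integral>\<omega>. of_real (c \<bullet> X \<omega>) * iexp (s * (c \<bullet> X \<omega>)) \<partial>P) - \<i> * of_real (s * \<kappa>) * f s) * (\<integral>\<omega>. iexp (?u \<bullet> \<epsilon> \<omega>) \<partial>P) = 0"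
      using zero by simp
    moreover have "(\<integral>\<omega>. iexp (?u \<bullet> \<epsilon> \<omega>) \<partial>P) \<noteq> 0" unfolding char_\<epsilon> by simp
    ultimately show ?thesis by simp
  qed
  have df: "(f has_vector_derivative - of_real (s * \<kappa>) * f s) (at s)" for s
  proof -
    have "((\<lambda>s. \<integral>\<omega>. iexp (0 + s * (c \<bullet> X \<omega>)) \<partial>P) has_vector_derivative
        (\<integral>\<omega>. \<i> * (of_real (c \<bullet> X \<omega>) * iexp (0 + s * (c \<bullet> X \<omega>))) \<partial>P)) (at s)"
      by (rule has_vector_derivative_integral_iexp[OF _ _ square_integrable_inner_X]) measurable
    then show ?thesis
      using score[of s] by (simp add: f_def[abs_def] del: of_real_mult) (simp add: algebra_simps)
  qed
  \<comment> \<open>The product with the integrating factor is constant.\<close>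
  define h where "h s = f s * of_real (exp (s\<^sup>2 * \<kappa> / 2))" for s
  have "(h has_vector_derivative 0) (at s)" for s
  proof -
    have "((\<lambda>s. exp (s\<^sup>2 * \<kappa> / 2)) has_real_derivative s * \<kappa> * exp (s\<^sup>2 * \<kappa> / 2)) (at s)"
      by (auto intro!: derivative_eq_intros)
    then have "((\<lambda>s. complex_of_real (exp (s\<^sup>2 * \<kappa> / 2))) has_vector_derivative of_real (s * \<kappa> * exp (s\<^sup>2 * \<kappa> / 2))) (at s)"
      by (intro bounded_linear.has_vector_derivative[OF bounded_linear_of_real])
        (simp add: has_real_derivative_iff_has_vector_derivative)
    from has_vector_derivative_mult[OF df[of s] this] show ?thesis
      unfolding h_def[abs_def] by (simp add: algebra_simps)
  qed
  then obtain k where k: "\<And>s. h s = k"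
    using has_derivative_zero_constant[of UNIV h] by (auto simp: has_vector_derivative_def)
  have "h 1 = 1" using k[of 1] k[of 0] by (simp add: h_def f_def prob_space)
  then have "f 1 * of_real (exp (\<kappa> / 2)) * of_real (exp (- \<kappa> / 2)) = of_real (exp (- \<kappa> / 2))"
    by (simp add: h_def)
  then have "f 1 = of_real (exp (- \<kappa> / 2))"
    by (simp add: mult.assoc exp_add[symmetric] flip: of_real_mult)
  then show "(\<integral>\<omega>. iexp (c \<bullet> X \<omega>) \<partial>P) = of_real (exp (- (\<integral>\<omega>. (c \<bullet> X \<omega>)\<^sup>2 \<partial>P) / 2))"
    by (simp add: f_def \<kappa>_def)
qed

end

section \<open>Bayes' formula for the conditional laws\<close>

context linear_gaussian_observation
begin

definition W :: "'a \<Rightarrow> real^'q" where "W \<omega> = Z *v X \<omega>"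

lemma W_measurable[measurable]: "W \<in> borel_measurable P"
  unfolding W_def[abs_def] by measurable

lemma Y_eq_W: "Y \<omega> = W \<omega> + \<epsilon> \<omega>"
  by (simp add: Y W_def)

definition G :: "real^'q^'q" where "G = moore_penrose V"

lemma VGV: "V ** G ** V = V" and VG_symmetric: "transpose (V ** G) = V ** G"
  using is_moore_penrose_moore_penrose[of V] by (auto simp: is_moore_penrose_def G_def)

lemma VVG: "V ** (V ** G) = V"
proof -
  have "transpose (V ** (V ** G)) = V"
    by (simp add: matrix_transpose_mul[of V "V ** G"] VG_symmetric V_symmetric VGV)
  then show ?thesis by (metis V_symmetric transpose_transpose)
qed

lemma V_self_adjoint: "a \<bullet> (V *v b) = (V *v a) \<bullet> b"
  by (simp add: inner_matrix V_symmetric)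

text \<open>The map \<open>1 - V G\<close> is the orthogonal projection onto the kernel of the symmetric matrix \<open>V\<close>.\<close>

lemma AE_range_V_if_kernel:
  fixes U :: "'a \<Rightarrow> real^'q"
  assumes ker: "\<And>t. V *v t = 0 \<Longrightarrow> AE \<omega> in P. t \<bullet> U \<omega> = 0"
  shows "AE \<omega> in P. V *v (G *v U \<omega>) = U \<omega>"
proof (rule AE_eq_if_inner)
  fix a
  define t where "t = a - (V ** G) *v a"
  have "V *v t = 0"
    by (simp add: t_def matrix_vector_mult_diff_distrib matrix_vector_mul_assoc VVG)
  then have ae: "AE \<omega> in P. t \<bullet> U \<omega> = 0" by (rule ker)
  have t: "t \<bullet> x = a \<bullet> x - a \<bullet> (V *v (G *v x))" for x
    using inner_matrix[of a "V ** G" x] by (simp add: t_def inner_diff_left VG_symmetric matrix_vector_mul_assoc)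
  show "AE \<omega> in P. a \<bullet> (V *v (G *v U \<omega>)) = a \<bullet> U \<omega>"
    using ae by eventually_elim (simp only: t right_minus_eq)
qed

lemma \<epsilon>_kernel: "V *v t = 0 \<Longrightarrow> AE \<omega> in P. t \<bullet> \<epsilon> \<omega> = 0"
  using variance_inner_\<epsilon>[of t] by (intro AE_0_if_square_integral_0 square_integrable_inner_\<epsilon>) auto

text \<open>For \<open>t\<close> in the kernel of \<open>V\<close> the noise does not contribute to \<open>t \<bullet> Y = t \<bullet> W\<close>. Invertibility of
  \<open>1 - M Z\<close> gives a functional of \<open>R\<close> whose part in \<open>X\<close> is also \<open>t \<bullet> W\<close>; orthogonality of the two then
  makes the variance of \<open>t \<bullet> W\<close> vanish.\<close>

lemma W_kernel:
  assumes "V *v t = 0"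
  shows "AE \<omega> in P. t \<bullet> W \<omega> = 0"
proof -
  define c where "c = transpose Z *v t"
  have W: "t \<bullet> W \<omega> = c \<bullet> X \<omega>" for \<omega> by (simp add: W_def c_def inner_matrix)
  obtain a where a: "transpose (mat 1 - M ** Z) *v a = c" by (rule IMZ_transpose_surj)
  define d where "d = transpose M *v a"
  have R: "a \<bullet> R \<omega> = c \<bullet> X \<omega> - d \<bullet> \<epsilon> \<omega>" for \<omega> by (simp add: inner_R a d_def)
  have "0 = (\<integral>\<omega>. (a \<bullet> R \<omega>) * (t \<bullet> Y \<omega>) \<partial>P)" by (simp add: R_orthogonal)
  also have "\<dots> = (\<integral>\<omega>. (c \<bullet> X \<omega>)\<^sup>2 - (c \<bullet> X \<omega>) * (d \<bullet> \<epsilon> \<omega>) \<partial>P)"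
  proof (rule integral_cong_AE)
    show "AE \<omega> in P. (a \<bullet> R \<omega>) * (t \<bullet> Y \<omega>) = (c \<bullet> X \<omega>)\<^sup>2 - (c \<bullet> X \<omega>) * (d \<bullet> \<epsilon> \<omega>)"
      using \<epsilon>_kernel[OF assms]
      by eventually_elim (simp add: R inner_Y c_def[symmetric] algebra_simps power2_eq_square)
  qed measurable
  also have "\<dots> = (\<integral>\<omega>. (c \<bullet> X \<omega>)\<^sup>2 \<partial>P)"
    using square_integrable_inner_X X_\<epsilon>_uncorrelated by simp
  finally show ?thesis
    unfolding W by (intro AE_0_if_square_integral_0 square_integrable_inner_X) auto
qed

lemma AE_W_range: "AE \<omega> in P. V *v (G *v W \<omega>) = W \<omega>"
  by (rule AE_range_V_if_kernel[OF W_kernel])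

lemma AE_\<epsilon>_range: "AE \<omega> in P. V *v (G *v \<epsilon> \<omega>) = \<epsilon> \<omega>"
  by (rule AE_range_V_if_kernel[OF \<epsilon>_kernel])

definition \<gamma> :: "(real^'q) measure" where "\<gamma> = distr P borel \<epsilon>"

text \<open>The factor \<open>exp (w \<bullet> G y - (G w \<bullet> w) / 2)\<close> is the density of the law of \<open>w + \<epsilon>\<close> with respect to that of
  \<open>\<epsilon>\<close>, if \<open>w\<close> and \<open>y\<close> are in the range of \<open>V\<close>. The part that does not depend on \<open>y\<close> is absorbed here;
  the other one is the exponential family with the natural parameter \<open>\<eta> = G y\<close>.\<close>

definition \<nu> :: "(real^'q) measure" where
  "\<nu> = density (distr P borel W) (\<lambda>w. ennreal (exp (- ((G *v w) \<bullet> w) / 2)))"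

lemma sets_\<gamma>[measurable_cong, simp]: "sets \<gamma> = sets borel"
  by (simp add: \<gamma>_def)

lemma sets_\<nu>[measurable_cong, simp]: "sets \<nu> = sets borel"
  by (simp add: \<nu>_def)

lemma prob_space_\<gamma>: "prob_space \<gamma>"
  unfolding \<gamma>_def by (rule prob_space_distr) simp

lemma nn_integral_\<nu>:
  assumes [measurable]: "f \<in> borel_measurable borel"
  shows "(\<integral>\<^sup>+ w. f w \<partial>\<nu>) = (\<integral>\<^sup>+ \<omega>. ennreal (exp (- ((G *v W \<omega>) \<bullet> W \<omega>) / 2)) * f (W \<omega>) \<partial>P)"
  unfolding \<nu>_def by (subst nn_integral_density; simp) (subst nn_integral_distr; simp)

lemma AE_\<nu>_range: "AE w in \<nu>. V *v (G *v w) = w"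
proof -
  have "{w \<in> space borel. V *v (G *v w) = w} \<in> sets borel" by measurable
  then have "AE w in distr P borel W. V *v (G *v w) = w"
    using AE_W_range by (subst AE_distr_iff) auto
  then show ?thesis unfolding \<nu>_def by (subst AE_density) auto
qed

lemma AE_\<gamma>_range: "AE y in \<gamma>. V *v (G *v y) = y"
proof -
  have "{w \<in> space borel. V *v (G *v w) = w} \<in> sets borel" by measurable
  then show ?thesis
    using AE_\<epsilon>_range unfolding \<gamma>_def by (subst AE_distr_iff) auto
qed

text \<open>This is \<open>0 \<le> (\<eta> - G w) \<bullet> V (\<eta> - G w)\<close>. It is the reason why \<open>\<nu>\<close> has all exponential moments, although
  only second moments of \<open>W\<close> are finite a priori.\<close>

lemma completed_square_bound:
  assumes w: "V *v (G *v w) = w"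
  shows "w \<bullet> \<eta> - ((G *v w) \<bullet> w) / 2 \<le> (\<eta> \<bullet> (V *v \<eta>)) / 2"
proof -
  define \<theta> where "\<theta> = G *v w"
  have w': "V *v \<theta> = w" using w by (simp add: \<theta>_def)
  have "0 \<le> (\<eta> - \<theta>) \<bullet> (V *v (\<eta> - \<theta>))" by (rule V_nonneg)
  also have "\<dots> = \<eta> \<bullet> (V *v \<eta>) - 2 * (w \<bullet> \<eta>) + \<theta> \<bullet> w"
    using V_self_adjoint[of \<theta> \<eta>]
    by (simp add: matrix_vector_mult_diff_distrib w' inner_diff_left inner_diff_right inner_commute[of \<eta> w])
  finally show ?thesis by (simp add: \<theta>_def)
qed

sublocale E: exponential_family \<nu>
proof
  show "sets \<nu> = sets borel" by simp
  have "AE \<omega> in P. ennreal (exp (- ((G *v W \<omega>) \<bullet> W \<omega>) / 2)) \<noteq> 0" by simp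
  then have "(\<integral>\<^sup>+ \<omega>. ennreal (exp (- ((G *v W \<omega>) \<bullet> W \<omega>) / 2)) * 1 \<partial>P) \<noteq> 0"
    by (subst nn_integral_0_iff_AE) auto
  then have "(\<integral>\<^sup>+ w. 1 \<partial>\<nu>) \<noteq> 0"
    by (subst nn_integral_\<nu>) auto
  then show "emeasure \<nu> (space \<nu>) \<noteq> 0" by simp
  fix \<eta>
  show "integrable \<nu> (\<lambda>w. exp (w \<bullet> \<eta>))"
  proof (rule integrableI_nonneg)
    have "(\<integral>\<^sup>+ w. ennreal (exp (w \<bullet> \<eta>)) \<partial>\<nu>) =
        (\<integral>\<^sup>+ \<omega>. ennreal (exp (- ((G *v W \<omega>) \<bullet> W \<omega>) / 2)) * ennreal (exp (W \<omega> \<bullet> \<eta>)) \<partial>P)"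
      by (rule nn_integral_\<nu>) measurable
    also have "\<dots> \<le> (\<integral>\<^sup>+ \<omega>. ennreal (exp ((\<eta> \<bullet> (V *v \<eta>)) / 2)) \<partial>P)"
    proof (rule nn_integral_mono_AE)
      show "AE \<omega> in P. ennreal (exp (- ((G *v W \<omega>) \<bullet> W \<omega>) / 2)) * ennreal (exp (W \<omega> \<bullet> \<eta>))
          \<le> ennreal (exp ((\<eta> \<bullet> (V *v \<eta>)) / 2))"
        using AE_W_range
      proof eventually_elim
        case (elim \<omega>)
        show ?case
          using completed_square_bound[OF elim, of \<eta>]
          by (simp add: ennreal_mult'[symmetric] exp_add[symmetric])
      qed
    qed
    also have "\<dots> < \<infinity>" by (simp add: emeasure_space_1)
    finally show "(\<integral>\<^sup>+ w. ennreal (exp (w \<bullet> \<eta>)) \<partial>\<nu>) < \<infinity>" .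
  qed simp_all
qed

definition L :: "real^'q \<Rightarrow> real" where "L \<eta> = exp_moment \<nu> 0 0 \<eta>"

lemma L_pos: "0 < L \<eta>"
  unfolding L_def by (rule E.exp_moment_pos)

lemma nn_integral_L: "(\<integral>\<^sup>+ w. ennreal (exp (w \<bullet> \<eta>)) \<partial>\<nu>) = ennreal (L \<eta>)"
  by (simp add: L_def exp_moment_def nn_integral_eq_integral[OF E.integrable_exp])

lemma finite_measure_\<nu>: "finite_measure \<nu>"
  using E.integrable_exp[of 0] by (auto intro!: finite_measureI simp: integrable_iff_bounded)

text \<open>Given \<open>W = w\<close>, the law of \<open>Y\<close> is the noise law shifted by \<open>w\<close>, which the Cameron--Martin theorem
  turns into a density with respect to the fixed measure \<open>\<gamma>\<close>. Then the integrals are interchanged.\<close>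

theorem bayes_formula:
  fixes F :: "real^'q \<Rightarrow> real^'q \<Rightarrow> ennreal"
  assumes F[measurable]: "(\<lambda>(w, y). F w y) \<in> borel_measurable (borel \<Otimes>\<^sub>M borel)"
  shows "(\<integral>\<^sup>+ \<omega>. F (W \<omega>) (Y \<omega>) \<partial>P) =
    (\<integral>\<^sup>+ y. \<integral>\<^sup>+ w. F w y * ennreal (exp (w \<bullet> (G *v y))) \<partial>\<nu> \<partial>\<gamma>)"
proof -
  define \<mu> where "\<mu> = distr P borel W"
  have s\<mu>[measurable_cong, simp]: "sets \<mu> = sets borel" by (simp add: \<mu>_def)
  interpret \<mu>: prob_space \<mu> unfolding \<mu>_def by (rule prob_space_distr) simp
  interpret \<gamma>: prob_space \<gamma> by (rule prob_space_\<gamma>)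
  interpret \<mu>\<gamma>: pair_sigma_finite \<mu> \<gamma> ..
  have range_\<mu>: "AE w in \<mu>. V *v (G *v w) = w"
  proof -
    have "{w \<in> space borel. V *v (G *v w) = w} \<in> sets borel" by measurable
    then show ?thesis using AE_W_range unfolding \<mu>_def by (subst AE_distr_iff) auto
  qed
  have "indep_var borel W borel \<epsilon>"
    unfolding W_def[abs_def] by (rule indep_var_of_X_\<epsilon>[of "\<lambda>x. Z *v x" "\<lambda>x. x"]) measurable
  then have joint: "distr P (borel \<Otimes>\<^sub>M borel) (\<lambda>\<omega>. (W \<omega>, \<epsilon> \<omega>)) = \<mu> \<Otimes>\<^sub>M \<gamma>"
    unfolding indep_var_distribution_eq \<mu>_def \<gamma>_def by metis
  have shift: "(\<integral>\<^sup>+ e. F w (w + e) \<partial>\<gamma>) = (\<integral>\<^sup>+ y. ennreal (exp ((G *v w) \<bullet> y - ((G *v w) \<bullet> w) / 2)) * F w y \<partial>\<gamma>)"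
    if w: "V *v (G *v w) = w" for w
  proof -
    have "(\<integral>\<^sup>+ e. F w (w + e) \<partial>\<gamma>) = (\<integral>\<^sup>+ y. F w y \<partial>distr \<gamma> borel (\<lambda>y. y + V *v (G *v w)))"
      by (subst nn_integral_distr) (auto simp: w add.commute)
    also have "distr \<gamma> borel (\<lambda>y. y + V *v (G *v w)) =
        density \<gamma> (\<lambda>y. ennreal (exp ((G *v w) \<bullet> y - ((G *v w) \<bullet> w) / 2)))"
      using cameron_martin[OF normal_\<epsilon> prob_space_\<gamma>[unfolded \<gamma>_def], of "G *v w"] unfolding \<gamma>_def w .
    also have "(\<integral>\<^sup>+ y. F w y \<partial>\<dots>) = (\<integral>\<^sup>+ y. ennreal (exp ((G *v w) \<bullet> y - ((G *v w) \<bullet> w) / 2)) * F w y \<partial>\<gamma>)"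
      by (subst nn_integral_density) auto
    finally show ?thesis .
  qed
  have "(\<integral>\<^sup>+ \<omega>. F (W \<omega>) (Y \<omega>) \<partial>P) = (\<integral>\<^sup>+ z. (case z of (w, e) \<Rightarrow> F w (w + e)) \<partial>(\<mu> \<Otimes>\<^sub>M \<gamma>))"
    unfolding joint[symmetric] by (subst nn_integral_distr) (auto simp: Y_eq_W)
  also have "\<dots> = (\<integral>\<^sup>+ w. \<integral>\<^sup>+ e. F w (w + e) \<partial>\<gamma> \<partial>\<mu>)"
    by (subst \<gamma>.nn_integral_fst[symmetric]) auto
  also have "\<dots> = (\<integral>\<^sup>+ w. \<integral>\<^sup>+ y. ennreal (exp ((G *v w) \<bullet> y - ((G *v w) \<bullet> w) / 2)) * F w y \<partial>\<gamma> \<partial>\<mu>)"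
    by (rule nn_integral_cong_AE, use range_\<mu> in eventually_elim) (rule shift)
  also have "\<dots> = (\<integral>\<^sup>+ y. \<integral>\<^sup>+ w. ennreal (exp ((G *v w) \<bullet> y - ((G *v w) \<bullet> w) / 2)) * F w y \<partial>\<mu> \<partial>\<gamma>)"
    by (rule \<mu>\<gamma>.Fubini'[symmetric]) measurable
  also have "\<dots> = (\<integral>\<^sup>+ y. \<integral>\<^sup>+ w. F w y * ennreal (exp (w \<bullet> (G *v y))) \<partial>\<nu> \<partial>\<gamma>)"
  proof (rule nn_integral_cong_AE)
    show "AE y in \<gamma>. (\<integral>\<^sup>+ w. ennreal (exp ((G *v w) \<bullet> y - ((G *v w) \<bullet> w) / 2)) * F w y \<partial>\<mu>) =
        (\<integral>\<^sup>+ w. F w y * ennreal (exp (w \<bullet> (G *v y))) \<partial>\<nu>)"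
      using AE_\<gamma>_range
    proof eventually_elim
      case (elim y)
      have "AE w in \<mu>. ennreal (exp ((G *v w) \<bullet> y - ((G *v w) \<bullet> w) / 2)) * F w y =
          ennreal (exp (- ((G *v w) \<bullet> w) / 2)) * (F w y * ennreal (exp (w \<bullet> (G *v y))))"
        using range_\<mu>
      proof eventually_elim
        case (elim w)
        have "(G *v w) \<bullet> y = w \<bullet> (G *v y)"
          using V_self_adjoint[of "G *v w" "G *v y"] \<open>V *v (G *v y) = y\<close> elim by simp
        then have "exp ((G *v w) \<bullet> y - ((G *v w) \<bullet> w) / 2) = exp (- ((G *v w) \<bullet> w) / 2) * exp (w \<bullet> (G *v y))"
          by (simp add: exp_add[symmetric])
        then show ?case by (simp add: ennreal_mult' mult_ac)
      qed
      then show ?case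
        unfolding \<nu>_def \<mu>_def[symmetric] by (subst nn_integral_density) (simp_all add: nn_integral_cong_AE)
    qed
  qed
  finally show ?thesis .
qed

lemma nn_cond_exp_formula:
  fixes F :: "real^'q \<Rightarrow> real^'q \<Rightarrow> ennreal"
  assumes F[measurable]: "(\<lambda>(w, y). F w y) \<in> borel_measurable (borel \<Otimes>\<^sub>M borel)"
  shows "AE \<omega> in P. (\<integral>\<^sup>+ w. F w (Y \<omega>) * ennreal (exp (w \<bullet> (G *v Y \<omega>))) \<partial>\<nu>) * ennreal (1 / L (G *v Y \<omega>)) =
    nn_cond_exp P \<F> (\<lambda>\<omega>. F (W \<omega>) (Y \<omega>)) \<omega>"
proof (rule F.nn_cond_exp_charact)
  interpret \<nu>: finite_measure \<nu> by (rule finite_measure_\<nu>)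
  define I where "I y = (\<integral>\<^sup>+ w. F w y * ennreal (exp (w \<bullet> (G *v y))) \<partial>\<nu>)" for y
  have I[measurable]: "I \<in> borel_measurable borel"
    unfolding I_def[abs_def] by measurable
  have Lm[measurable]: "L \<in> borel_measurable borel"
    unfolding L_def[abs_def] by (rule borel_measurable_continuous_onI[OF E.continuous_exp_moment])
  let ?g = "\<lambda>y. I y * ennreal (1 / L (G *v y))"
  show "(\<lambda>\<omega>. (\<integral>\<^sup>+ w. F w (Y \<omega>) * ennreal (exp (w \<bullet> (G *v Y \<omega>))) \<partial>\<nu>) * ennreal (1 / L (G *v Y \<omega>))) \<in> borel_measurable \<F>"
    unfolding I_def[symmetric] by (rule measurable_generated_sigma[of ?g]) measurable
  show "(\<lambda>\<omega>. F (W \<omega>) (Y \<omega>)) \<in> borel_measurable P" by measurable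
  fix A assume A: "A \<in> sets \<F>"
  then obtain B where B[measurable]: "B \<in> sets borel" and AB: "A = Y -` B \<inter> space P"
    by (rule sets_generated_sigmaE)
  have ind: "indicator A \<omega> = (indicator B (Y \<omega>) :: ennreal)" if "\<omega> \<in> space P" for \<omega>
    using that by (simp add: AB indicator_def)
  have "(\<integral>\<^sup>+ \<omega>\<in>A. F (W \<omega>) (Y \<omega>) \<partial>P) = (\<integral>\<^sup>+ \<omega>. F (W \<omega>) (Y \<omega>) * indicator B (Y \<omega>) \<partial>P)"
    by (rule nn_integral_cong) (simp add: ind)
  also have "\<dots> = (\<integral>\<^sup>+ y. \<integral>\<^sup>+ w. (F w y * indicator B y) * ennreal (exp (w \<bullet> (G *v y))) \<partial>\<nu> \<partial>\<gamma>)"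
    by (rule bayes_formula) measurable
  also have "\<dots> = (\<integral>\<^sup>+ y. indicator B y * I y \<partial>\<gamma>)"
    unfolding I_def by (subst nn_integral_cmult[symmetric]) (auto simp: mult_ac)
  also have "\<dots> = (\<integral>\<^sup>+ y. (?g y * indicator B y) * ennreal (L (G *v y)) \<partial>\<gamma>)"
  proof (rule nn_integral_cong)
    fix y
    have "ennreal (1 / L (G *v y)) * ennreal (L (G *v y)) = 1"
      using L_pos[of "G *v y"] by (simp add: ennreal_mult'[symmetric])
    then show "indicator B y * I y = (?g y * indicator B y) * ennreal (L (G *v y))"
      by (metis mult.assoc mult.commute mult.right_neutral)
  qed
  also have "\<dots> = (\<integral>\<^sup>+ y. \<integral>\<^sup>+ w. (?g y * indicator B y) * ennreal (exp (w \<bullet> (G *v y))) \<partial>\<nu> \<partial>\<gamma>)"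
    by (subst nn_integral_cmult) (auto simp: nn_integral_L)
  also have "\<dots> = (\<integral>\<^sup>+ \<omega>. ?g (Y \<omega>) * indicator B (Y \<omega>) \<partial>P)"
    by (rule bayes_formula[of "\<lambda>w y. ?g y * indicator B y", symmetric]) measurable
  also have "\<dots> = (\<integral>\<^sup>+ \<omega>\<in>A. ?g (Y \<omega>) \<partial>P)"
    by (rule nn_integral_cong) (simp add: ind)
  finally show "(\<integral>\<^sup>+ \<omega>\<in>A. F (W \<omega>) (Y \<omega>) \<partial>P) =
      (\<integral>\<^sup>+ \<omega>\<in>A. ((\<integral>\<^sup>+ w. F w (Y \<omega>) * ennreal (exp (w \<bullet> (G *v Y \<omega>))) \<partial>\<nu>) * ennreal (1 / L (G *v Y \<omega>))) \<partial>P)"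
    unfolding I_def .
qed

text \<open>Conditionally on \<open>Y = y\<close>, the vector \<open>W\<close> follows the member of the exponential family with the
  parameter \<open>G y\<close>. Integrability is only required under these conditional laws; \<open>f W Y\<close> itself may
  fail to be integrable.\<close>

theorem real_cond_exp_formula:
  fixes f :: "real^'q \<Rightarrow> real^'q \<Rightarrow> real"
  assumes f[measurable]: "(\<lambda>(w, y). f w y) \<in> borel_measurable (borel \<Otimes>\<^sub>M borel)"
    and int: "\<And>y. integrable \<nu> (\<lambda>w. f w y * exp (w \<bullet> (G *v y)))"
  shows "AE \<omega> in P. real_cond_exp P \<F> (\<lambda>\<omega>. f (W \<omega>) (Y \<omega>)) \<omega> =
    (\<integral>w. f w (Y \<omega>) * exp (w \<bullet> (G *v Y \<omega>)) \<partial>\<nu>) / L (G *v Y \<omega>)"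
proof -
  have "AE \<omega> in P. (\<integral>\<^sup>+ w. ennreal (f w (Y \<omega>)) * ennreal (exp (w \<bullet> (G *v Y \<omega>))) \<partial>\<nu>) * ennreal (1 / L (G *v Y \<omega>)) =
      nn_cond_exp P \<F> (\<lambda>\<omega>. ennreal (f (W \<omega>) (Y \<omega>))) \<omega>"
    by (rule nn_cond_exp_formula) measurable
  moreover have "AE \<omega> in P. (\<integral>\<^sup>+ w. ennreal (- f w (Y \<omega>)) * ennreal (exp (w \<bullet> (G *v Y \<omega>))) \<partial>\<nu>) * ennreal (1 / L (G *v Y \<omega>)) =
      nn_cond_exp P \<F> (\<lambda>\<omega>. ennreal (- f (W \<omega>) (Y \<omega>))) \<omega>"
    by (rule nn_cond_exp_formula) measurable
  ultimately show ?thesis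
  proof eventually_elim
    case (elim \<omega>)
    show ?case
      unfolding real_cond_exp_def elim[symmetric] real_lebesgue_integral_def[OF int] enn2real_mult
      using L_pos[of "G *v Y \<omega>"]
      by (simp add: ennreal_mult''[symmetric] diff_divide_distrib)
  qed
qed

end

section \<open>Vanishing third moments force a linear filter\<close>

context linear_gaussian_observation
begin

lemma exp_moment_eq_L: "exp_moment \<nu> c 0 \<eta> = L \<eta>"
  by (simp add: L_def E.exp_moment_0[of c \<eta> 0])

lemma mean_measurable[measurable]: "E.mean c \<in> borel_measurable borel"
  unfolding E.mean_def[abs_def]
  by (intro borel_measurable_divide borel_measurable_continuous_onI E.continuous_exp_moment)

lemma continuous_third_cumulant: "continuous_on UNIV (E.third_cumulant c)"
proof -
  have nz: "exp_moment \<nu> c 0 \<eta> \<noteq> 0" for \<eta>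
    using E.exp_moment_pos[of c \<eta>] by simp
  show ?thesis
    unfolding E.third_cumulant_def[abs_def] E.mean_def
    by (intro continuous_intros E.continuous_exp_moment) (use nz in auto)
qed

lemma cond_exp_W:
  "AE \<omega> in P. real_cond_exp P \<F> (\<lambda>\<omega>. c \<bullet> W \<omega>) \<omega> = E.mean c (G *v Y \<omega>)"
proof -
  have int: "integrable \<nu> (\<lambda>w. (w \<bullet> c) * exp (w \<bullet> \<eta>))" for \<eta>
    using E.integrable_exp_moment[of c 1 \<eta>] by simp
  have "AE \<omega> in P. real_cond_exp P \<F> (\<lambda>\<omega>. W \<omega> \<bullet> c) \<omega> =
      (\<integral>w. (w \<bullet> c) * exp (w \<bullet> (G *v Y \<omega>)) \<partial>\<nu>) / L (G *v Y \<omega>)"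
    by (rule real_cond_exp_formula[OF _ int]) measurable
  then show ?thesis
    by (simp add: E.mean_def exp_moment_def[of \<nu> c "Suc 0"] exp_moment_eq_L inner_commute)
qed

lemma inner_X_eq_inner_W:
  obtains c where "\<And>\<omega>. a \<bullet> X \<omega> = c \<bullet> W \<omega>"
proof -
  obtain c where "transpose Z *v c = a" by (rule Z_transpose_surj)
  then have "a \<bullet> X \<omega> = c \<bullet> W \<omega>" for \<omega> by (simp add: W_def inner_matrix)
  then show ?thesis by (rule that)
qed

lemma cond_third_moment:
  assumes c: "\<And>\<omega>. e \<bullet> X \<omega> = c \<bullet> W \<omega>"
  shows "AE \<omega> in P. real_cond_exp P \<F> (\<lambda>\<omega>. (e \<bullet> (X \<omega> - cond_exp_vec P X Y \<omega>)) ^ 3) \<omega> =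
    E.third_cumulant c (G *v Y \<omega>)"
proof -
  define f where "f w y = (w \<bullet> c - E.mean c (G *v y)) ^ 3" for w y
  have fm[measurable]: "(\<lambda>(w, y). f w y) \<in> borel_measurable (borel \<Otimes>\<^sub>M borel)"
    unfolding f_def by measurable
  have int: "integrable \<nu> (\<lambda>w. f w y * exp (w \<bullet> (G *v y)))" for y
  proof -
    let ?m = "E.mean c (G *v y)" and ?\<eta> = "G *v y"
    have "f w y * exp (w \<bullet> ?\<eta>) = (w \<bullet> c) ^ 3 * exp (w \<bullet> ?\<eta>) - 3 * ?m * ((w \<bullet> c) ^ 2 * exp (w \<bullet> ?\<eta>))
        + 3 * ?m ^ 2 * ((w \<bullet> c) ^ 1 * exp (w \<bullet> ?\<eta>)) - ?m ^ 3 * ((w \<bullet> c) ^ 0 * exp (w \<bullet> ?\<eta>))" for w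
      by (simp add: f_def algebra_simps power3_eq_cube power2_eq_square)
    then show ?thesis
      by (simp only: E.integrable_exp_moment Bochner_Integration.integrable_add
          Bochner_Integration.integrable_diff integrable_mult_right)
  qed
  have "AE \<omega> in P. real_cond_exp P \<F> (\<lambda>\<omega>. (e \<bullet> (X \<omega> - cond_exp_vec P X Y \<omega>)) ^ 3) \<omega> =
      real_cond_exp P \<F> (\<lambda>\<omega>. f (W \<omega>) (Y \<omega>)) \<omega>"
  proof (rule F.real_cond_exp_cong)
    show "AE \<omega> in P. (e \<bullet> (X \<omega> - cond_exp_vec P X Y \<omega>)) ^ 3 = f (W \<omega>) (Y \<omega>)"
      using inner_cond_exp_vec[of e] cond_exp_W[of c]
      by eventually_elim (simp add: f_def inner_diff_right c inner_commute)
  qed measurable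
  moreover have "AE \<omega> in P. real_cond_exp P \<F> (\<lambda>\<omega>. f (W \<omega>) (Y \<omega>)) \<omega> =
      (\<integral>w. f w (Y \<omega>) * exp (w \<bullet> (G *v Y \<omega>)) \<partial>\<nu>) / L (G *v Y \<omega>)"
    by (rule real_cond_exp_formula[OF fm int])
  ultimately show ?thesis
  proof eventually_elim
    case (elim \<omega>)
    then show ?case
      using E.third_cumulant_eq[of c "G *v Y \<omega>"] by (simp add: f_def exp_moment_eq_L)
  qed
qed

text \<open>The law of \<open>Y\<close> has the strictly positive density \<open>L (G y)\<close> with respect to \<open>\<gamma>\<close>.\<close>

lemma AE_\<gamma>_if_AE_Y:
  assumes ae: "AE \<omega> in P. Q (Y \<omega>)" and [measurable]: "Measurable.pred borel Q"
  shows "AE y in \<gamma>. Q y"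
proof -
  interpret \<nu>: finite_measure \<nu> by (rule finite_measure_\<nu>)
  have [measurable]: "{y. \<not> Q y} \<in> sets borel"
    using assms(2) by (simp add: pred_def)
  have Lm[measurable]: "L \<in> borel_measurable borel"
    unfolding L_def[abs_def] by (rule borel_measurable_continuous_onI[OF E.continuous_exp_moment])
  have "0 = (\<integral>\<^sup>+ \<omega>. indicator {y. \<not> Q y} (Y \<omega>) \<partial>P)"
    using ae by (subst eq_commute, subst nn_integral_0_iff_AE) (auto elim!: eventually_mono)
  also have "\<dots> = (\<integral>\<^sup>+ y. \<integral>\<^sup>+ w. indicator {y. \<not> Q y} y * ennreal (exp (w \<bullet> (G *v y))) \<partial>\<nu> \<partial>\<gamma>)"
    by (rule bayes_formula) measurable
  also have "\<dots> = (\<integral>\<^sup>+ y. indicator {y. \<not> Q y} y * ennreal (L (G *v y)) \<partial>\<gamma>)"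
    by (subst nn_integral_cmult) (auto simp: nn_integral_L)
  finally have "AE y in \<gamma>. indicator {y. \<not> Q y} y * ennreal (L (G *v y)) = 0"
    by (subst (asm) eq_commute, subst (asm) nn_integral_0_iff_AE) auto
  then show ?thesis
  proof eventually_elim
    case (elim y)
    then show ?case
      using L_pos[of "G *v y"] by (auto simp: indicator_def split: if_splits)
  qed
qed

lemma AE_\<gamma>_shift:
  assumes ae: "AE y in \<gamma>. Q y" and [measurable]: "Measurable.pred borel Q"
  shows "AE y in \<gamma>. Q (y + V *v \<theta>)"
proof -
  have "AE y in distr \<gamma> borel (\<lambda>y. y + V *v \<theta>). Q y"
    unfolding cameron_martin[OF normal_\<epsilon> prob_space_\<gamma>[unfolded \<gamma>_def], folded \<gamma>_def]
    using ae by (subst AE_density) auto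
  then show ?thesis by (rule AE_distrD[rotated]) measurable
qed

text \<open>The map \<open>G V\<close> acts like the identity when paired with the range of \<open>V\<close>, on which \<open>\<nu>\<close> is
  concentrated.\<close>

lemma exp_moment_shift: "exp_moment \<nu> c k (\<eta> + G *v (V *v \<theta>)) = exp_moment \<nu> c k (\<eta> + \<theta>)"
  unfolding exp_moment_def
proof (rule integral_cong_AE)
  show "AE w in \<nu>. (w \<bullet> c) ^ k * exp (w \<bullet> (\<eta> + G *v (V *v \<theta>))) = (w \<bullet> c) ^ k * exp (w \<bullet> (\<eta> + \<theta>))"
    using AE_\<nu>_range
  proof eventually_elim
    case (elim w)
    have "w \<bullet> (G *v (V *v \<theta>)) = (G *v w) \<bullet> ((V ** G ** V) *v \<theta>)"
      using V_self_adjoint[of "G *v w" "G *v (V *v \<theta>)"] elim by (simp add: matrix_vector_mul_assoc matrix_mul_assoc)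
    also have "\<dots> = w \<bullet> \<theta>"
      using V_self_adjoint[of "G *v w" \<theta>] elim by (simp add: VGV)
    finally show ?case by (simp add: inner_add_right)
  qed
qed measurable

lemma third_cumulant_shift: "E.third_cumulant c (\<eta> + G *v (V *v \<theta>)) = E.third_cumulant c (\<eta> + \<theta>)"
  by (simp add: E.third_cumulant_def E.mean_def exp_moment_shift)

text \<open>The noise law is quasi-invariant under shifts by \<open>V \<theta>\<close>, so the almost sure identity holds at
  \<open>G y + \<theta>\<close> for almost every \<open>y\<close>, simultaneously for all \<open>\<theta>\<close> in a countable dense set. One such \<open>y\<close> and
  the continuity of the cumulants give all parameters.\<close>

lemma third_cumulant_0_everywhere:
  assumes ae: "AE \<omega> in P. E.third_cumulant c (G *v Y \<omega>) = 0"
  shows "E.third_cumulant c \<eta> = 0"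
proof -
  interpret \<gamma>: prob_space \<gamma> by (rule prob_space_\<gamma>)
  have [measurable]: "E.third_cumulant c \<in> borel_measurable borel"
    by (rule borel_measurable_continuous_onI[OF continuous_third_cumulant])
  obtain D :: "(real^'q) set" where D: "countable D" "\<And>S. open S \<Longrightarrow> S \<noteq> {} \<Longrightarrow> \<exists>d\<in>D. d \<in> S"
    by (rule countable_dense_setE) blast
  have ae0: "AE y in \<gamma>. E.third_cumulant c (G *v y) = 0"
    by (rule AE_\<gamma>_if_AE_Y[OF ae]) measurable
  have "AE y in \<gamma>. E.third_cumulant c (G *v y + \<theta>) = 0" for \<theta>
    using AE_\<gamma>_shift[OF ae0, of \<theta>]
    by (simp add: matrix_vector_right_distrib third_cumulant_shift)
  then have "AE y in \<gamma>. \<forall>\<theta>\<in>D. E.third_cumulant c (G *v y + \<theta>) = 0"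
    by (simp add: AE_ball_countable[OF D(1)])
  moreover have "ae_filter \<gamma> \<noteq> bot" by (simp add: ae_filter_eq_bot_iff \<gamma>.emeasure_space_1)
  ultimately obtain y where y: "\<forall>\<theta>\<in>D. E.third_cumulant c (G *v y + \<theta>) = 0"
    using eventually_happens' by blast
  let ?N = "{\<theta>. E.third_cumulant c (G *v y + \<theta>) \<noteq> 0}"
  have "continuous_on UNIV (\<lambda>\<theta>. E.third_cumulant c (G *v y + \<theta>))"
    by (rule continuous_on_compose2[OF continuous_third_cumulant]) (auto intro!: continuous_intros)
  then have "open ?N"
    by (intro open_Collect_neq) auto
  then have "?N = {}" using D(2)[of ?N] y by blast
  then have "E.third_cumulant c (G *v y + (\<eta> - G *v y)) = 0" by blast
  then show ?thesis by simp
qed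

text \<open>All conditional means of functionals of \<open>W\<close>, and so those of the coordinates of \<open>X\<close>, are affine
  functions of \<open>G Y\<close>. The constant terms vanish because \<open>X\<close> and \<open>Y\<close> are centered.\<close>

theorem third_moment_0_imp_linear:
  assumes third: "\<And>e. AE \<omega> in P. real_cond_exp P \<F> (\<lambda>\<omega>. (e \<bullet> (X \<omega> - cond_exp_vec P X Y \<omega>)) ^ 3) \<omega> = 0"
  shows "\<exists>A. AE \<omega> in P. cond_exp_vec P X Y \<omega> = A *v Y \<omega>"
proof -
  have "E.third_cumulant c \<eta> = 0" for c \<eta>
  proof (rule third_cumulant_0_everywhere)
    have c: "(transpose Z *v c) \<bullet> X \<omega> = c \<bullet> W \<omega>" for \<omega> by (simp add: W_def inner_matrix)
    show "AE \<omega> in P. E.third_cumulant c (G *v Y \<omega>) = 0"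
      using cond_third_moment[OF c] third[of "transpose Z *v c"] by eventually_elim simp
  qed
  note affine = E.affine_mean_if_third_cumulants_vanish[OF this]
  have "\<exists>a b. AE \<omega> in P. real_cond_exp P \<F> (\<lambda>\<omega>. X \<omega> $ i) \<omega> = a + b \<bullet> (G *v Y \<omega>)" for i
  proof -
    obtain c where c: "\<And>\<omega>. axis i 1 \<bullet> X \<omega> = c \<bullet> W \<omega>" by (rule inner_X_eq_inner_W) blast
    obtain a b where ab: "\<And>\<eta>. E.mean c \<eta> = a + b \<bullet> \<eta>" using affine[of c] by blast
    have "AE \<omega> in P. real_cond_exp P \<F> (\<lambda>\<omega>. X \<omega> $ i) \<omega> = a + b \<bullet> (G *v Y \<omega>)"
      using cond_exp_W[of c] by (simp add: ab c[symmetric] inner_axis')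
    then show ?thesis by blast
  qed
  then obtain a b where ab: "\<And>i. AE \<omega> in P. real_cond_exp P \<F> (\<lambda>\<omega>. X \<omega> $ i) \<omega> = a i + b i \<bullet> (G *v Y \<omega>)"
    by metis
  have a: "a i = 0" for i
  proof -
    have iX: "integrable P (\<lambda>\<omega>. X \<omega> $ i)"
      using integrable_inner_X[of "axis i 1"] by (simp add: inner_axis')
    have "0 = (\<integral>\<omega>. real_cond_exp P \<F> (\<lambda>\<omega>. X \<omega> $ i) \<omega> \<partial>P)"
      using F.real_cond_exp_int(2)[OF iX] centered_X by simp
    also have "\<dots> = (\<integral>\<omega>. a i + (transpose G *v b i) \<bullet> Y \<omega> \<partial>P)"
      by (rule integral_cong_AE) (use ab[of i] in \<open>auto simp: inner_matrix\<close>)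
    also have "\<dots> = a i"
      using integrable_inner_Y mean_inner_Y by (simp add: prob_space)
    finally show ?thesis by simp
  qed
  define B where "B = (\<chi> i. b i)"
  have B: "(B *v x) $ i = b i \<bullet> x" for x i
    by (simp add: B_def matrix_vector_mult_def inner_vec_def)
  have "AE \<omega> in P. \<forall>i\<in>UNIV. real_cond_exp P \<F> (\<lambda>\<omega>. X \<omega> $ i) \<omega> = b i \<bullet> (G *v Y \<omega>)"
    using ab by (intro AE_finite_allI) (auto simp: a)
  then have "AE \<omega> in P. cond_exp_vec P X Y \<omega> = (B ** G) *v Y \<omega>"
    by eventually_elim (simp add: vec_eq_iff cond_exp_vec_def B matrix_vector_mul_assoc[symmetric])
  then show ?thesis by blast
qed

end

section \<open>The equivalence\<close>

theorem proposition3p6: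
  fixes P :: "'a measure"
    and Z :: "real^'p^'q"
    and V :: "real^'q^'q"
    and DX :: "'a \<Rightarrow> real^'p"
    and DY eps :: "'a \<Rightarrow> real^'q"
    and M :: "real^'q^'p"
  assumes P: "prob_space P"
    and DX_measurable: "DX \<in> borel_measurable P"
    and DX_square_integrable: "\<And>i. integrable P (\<lambda>\<omega>. (DX \<omega> $ i)\<^sup>2)"
    and DX_centered: "\<And>i. (\<integral>\<omega>. DX \<omega> $ i \<partial>P) = 0"
    and eps_measurable: "eps \<in> borel_measurable P"
    and eps_normal: "multivariate_normal 0 V (distr P borel eps)"
    and indep: "indep_random_vectors P eps DX"
    and DY: "\<And>\<omega>. DY \<omega> = Z *v DX \<omega> + eps \<omega>"
    and M: "M = cross_covariance P DX DY ** moore_penrose (cross_covariance P DY DY)"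
    and rank_IMZ: "rank (mat 1 - M ** Z) = CARD('p)"
    and dim_eq: "CARD('p) = CARD('q)"
    and rank_Z: "rank Z = CARD('p)"
  shows
    "((\<exists>A :: real^'q^'p. AE \<omega> in P. cond_exp_vec P DX DY \<omega> = A *v DY \<omega>)
        \<longleftrightarrow> is_normal_law (distr P borel DX))
     \<and> (is_normal_law (distr P borel DX)
        \<longleftrightarrow> (\<forall>e :: real^'p. \<exists>m3.
              is_cond_exp_given P (\<lambda>\<omega>. (e \<bullet> (DX \<omega> - cond_exp_vec P DX DY \<omega>)) ^ 3) DY m3 \<and>
              (AE y in distr P borel DY. m3 y = 0)))"
proof -
  interpret prob_space P by (rule P)
  interpret linear_gaussian_observation P Z V DX DY eps M
    by unfold_locales (fact DX_measurable DX_square_integrable DX_centered eps_measurable eps_normal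
        indep DY M rank_IMZ rank_Z)+
  \<comment> \<open>A version \<open>m3\<close> that vanishes almost surely under the law of \<open>DY\<close> exists iff the conditional expectation vanishes almost surely.\<close>
  have third: "(\<exists>m3. is_cond_exp_given P (\<lambda>\<omega>. (e \<bullet> (DX \<omega> - cond_exp_vec P DX DY \<omega>)) ^ 3) DY m3 \<and>
        (AE y in distr P borel DY. m3 y = 0)) \<longleftrightarrow>
      (AE \<omega> in P. real_cond_exp P \<F> (\<lambda>\<omega>. (e \<bullet> (DX \<omega> - cond_exp_vec P DX DY \<omega>)) ^ 3) \<omega> = 0)"
    (is "?L \<longleftrightarrow> ?R") for e
  proof
    assume ?L
    then obtain m3 where m3: "AE \<omega> in P. m3 (DY \<omega>) =
        real_cond_exp P \<F> (\<lambda>\<omega>. (e \<bullet> (DX \<omega> - cond_exp_vec P DX DY \<omega>)) ^ 3) \<omega>"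
      and "AE y in distr P borel DY. m3 y = 0"
      by (auto simp: is_cond_exp_given_def)
    from this(2) have "AE \<omega> in P. m3 (DY \<omega>) = 0"
      by (rule AE_distrD[rotated]) measurable
    with m3 show ?R by eventually_elim simp
  next
    assume ?R
    then show ?L by (intro exI[of _ "\<lambda>_. 0"]) (auto simp: is_cond_exp_given_def)
  qed
  show ?thesis
    unfolding third
    using normal_imp_linear linear_imp_normal normal_imp_third_moment_0 third_moment_0_imp_linear
    by blast
qed

end
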